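(* Let $A\in\mathcal A_{\$}(\mathbf X)$ be a rich band-dominated operator on $\mathbf X=l^p(\mathbb Z^N,X)$ and let $\varepsilon>0$. Then $$\mathrm{sp}_{\varepsilon,\mathrm{ess}}(A)=\bigcup_{A_h\in\sigma_{\rm op}(A)}\mathrm{sp}_\varepsilon(A_h).$$
   Context: Let $N\in\mathbb N$, $p\in\{0\}\cup[1,\infty]$, and let $X\ne\{0\}$ be a complex Banach space. $\mathbf X=l^p(\mathbb Z^N,X)$ is the space of sequences $x=(x_i)_{i\in\mathbb Z^N}$, $x_i\in X$, with the usual $p$-norm for $1\le p\le\infty$; $l^0(\mathbb Z^N,X)$ denotes the closure in $l^\infty(\mathbb Z^N,X)$ of the finitely supported sequences. $\mathcal L(\mathbf X)$ is the algebra of bounded linear operators. $P_n:=\chi_{\{-n,\dots,n\}^N}I$ (multiplication by the characteristic function), $Q_n:=I-P_n$ ($n\in\mathbb N$), $\mathcal P:=(P_n)$. $\mathcal K(\mathbf X,\mathcal P):=\{K\in\mathcal L(\mathbf X):\|Q_nK\|+\|KQ_n\|\to0\}$; $\mathcal L(\mathbf X,\mathcal P):=\{A\in\mathcal L(\mathbf X): AK,KA\in\mathcal K(\mathbf X,\mathcal P)\ \forall K\in\mathcal K(\mathbf X,\mathcal P)\}$, a closed subalgebra of $\mathcal L(\mathbf X)$ containing $\mathcal K(\mathbf X,\mathcal P)$ as a closed two-sided ideal. $(A_n)\subset\mathcal L(\mathbf X)$ converges $\mathcal P$-strongly to $A$ if $\|K(A_n-A)\|+\|(A_n-A)K\|\to0$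 for every $K\in\mathcal K(\mathbf X,\mathcal P)$. Shifts: $(V_kx)_i=x_{i-k}$ for $k\in\mathbb Z^N$. For $A\in\mathcal L(\mathbf X,\mathcal P)$ and a sequence $h=(h_n)\subset\mathbb Z^N$ with $|h_n|\to\infty$, the limit operator $A_h$ is the $\mathcal P$-strong limit of $V_{-h_n}AV_{h_n}$, if it exists. $\sigma_{\rm op}(A)$ is the set of all limit operators of $A$. $A$ is rich if every $h\subset\mathbb Z^N$ tending to infinity has a subsequence $g$ such that $A_g$ exists. A band operator is a finite sum $\sum_\alpha a_\alpha V_\alpha$ with $\alpha\in\mathbb Z^N$, $a_\alpha\in l^\infty(\mathbb Z^N,\mathcal L(X))$ acting by $(a_\alpha x)_i=a_\alpha(i)x_i$. $\mathcal A(\mathbf X)\subset\mathcal L(\mathbf X,\mathcal P)$ is the norm closure in $\mathcal L(\mathbf X)$ of the set of band operators; $\mathcal A_{\$}(\mathbf X)$ is the set of all rich operators in $\mathcal A(\mathbf X)$. Pseudospectra, with the convention $\|b^{-1}\|:=\infty$ if $b$ is not invertible: for $B\in\mathcal L(\mathbf X)$, $\mathrm{sp}_\varepsilon(B):=\{\lambda\in\mathbb C:\|(B-\lambda I)^{-1}\|>1/\varepsilon\}$; for $A\in\mathcal L(\mathbf X,\mathcal P)$, $\mathrm{sp}_{\varepsilon,\mathrm{ess}}(A):=\{\lambda\in\mathbb C:\|(A-\lambda I+\mathcal K(\mathbf X,\mathcal P))^{-1}\|>1/\varepsilon\}$, where the inverse and norm are taken in the quotient algebra $\mathcal L(\mathbf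 X,\mathcal P)/\mathcal K(\mathbf X,\mathcal P)$. *)

theory Defs
  imports
    "HOL-Analysis.Analysis"
    "HOL-Algebra.QuotRing"
    "HOL-Library.Function_Algebras"
begin

class complex_banach = banach +
  fixes scaleC :: "complex \<Rightarrow> 'a \<Rightarrow> 'a"
  assumes scaleC_add_right: "scaleC c (x + y) = scaleC c x + scaleC c y"
    and scaleC_add_left: "scaleC (c + d) x = scaleC c x + scaleC d x"
    and scaleC_scaleC: "scaleC c (scaleC d x) = scaleC (c * d) x"
    and scaleC_of_real: "scaleC (complex_of_real r) x = r *\<^sub>R x"
    and norm_scaleC: "norm (scaleC c x) = cmod c * norm x"

text \<open>
  \<open>\<int>\<^sup>N\<close> is \<^typ>\<open>int ^ 'n\<close> with \<open>N = CARD('n)\<close>. The exponent \<open>p\<close> is an extended real, and the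
  definitions below are only meant for \<open>p = 0\<close> or \<open>1 \<le> p \<le> \<infinity>\<close>. Addition, subtraction
  and zero on sequences and on operators are the pointwise ones of
  \<^theory>\<open>HOL-Library.Function_Algebras\<close>.
\<close>

type_synonym ('n, 'x) seq = "int ^ 'n \<Rightarrow> 'x"
type_synonym ('n, 'x) oper = "('n, 'x) seq \<Rightarrow> ('n, 'x) seq"

definition seq_scaleC :: "complex \<Rightarrow> ('n::finite, 'x::complex_banach) seq \<Rightarrow> ('n, 'x) seq" where
  "seq_scaleC c x = (\<lambda>i. scaleC c (x i))"

definition lp_norm :: "ereal \<Rightarrow> ('n::finite, 'x::complex_banach) seq \<Rightarrow> real" where
  "lp_norm p x =
     (if p = 0 \<or> p = \<infinity> then (SUP i. norm (x i))
      else (\<Sum>\<^sub>\<infinity>i\<in>UNIV. norm (x i) powr real_of_ereal p) powr (1 / real_of_ereal p))"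

definition linf_space :: "('n::finite, 'x::complex_banach) seq set" where
  "linf_space = {x. bounded (range x)}"

text \<open>For \<open>p = 0\<close> this is the closure of the finitely supported sequences in \<open>l\<^sup>\<infinity>\<close>.\<close>

definition lp_space :: "ereal \<Rightarrow> ('n::finite, 'x::complex_banach) seq set" where
  "lp_space p =
     (if p = 0 then {x \<in> linf_space. \<forall>e>0. \<exists>y. finite {i. y i \<noteq> 0} \<and> lp_norm \<infinity> (x - y) < e}
      else if p = \<infinity> then linf_space
      else {x. (\<lambda>i. norm (x i) powr real_of_ereal p) summable_on UNIV})"

text \<open>
  An operator on \<open>l\<^sup>p\<close> is represented by a function on all sequences which is zero
  outside \<open>l\<^sup>p\<close>, so that operators are equal iff they agree on \<open>l\<^sup>p\<close>.
\<close>

definition lp_restrict :: "ereal \<Rightarrow> ('n::finite, 'x::complex_banach) oper \<Rightarrow> ('n, 'x) oper" where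
  "lp_restrict p T = (\<lambda>x. if x \<in> lp_space p then T x else 0)"

definition bounded_ops :: "ereal \<Rightarrow> ('n::finite, 'x::complex_banach) oper set" where
  "bounded_ops p =
     {T. (\<forall>x. x \<notin> lp_space p \<longrightarrow> T x = 0) \<and>
         (\<forall>x\<in>lp_space p. T x \<in> lp_space p) \<and>
         (\<forall>x\<in>lp_space p. \<forall>y\<in>lp_space p. T (x + y) = T x + T y) \<and>
         (\<forall>c. \<forall>x\<in>lp_space p. T (seq_scaleC c x) = seq_scaleC c (T x)) \<and>
         (\<exists>C. \<forall>x\<in>lp_space p. lp_norm p (T x) \<le> C * lp_norm p x)}"

definition opnorm :: "ereal \<Rightarrow> ('n::finite, 'x::complex_banach) oper \<Rightarrow> real" where
  "opnorm p T = (SUP x\<in>{x \<in> lp_space p. lp_norm p x \<le> 1}. lp_norm p (T x))"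

definition id_op :: "ereal \<Rightarrow> ('n::finite, 'x::complex_banach) oper" where
  "id_op p = lp_restrict p (\<lambda>x. x)"

definition op_scaleC :: "complex \<Rightarrow> ('n::finite, 'x::complex_banach) oper \<Rightarrow> ('n, 'x) oper" where
  "op_scaleC c T = (\<lambda>x. seq_scaleC c (T x))"

definition cube :: "nat \<Rightarrow> (int ^ 'n::finite) set" where
  "cube n = {i. \<forall>j. i $ j \<in> {- int n..int n}}"

definition P_op :: "ereal \<Rightarrow> nat \<Rightarrow> ('n::finite, 'x::complex_banach) oper" where
  "P_op p n = lp_restrict p (\<lambda>x i. if i \<in> cube n then x i else 0)"

definition Q_op :: "ereal \<Rightarrow> nat \<Rightarrow> ('n::finite, 'x::complex_banach) oper" where
  "Q_op p n = id_op p - P_op p n"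

definition shift_op :: "ereal \<Rightarrow> int ^ 'n \<Rightarrow> ('n::finite, 'x::complex_banach) oper" where
  "shift_op p k = lp_restrict p (\<lambda>x i. x (i - k))"

definition P_compact_ops :: "ereal \<Rightarrow> ('n::finite, 'x::complex_banach) oper set" where
  "P_compact_ops p =
     {K \<in> bounded_ops p. (\<lambda>n. opnorm p (Q_op p n \<circ> K) + opnorm p (K \<circ> Q_op p n)) \<longlonglongrightarrow> 0}"

definition P_ops :: "ereal \<Rightarrow> ('n::finite, 'x::complex_banach) oper set" where
  "P_ops p =
     {A \<in> bounded_ops p. \<forall>K\<in>P_compact_ops p. A \<circ> K \<in> P_compact_ops p \<and> K \<circ> A \<in> P_compact_ops p}"

definition op_ring :: "ereal \<Rightarrow> ('n::finite, 'x::complex_banach) oper ring" where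
  "op_ring p =
     \<lparr>carrier = bounded_ops p, mult = (\<circ>), one = id_op p, zero = 0, add = (+)\<rparr>"

definition P_op_ring :: "ereal \<Rightarrow> ('n::finite, 'x::complex_banach) oper ring" where
  "P_op_ring p = (op_ring p)\<lparr>carrier := P_ops p\<rparr>"

definition coset_norm :: "ereal \<Rightarrow> ('n::finite, 'x::complex_banach) oper set \<Rightarrow> real" where
  "coset_norm p C = (INF T\<in>C. opnorm p T)"

definition P_strong_limit ::
    "ereal \<Rightarrow> (nat \<Rightarrow> ('n::finite, 'x::complex_banach) oper) \<Rightarrow> ('n, 'x) oper \<Rightarrow> bool" where
  "P_strong_limit p T B \<longleftrightarrow>
     (\<forall>n. T n \<in> bounded_ops p) \<and> B \<in> bounded_ops p \<and>
     (\<forall>K\<in>P_compact_ops p.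
        (\<lambda>n. opnorm p (K \<circ> (T n - B)) + opnorm p ((T n - B) \<circ> K)) \<longlonglongrightarrow> 0)"

definition tends_to_infinity :: "(nat \<Rightarrow> int ^ 'n::finite) \<Rightarrow> bool" where
  "tends_to_infinity h \<longleftrightarrow> filterlim (\<lambda>n. Max (range (\<lambda>j. \<bar>h n $ j\<bar>))) at_top sequentially"

definition is_limit_op ::
    "ereal \<Rightarrow> ('n::finite, 'x::complex_banach) oper \<Rightarrow> (nat \<Rightarrow> int ^ 'n) \<Rightarrow> ('n, 'x) oper \<Rightarrow> bool" where
  "is_limit_op p A h B \<longleftrightarrow>
     tends_to_infinity h \<and>
     P_strong_limit p (\<lambda>n. shift_op p (- h n) \<circ> A \<circ> shift_op p (h n)) B"

definition op_spectrum :: "ereal \<Rightarrow> ('n::finite, 'x::complex_banach) oper \<Rightarrow> ('n, 'x) oper set" where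
  "op_spectrum p A = {B. \<exists>h. is_limit_op p A h B}"

definition rich :: "ereal \<Rightarrow> ('n::finite, 'x::complex_banach) oper \<Rightarrow> bool" where
  "rich p A \<longleftrightarrow>
     A \<in> P_ops p \<and>
     (\<forall>h. tends_to_infinity h \<longrightarrow>
        (\<exists>r :: nat \<Rightarrow> nat. strict_mono r \<and> (\<exists>B. is_limit_op p A (h \<circ> r) B)))"

text \<open>
  The coefficients are bounded families in \<open>\<L>(X)\<close>; since \<^typ>\<open>'x \<Rightarrow>\<^sub>L 'x\<close> consists of the bounded
  real-linear maps, homogeneity over \<open>\<complex>\<close> is required separately.
\<close>

definition coeff_space :: "(int ^ 'n::finite \<Rightarrow> 'x::complex_banach \<Rightarrow>\<^sub>L 'x) set" where
  "coeff_space =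
     {a. bounded (range a) \<and>
         (\<forall>i c v. blinfun_apply (a i) (scaleC c v) = scaleC c (blinfun_apply (a i) v))}"

definition mult_op ::
    "ereal \<Rightarrow> (int ^ 'n \<Rightarrow> 'x \<Rightarrow>\<^sub>L 'x) \<Rightarrow> ('n::finite, 'x::complex_banach) oper" where
  "mult_op p a = lp_restrict p (\<lambda>x i. blinfun_apply (a i) (x i))"

definition band_ops :: "ereal \<Rightarrow> ('n::finite, 'x::complex_banach) oper set" where
  "band_ops p =
     {(\<Sum>\<alpha>\<in>S. mult_op p (a \<alpha>) \<circ> shift_op p \<alpha>) | S a. finite S \<and> (\<forall>\<alpha>\<in>S. a \<alpha> \<in> coeff_space)}"

definition band_dominated_ops :: "ereal \<Rightarrow> ('n::finite, 'x::complex_banach) oper set" where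
  "band_dominated_ops p = {A \<in> bounded_ops p. \<forall>e>0. \<exists>B\<in>band_ops p. opnorm p (A - B) < e}"

definition rich_band_dominated_ops :: "ereal \<Rightarrow> ('n::finite, 'x::complex_banach) oper set" where
  "rich_band_dominated_ops p = {A \<in> band_dominated_ops p. rich p A}"

definition inverse_norm :: "('a, 'b) monoid_scheme \<Rightarrow> ('a \<Rightarrow> real) \<Rightarrow> 'a \<Rightarrow> ereal" where
  "inverse_norm R nrm b = (if b \<in> Units R then ereal (nrm (inv\<^bsub>R\<^esub> b)) else \<infinity>)"

definition pseudospectrum ::
    "ereal \<Rightarrow> real \<Rightarrow> ('n::finite, 'x::complex_banach) oper \<Rightarrow> complex set" where
  "pseudospectrum p \<epsilon> B =
     {z. inverse_norm (op_ring p) (opnorm p) (B - op_scaleC z (id_op p)) > ereal (1 / \<epsilon>)}"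

definition ess_pseudospectrum ::
    "ereal \<Rightarrow> real \<Rightarrow> ('n::finite, 'x::complex_banach) oper \<Rightarrow> complex set" where
  "ess_pseudospectrum p \<epsilon> A =
     {z. inverse_norm (P_op_ring p Quot P_compact_ops p) (coset_norm p)
           (P_compact_ops p +>\<^bsub>P_op_ring p\<^esub> (A - op_scaleC z (id_op p))) > ereal (1 / \<epsilon>)}"

end

theory Submission
  imports Defs
begin

text \<open>
  Write \<open>B = A - \<lambda>I\<close> and \<open>c = 1/\<epsilon>\<close>. Both sides of the identity are complements of conditions of the
  form \<open>norm of the inverse \<le> c\<close>, so it suffices that \<open>B\<close> has an inverse of norm at most \<open>c\<close> modulo
  \<open>\<K>(X, \<P>)\<close> iff every limit operator of \<open>B\<close> has an inverse of norm at most \<open>c\<close>.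

  Given an inverse \<open>C\<close> modulo the ideal, the shifted operators \<open>V\<^bsub>-h(n)\<^esub> C V\<^bsub>h(n)\<^esub>\<close> bound the limit operator \<open>L\<close>
  below on finitely supported sequences. As commutators of \<open>L\<close> with slowly varying cutoff functions are
  small, this extends to all sequences and also shows that the sequences \<open>V\<^bsub>-h(n)\<^esub> C V\<^bsub>h(n)\<^esub> y\<close> converge
  on every window, to a solution \<open>x\<close> of \<open>L x = y\<close>; no duality or density is used, so \<open>p = \<infinity>\<close> is included.

  Conversely, by richness, far out and on windows of a fixed size \<open>B\<close> is close to shifted limit operators.
  Patching their inverses together over a tiling gives \<open>C\<^sub>0\<close> of finite propagation with
  \<open>B C\<^sub>0 = I + F - K\<close>, where \<open>K\<close> lies in the ideal and \<open>F\<close> is small, hence a right inverse modulo the ideal.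
  The sharp bound \<open>\<parallel>B y\<parallel> \<ge> (1/c - \<delta>) \<parallel>y\<parallel>\<close> for \<open>y\<close> supported far out, obtained by averaging over all
  translates of one cutoff function, makes it two-sided and controls its norm.
\<close>

section \<open>Sizes of families of real numbers\<close>

text \<open>Two estimates of different quality are involved. Patching over a tiling costs a factor
  \<open>card (cube 3)\<close>, so it yields invertibility modulo the ideal but not the bound c. The
  sharp bound rests on a mixed-norm identity: the size in s of the norms of \<phi>(. - s) x is the
  size of \<phi> times the norm of x, for every exponent including the supremum, by interchanging
  two iterated sizes. The commutator errors must therefore be small in that same size over s,
  relative to the size of \<phi>, and not just uniformly in s. For p = \<infinity> the finitely
  supported sequences are not dense, so bounds on windows pass to whole sequences by a Fatou
  property. For p = 0 this property does not give decay at infinity, which is verified separately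
  wherever a new sequence is built. The union needs no closure: lying outside of it is a nonstrict
  bound by the single constant c for all limit operators, so uniform boundedness of their inverses
  comes for free. On the quotient side the coset norm is an infimum, so the same bound means a
  representative of norm at most c + e for every e > 0.\<close>

lemma powr_add_le_convex_combination:
  fixes u v t q :: real
  assumes "0 \<le> u" "0 \<le> v" "0 \<le> t" "t \<le> 1" "1 \<le> q"
  shows "(t * u + (1 - t) * v) powr q \<le> t * u powr q + (1 - t) * v powr q"
proof -
  \<comment> \<open>If one of the two numbers vanishes, the claim reduces to
    \<open>s powr q \<le> s\<close> for the weight of the other one; if both are positive it is
    convexity of the power function.\<close>
  have small: "s powr q \<le> s" if "0 \<le> s" "s \<le> 1" for s :: real
    using that assms(5) powr_mono'[of 1 q s] by (cases "s = 0") auto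
  consider "u = 0" | "v = 0" | "u > 0" "v > 0" using assms by linarith
  then show ?thesis
  proof cases
    case 1
    have "((1 - t) * v) powr q = (1 - t) powr q * v powr q"
      using assms by (simp add: powr_mult)
    also have "\<dots> \<le> (1 - t) * v powr q"
      using assms small[of "1 - t"] by (intro mult_right_mono) auto
    finally show ?thesis using 1 assms by simp
  next
    case 2
    have "(t * u) powr q = t powr q * u powr q"
      using assms by (simp add: powr_mult)
    also have "\<dots> \<le> t * u powr q"
      using assms small[of t] by (intro mult_right_mono) auto
    finally show ?thesis using 2 assms by simp
  next
    case 3
    show ?thesis
      using convex_onD[OF powr_convex[OF assms(5)], of "1 - t" u v] 3 assms by simp
  qed
qed

text \<open>After division by the majorants both sums are at most 1, and (f + g)/(a + b) is the
  convex combination of f/a and g/b with weight a/(a + b). Arbitrary majorants \<open>a\<close>,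
  \<open>b\<close> take the place of the norms, which is the form that \<open>lp_le\<close>
  needs.\<close>

lemma minkowski_powr_sum:
  fixes f g :: "'i \<Rightarrow> real"
  assumes S: "finite S" and q: "1 \<le> q" and ab: "0 \<le> a" "0 \<le> b"
    and f: "\<And>i. 0 \<le> f i" and g: "\<And>i. 0 \<le> g i"
    and fa: "(\<Sum>i\<in>S. f i powr q) \<le> a powr q" and gb: "(\<Sum>i\<in>S. g i powr q) \<le> b powr q"
  shows "(\<Sum>i\<in>S. (f i + g i) powr q) \<le> (a + b) powr q"
proof -
  have zero: "h i = 0" if "(\<Sum>i\<in>S. h i powr q) \<le> 0" "i \<in> S" for h :: "'i \<Rightarrow> real" and i
  proof -
    have "(\<Sum>i\<in>S. h i powr q) = 0" using that(1) by (simp add: sum_nonneg order.antisym)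
    then show ?thesis using that(2) S by (simp add: sum_nonneg_eq_0_iff)
  qed
  \<comment> \<open>A majorant 0 forces the corresponding family to vanish on \<open>S\<close>,
    which is what \<open>zero\<close> provides; otherwise both divisions are legitimate.\<close>
  consider "a = 0" | "b = 0" | "a > 0" "b > 0" using ab by linarith
  then show ?thesis
  proof cases
    case 1
    then have "f i = 0" if "i \<in> S" for i using zero[of f i] fa that by simp
    then show ?thesis using gb 1 by simp
  next
    case 2
    then have "g i = 0" if "i \<in> S" for i using zero[of g i] gb that by simp
    then show ?thesis using fa 2 by simp
  next
    case 3
    define t where "t = a / (a + b)"
    have t: "0 \<le> t" "t \<le> 1" "1 - t = b / (a + b)"
      using 3 by (auto simp: t_def field_simps)
    have "(\<Sum>i\<in>S. (f i + g i) powr q)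
        = (\<Sum>i\<in>S. (a + b) powr q * (t * (f i / a) + (1 - t) * (g i / b)) powr q)"
    proof (intro sum.cong refl)
      fix i
      have "t * (f i / a) + (1 - t) * (g i / b) = (f i + g i) / (a + b)"
        unfolding t(3) using 3 by (simp add: t_def add_divide_distrib)
      then show "(f i + g i) powr q = (a + b) powr q * (t * (f i / a) + (1 - t) * (g i / b)) powr q"
        using 3 f[of i] g[of i] by (simp add: powr_divide)
    qed
    also have "\<dots> \<le> (\<Sum>i\<in>S. (a + b) powr q * (t * (f i / a) powr q + (1 - t) * (g i / b) powr q))"
      using 3 f g t q by (intro sum_mono mult_left_mono powr_add_le_convex_combination) auto
    also have "\<dots> = (a + b) powr q * (t * ((\<Sum>i\<in>S. f i powr q) / a powr q)
                        + (1 - t) * ((\<Sum>i\<in>S. g i powr q) / b powr q))"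
      using 3 f g by (simp add: sum_distrib_left sum.distrib powr_divide sum_divide_distrib algebra_simps)
    also have "\<dots> \<le> (a + b) powr q * (t * 1 + (1 - t) * 1)"
      using 3 fa gb t by (intro mult_left_mono add_mono) auto
    finally show ?thesis by simp
  qed
qed

text \<open>The index type is arbitrary because the notion is applied to coordinates, to translates
  of a cutoff function and to tiles. For p = 0 it records boundedness only; the decay that l^0
  demands is the separate condition in \<open>lp_iff\<close>.\<close>

definition lp_summable :: "ereal \<Rightarrow> ('i \<Rightarrow> real) \<Rightarrow> bool" where
  "lp_summable p f \<longleftrightarrow>
     (if p = 0 \<or> p = \<infinity> then bounded (range f) else (\<lambda>i. f i powr real_of_ereal p) summable_on UNIV)"

definition lp_size :: "ereal \<Rightarrow> ('i \<Rightarrow> real) \<Rightarrow> real" where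
  "lp_size p f =
     (if p = 0 \<or> p = \<infinity> then (SUP i. f i)
      else (\<Sum>\<^sub>\<infinity>i\<in>UNIV. f i powr real_of_ereal p) powr (1 / real_of_ereal p))"

text \<open>The size bound in terms of finite partial sums, which needs no summability side condition.\<close>

definition lp_le :: "ereal \<Rightarrow> ('i \<Rightarrow> real) \<Rightarrow> real \<Rightarrow> bool" where
  "lp_le p f c \<longleftrightarrow>
     (if p = 0 \<or> p = \<infinity> then (\<forall>i. f i \<le> c)
      else (\<forall>S. finite S \<longrightarrow> (\<Sum>i\<in>S. f i powr real_of_ereal p) \<le> c powr real_of_ereal p))"

lemma lp_norm_eq: "lp_norm p x = lp_size p (\<lambda>i. norm (x i))"
  by (simp add: lp_norm_def lp_size_def)

section \<open>Order, triangle inequality, scaling and reindexing for sizes\<close>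

locale lp_exponent =
  fixes p :: ereal
  assumes exponent: "p = 0 \<or> 1 \<le> p"
begin

lemma exponent_cases:
  obtains (sup) "p = 0 \<or> p = \<infinity>"
  | (fin) q where "p = ereal q" "real_of_ereal p = q" "1 \<le> q" "p \<noteq> 0" "p \<noteq> \<infinity>"
proof (cases "p = 0 \<or> p = \<infinity>")
  case True
  then show ?thesis by (rule sup)
next
  case False
  then have "1 \<le> p" "p \<noteq> \<infinity>" using exponent by auto
  then obtain q where "p = ereal q" "1 \<le> q" by (cases p) auto
  then show ?thesis using False fin by simp
qed

text \<open>The partial sums of a nonnegative family are bounded iff it is summable, and its total
  is their least upper bound. Monotonicity of the q-th power (\<open>inv\<close>) moves the outer
  root to the other side.\<close>

lemma lp_le_iff:
  fixes f :: "'i \<Rightarrow> real"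
  assumes f: "\<And>i. 0 \<le> f i" and c: "0 \<le> c"
  shows "lp_le p f c \<longleftrightarrow> lp_summable p f \<and> lp_size p f \<le> c"
proof (cases rule: exponent_cases)
  case sup
  have "bdd_above (range f)" if "bounded (range f)"
    using that by (rule bounded_imp_bdd_above)
  moreover have "bounded (range f)" if "\<forall>i. f i \<le> c"
    using that f unfolding bounded_iff by (auto intro!: exI[of _ c])
  ultimately show ?thesis using sup
    unfolding lp_le_def lp_summable_def lp_size_def by (auto simp: cSUP_le_iff)
next
  case (fin q)
  let ?g = "\<lambda>i. f i powr q"
  have inv: "(s powr (1 / q) \<le> c) = (s \<le> c powr q)" if "0 \<le> s" for s :: real
  proof -
    have "s powr (1 / q) \<le> c \<longleftrightarrow> (s powr (1 / q)) powr q \<le> c powr q"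
      using fin(3) c powr_less_mono2[of q c "s powr (1 / q)"] powr_mono2[of q "s powr (1 / q)" c]
      by (force simp: not_less[symmetric])
    also have "(s powr (1 / q)) powr q = s" using fin(3) that by (simp add: powr_powr)
    finally show ?thesis .
  qed
  have "?g summable_on UNIV" if "\<forall>S. finite S \<longrightarrow> sum ?g S \<le> c powr q"
    using that by (intro nonneg_bdd_above_summable_on) (auto intro!: bdd_aboveI[of _ "c powr q"])
  moreover have "infsum ?g UNIV \<le> c powr q \<longleftrightarrow> (\<forall>S. finite S \<longrightarrow> sum ?g S \<le> c powr q)"
    if "?g summable_on UNIV"
    using that finite_sum_le_infsum[OF that] infsum_le_finite_sums[OF that]
    by (meson order_trans powr_ge_zero subset_UNIV)
  ultimately show ?thesis
    using fin inv[of "infsum ?g UNIV"] infsum_nonneg[of UNIV ?g]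
    unfolding lp_le_def lp_summable_def lp_size_def by auto
qed

lemma lp_size_nonneg:
  fixes f :: "'i \<Rightarrow> real"
  assumes f: "\<And>i. 0 \<le> f i" and "lp_summable p f" shows "0 \<le> lp_size p f"
proof (cases rule: exponent_cases)
  case sup
  then have "bdd_above (range f)"
    using assms(2) bounded_imp_bdd_above unfolding lp_summable_def by auto
  then have "f undefined \<le> (SUP i. f i)" by (intro cSUP_upper) auto
  then show ?thesis using f[of undefined] sup by (auto simp: lp_size_def)
qed (auto simp: lp_size_def)

lemma lp_le_size:
  fixes f :: "'i \<Rightarrow> real"
  assumes "\<And>i. 0 \<le> f i" "lp_summable p f" shows "lp_le p f (lp_size p f)"
  using assms lp_le_iff[of f "lp_size p f"] lp_size_nonneg[of f] by simp

lemma lp_leD: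
  fixes f :: "'i \<Rightarrow> real"
  assumes "\<And>i. 0 \<le> f i" "0 \<le> c" "lp_le p f c"
  shows "lp_summable p f" "lp_size p f \<le> c"
  using assms lp_le_iff[of f c] by auto

lemma lp_le_mono:
  assumes "\<And>i. 0 \<le> f i" "\<And>i. f i \<le> g i" "lp_le p g c" shows "lp_le p f c"
proof (cases rule: exponent_cases)
  case sup
  then show ?thesis using assms unfolding lp_le_def by (auto intro: order_trans)
next
  case (fin q)
  have "(\<Sum>i\<in>S. f i powr q) \<le> (\<Sum>i\<in>S. g i powr q)" for S
    using assms fin by (intro sum_mono powr_mono2) auto
  then show ?thesis using assms(3) fin unfolding lp_le_def by (auto intro: order_trans)
qed

lemma lp_le_add:
  assumes "\<And>i. 0 \<le> f i" "\<And>i. 0 \<le> g i" "0 \<le> a" "0 \<le> b" "lp_le p f a" "lp_le p g b"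
  shows "lp_le p (\<lambda>i. f i + g i) (a + b)"
proof (cases rule: exponent_cases)
  case sup
  then show ?thesis using assms unfolding lp_le_def by (auto intro: add_mono)
next
  case (fin q)
  then show ?thesis using assms unfolding lp_le_def
    by (auto intro!: minkowski_powr_sum)
qed

lemma lp_le_mult:
  assumes "\<And>i. 0 \<le> f i" "0 \<le> a" "0 \<le> c" "lp_le p f a"
  shows "lp_le p (\<lambda>i. c * f i) (c * a)"
proof (cases rule: exponent_cases)
  case sup
  then show ?thesis using assms unfolding lp_le_def by (auto intro: mult_left_mono)
next
  case (fin q)
  then show ?thesis using assms unfolding lp_le_def
    by (auto simp: powr_mult sum_distrib_left[symmetric] intro!: mult_left_mono)
qed

lemma lp_le_reindex:
  assumes "inj \<pi>" "lp_le p f a"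
  shows "lp_le p (\<lambda>i. f (\<pi> i)) a"
proof (cases rule: exponent_cases)
  case sup
  then show ?thesis using assms unfolding lp_le_def by auto
next
  case (fin q)
  have "(\<Sum>i\<in>S. f (\<pi> i) powr q) = (\<Sum>i\<in>\<pi> ` S. f i powr q)" for S
    using assms(1) by (subst sum.reindex) (auto simp: inj_on_def)
  then show ?thesis using assms fin unfolding lp_le_def by auto
qed

text \<open>Each condition in \<open>lp_le\<close> inspects finitely many indices, so the
  restrictions to finite sets decide it. This is the origin of the Fatou property of the
  norm.\<close>

lemma lp_le_Fatou:
  assumes "\<And>i. 0 \<le> f i" "0 \<le> c" "\<And>S. finite S \<Longrightarrow> lp_le p (\<lambda>i. if i \<in> S then f i else 0) c"
  shows "lp_le p f c"
proof (cases rule: exponent_cases)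
  case sup
  have "f i \<le> c" for i using assms(3)[of "{i}"] sup unfolding lp_le_def by (auto split: if_splits)
  then show ?thesis using sup unfolding lp_le_def by auto
next
  case (fin q)
  have "(\<Sum>i\<in>S. f i powr q) \<le> c powr q" if "finite S" for S
  proof -
    have "(\<Sum>i\<in>S. f i powr q) = (\<Sum>i\<in>S. (if i \<in> S then f i else 0) powr q)"
      by (intro sum.cong) auto
    also have "\<dots> \<le> c powr q" using assms(3)[OF that] that fin unfolding lp_le_def by auto
    finally show ?thesis .
  qed
  then show ?thesis using fin unfolding lp_le_def by auto
qed

lemma lp_summable_mono:
  assumes "\<And>i. 0 \<le> f i" "\<And>i. f i \<le> g i" "lp_summable p g" shows "lp_summable p f"
  using assms lp_leD(1)[OF _ _ lp_le_mono[OF _ _ lp_le_size]] lp_size_nonneg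
  by (metis (no_types, lifting) order_trans)

lemma lp_size_mono:
  assumes "\<And>i. 0 \<le> f i" "\<And>i. f i \<le> g i" "lp_summable p g" shows "lp_size p f \<le> lp_size p g"
proof -
  have g: "\<And>i. 0 \<le> g i" using assms order_trans by blast
  have "lp_le p f (lp_size p g)" using assms g by (intro lp_le_mono[OF _ _ lp_le_size]) auto
  then show ?thesis using assms g lp_size_nonneg[of g] lp_leD(2)[of f] by auto
qed

lemma lp_add:
  fixes f g :: "'i \<Rightarrow> real"
  assumes f: "\<And>i. 0 \<le> f i" "lp_summable p f" and g: "\<And>i. 0 \<le> g i" "lp_summable p g"
  shows "lp_summable p (\<lambda>i. f i + g i)"
    and "lp_size p (\<lambda>i. f i + g i) \<le> lp_size p f + lp_size p g"
proof -
  have "lp_le p (\<lambda>i. f i + g i) (lp_size p f + lp_size p g)"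
    using assms by (intro lp_le_add lp_le_size lp_size_nonneg) auto
  moreover have "0 \<le> lp_size p f + lp_size p g"
    using assms by (simp add: lp_size_nonneg)
  ultimately show "lp_summable p (\<lambda>i. f i + g i)"
    "lp_size p (\<lambda>i. f i + g i) \<le> lp_size p f + lp_size p g"
    using lp_leD[of "\<lambda>i. f i + g i"] f g by auto
qed

text \<open>Equality results from using the upper estimate twice, with the factor \<open>c\<close>
  and with \<open>1 / c\<close> on the scaled family.\<close>

lemma lp_mult:
  fixes f :: "'i \<Rightarrow> real"
  assumes f: "\<And>i. 0 \<le> f i" "lp_summable p f" and c: "0 \<le> c"
  shows "lp_summable p (\<lambda>i. c * f i)" and "lp_size p (\<lambda>i. c * f i) = c * lp_size p f"
proof -
  have le: "lp_summable p (\<lambda>i. d * g i) \<and> lp_size p (\<lambda>i. d * g i) \<le> d * lp_size p g"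
    if "\<And>i. 0 \<le> g i" "lp_summable p g" "0 \<le> d" for d and g :: "'i \<Rightarrow> real"
  proof -
    have "lp_le p (\<lambda>i. d * g i) (d * lp_size p g)"
      using that by (intro lp_le_mult lp_le_size lp_size_nonneg) auto
    moreover have "0 \<le> d * lp_size p g" using that by (simp add: lp_size_nonneg)
    ultimately show ?thesis using lp_leD[of "\<lambda>i. d * g i"] that by auto
  qed
  show s: "lp_summable p (\<lambda>i. c * f i)" using le[OF f c] by simp
  have "c * lp_size p f \<le> lp_size p (\<lambda>i. c * f i)"
  proof (cases "c = 0")
    case True
    then show ?thesis using lp_size_nonneg[OF _ s] f by simp
  next
    case False
    then have "c > 0" using c by simp
    have "lp_size p (\<lambda>i. (1 / c) * (c * f i)) \<le> (1 / c) * lp_size p (\<lambda>i. c * f i)"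
      using le[of "\<lambda>i. c * f i" "1 / c"] s f c by auto
    then show ?thesis using \<open>c > 0\<close> by (simp add: field_simps)
  qed
  then show "lp_size p (\<lambda>i. c * f i) = c * lp_size p f" using le[OF f c] by simp
qed

text \<open>Injective reindexing cannot increase the size; applying this to \<pi> and to its inverse
  gives equality.\<close>

lemma lp_reindex:
  fixes f :: "'i \<Rightarrow> real" and \<pi> :: "'i \<Rightarrow> 'i"
  assumes f: "\<And>i. 0 \<le> f i" "lp_summable p f" and \<pi>: "bij \<pi>"
  shows "lp_summable p (\<lambda>i. f (\<pi> i))" and "lp_size p (\<lambda>i. f (\<pi> i)) = lp_size p f"
proof -
  have le: "lp_summable p (\<lambda>i. g (\<sigma> i)) \<and> lp_size p (\<lambda>i. g (\<sigma> i)) \<le> lp_size p g"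
    if "\<And>i. 0 \<le> g i" "lp_summable p g" "inj \<sigma>" for g :: "'i \<Rightarrow> real" and \<sigma> :: "'i \<Rightarrow> 'i"
    using that lp_leD[of "\<lambda>i. g (\<sigma> i)" "lp_size p g"] lp_le_reindex[OF _ lp_le_size]
      lp_size_nonneg[of g] by metis
  show s: "lp_summable p (\<lambda>i. f (\<pi> i))" using le[of f \<pi>] f bij_is_inj[OF \<pi>] by blast
  have "inj (inv_into UNIV \<pi>)" using \<pi> by (metis bij_imp_bij_inv bij_def)
  from le[OF _ s this] have "lp_size p f \<le> lp_size p (\<lambda>i. f (\<pi> i))"
    using f(1) \<pi> by (simp add: bij_def surj_f_inv_f)
  then show "lp_size p (\<lambda>i. f (\<pi> i)) = lp_size p f"
    using le[OF f, of \<pi>] \<pi> by (simp add: bij_def)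
qed

lemma lp_coord_le:
  assumes f: "\<And>i. 0 \<le> f i" "lp_summable p f"
  shows "f i \<le> lp_size p f"
proof (cases rule: exponent_cases)
  case sup
  then show ?thesis using lp_le_size[OF f] unfolding lp_le_def by simp
next
  case (fin q)
  have "f i powr q \<le> lp_size p f powr q"
    using lp_le_size[OF f] fin unfolding lp_le_def
    by (auto dest!: spec[of _ "{i}"])
  then show ?thesis
    using fin(3) f(1)[of i] lp_size_nonneg[OF f]
    by (smt (verit) powr_less_mono2)
qed

lemma lp_zero [simp]: "lp_summable p (\<lambda>i. 0)" "lp_size p (\<lambda>i. 0) = 0"
  by (auto simp: lp_summable_def lp_size_def)

lemma lp_le_single:
  fixes f :: "'i \<Rightarrow> real"
  assumes "0 \<le> f j" "\<And>i. i \<noteq> j \<Longrightarrow> f i = 0"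
  shows "lp_le p f (f j)"
proof (cases rule: exponent_cases)
  case sup
  then show ?thesis using assms unfolding lp_le_def by (metis order_refl)
next
  case (fin q)
  have "(\<Sum>i\<in>S. f i powr q) \<le> f j powr q" if "finite S" for S
  proof -
    have "(\<Sum>i\<in>S. f i powr q) \<le> (\<Sum>i\<in>insert j S. f i powr q)"
      using that by (intro sum_mono2) auto
    also have "\<dots> = f j powr q + (\<Sum>i\<in>S - {j}. f i powr q)"
      using that by (simp add: sum.insert_remove)
    also have "(\<Sum>i\<in>S - {j}. f i powr q) = 0" using assms(2) by (intro sum.neutral) auto
    finally show ?thesis by simp
  qed
  then show ?thesis using fin unfolding lp_le_def by auto
qed

lemma lp_single:
  fixes f :: "'i \<Rightarrow> real"
  assumes "0 \<le> f j" "\<And>i. i \<noteq> j \<Longrightarrow> f i = 0"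
  shows "lp_summable p f" "lp_size p f = f j"
proof -
  have nn: "0 \<le> f i" for i using assms by (cases "i = j") auto
  show "lp_summable p f" using lp_leD(1)[of f "f j"] lp_le_single[of f j] assms nn by blast
  then show "lp_size p f = f j"
    using lp_leD(2)[of f "f j"] lp_le_single[of f j] lp_coord_le[of f j] assms nn
    by (simp add: order.antisym)
qed

lemma lp_finite_sum:
  fixes f :: "'b \<Rightarrow> 'i \<Rightarrow> real"
  assumes "finite S" "\<And>b i. b \<in> S \<Longrightarrow> 0 \<le> f b i" "\<And>b. b \<in> S \<Longrightarrow> lp_summable p (f b)"
  shows "lp_summable p (\<lambda>i. \<Sum>b\<in>S. f b i)"
    and "lp_size p (\<lambda>i. \<Sum>b\<in>S. f b i) \<le> (\<Sum>b\<in>S. lp_size p (f b))"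
  using assms
proof (induction S rule: finite_induct)
  case empty
  { case 1 show ?case by simp next case 2 show ?case by simp }
next
  case (insert b S)
  { case 1
    then show ?case using insert
      by (simp add: lp_add(1) sum_nonneg)
  next
    case 2
    have "lp_size p (\<lambda>i. f b i + (\<Sum>b\<in>S. f b i)) \<le> lp_size p (f b) + lp_size p (\<lambda>i. \<Sum>b\<in>S. f b i)"
      using 2 insert by (intro lp_add) (auto intro!: sum_nonneg)
    also have "\<dots> \<le> lp_size p (f b) + (\<Sum>b\<in>S. lp_size p (f b))"
      using 2 insert by simp
    finally show ?case using insert by simp }
qed

lemma lp_finite_support:
  fixes f :: "'i \<Rightarrow> real"
  assumes "finite S" "\<And>i. 0 \<le> f i" "\<And>i. i \<notin> S \<Longrightarrow> f i = 0"
  shows "lp_summable p f" "lp_size p f \<le> (\<Sum>i\<in>S. f i)"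
proof -
  have eq: "f = (\<lambda>i. \<Sum>b\<in>S. if i = b then f b else 0)"
    using assms by (auto simp: fun_eq_iff sum.delta)
  have s: "lp_summable p (\<lambda>i. if i = b then f b else 0)"
    "lp_size p (\<lambda>i. if i = b then f b else 0) = f b" for b
    using lp_single[of "\<lambda>i. if i = b then f b else 0" b] assms by auto
  show "lp_summable p f" by (subst eq, rule lp_finite_sum) (use assms s in auto)
  have "lp_size p f \<le> (\<Sum>b\<in>S. lp_size p (\<lambda>i. if i = b then f b else 0))"
    by (subst eq, rule lp_finite_sum) (use assms s in auto)
  then show "lp_size p f \<le> (\<Sum>i\<in>S. f i)" using s by simp
qed

lemma lp_size_powr:
  fixes f :: "'i \<Rightarrow> real"
  assumes "p = ereal q" "real_of_ereal p = q" "1 \<le> q" "p \<noteq> 0" "p \<noteq> \<infinity>"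
  shows "lp_size p f powr q = (\<Sum>\<^sub>\<infinity>i. f i powr q)"
proof -
  have "0 \<le> (\<Sum>\<^sub>\<infinity>i. f i powr q)" by (intro infsum_nonneg) auto
  then show ?thesis using assms by (simp add: lp_size_def powr_powr)
qed

text \<open>In the supremum case this is monotonicity. For finite q, \<open>lp_le\<close> asks only
  about finite sets \<open>S\<close> of outer indices: the finite sum is interchanged with the
  infinite one, and for each \<open>i\<close> the sum over \<open>S\<close> is at most the q-th
  power of the inner size. Summability in the new order is part of the conclusion, so it never has
  to be shown by hand.\<close>

lemma lp_Fubini_le:
  fixes f :: "'a \<Rightarrow> 'i \<Rightarrow> real"
  assumes f: "\<And>a i. 0 \<le> f a i" and s: "\<And>i. lp_summable p (\<lambda>a. f a i)"
    and s2: "lp_summable p (\<lambda>i. lp_size p (\<lambda>a. f a i))"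
  shows "lp_summable p (f a)" and "lp_summable p (\<lambda>a. lp_size p (f a))"
    and "lp_size p (\<lambda>a. lp_size p (f a)) \<le> lp_size p (\<lambda>i. lp_size p (\<lambda>a. f a i))"
proof -
  let ?c = "lp_size p (\<lambda>i. lp_size p (\<lambda>a. f a i))"
  have nn: "0 \<le> lp_size p (\<lambda>a. f a i)" for i using f s by (intro lp_size_nonneg) auto
  have sf: "lp_summable p (f a)" for a
    using f s by (intro lp_summable_mono[OF _ _ s2] lp_coord_le) auto
  show "lp_summable p (f a)" by (rule sf)
  have nn': "0 \<le> lp_size p (f a)" for a using f sf by (intro lp_size_nonneg) auto
  have "lp_le p (\<lambda>a. lp_size p (f a)) ?c"
  proof (cases rule: exponent_cases)
    case sup
    have "lp_size p (f a) \<le> ?c" for a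
      using f s by (intro lp_size_mono[OF _ _ s2] lp_coord_le) auto
    then show ?thesis using sup unfolding lp_le_def by auto
  next
    case (fin q)
    have "(\<Sum>a\<in>S. lp_size p (f a) powr q) \<le> ?c powr q" if "finite S" for S
    proof -
      have sq: "(\<lambda>i. f a i powr q) summable_on UNIV" for a
        using sf[of a] fin by (simp add: lp_summable_def)
      have "(\<Sum>a\<in>S. lp_size p (f a) powr q) = (\<Sum>a\<in>S. \<Sum>\<^sub>\<infinity>i. f a i powr q)"
        by (intro sum.cong refl lp_size_powr fin)
      also have "\<dots> = (\<Sum>\<^sub>\<infinity>i. \<Sum>a\<in>S. f a i powr q)"
      proof -
        have "((\<lambda>i. \<Sum>a\<in>S. f a i powr q) has_sum (\<Sum>a\<in>S. \<Sum>\<^sub>\<infinity>i. f a i powr q)) UNIV"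
          using that by (induction S rule: finite_induct) (auto intro!: has_sum_add has_sum_infsum sq)
        then show ?thesis by (rule infsumI[symmetric])
      qed
      also have "\<dots> \<le> (\<Sum>\<^sub>\<infinity>i. lp_size p (\<lambda>a. f a i) powr q)"
      proof (intro infsum_mono)
        show "(\<lambda>i. \<Sum>a\<in>S. f a i powr q) summable_on UNIV"
          using that by (induction S rule: finite_induct) (auto intro!: summable_on_add sq)
        show "(\<lambda>i. lp_size p (\<lambda>a. f a i) powr q) summable_on UNIV"
          using s2 fin by (simp add: lp_summable_def)
        show "(\<Sum>a\<in>S. f a i powr q) \<le> lp_size p (\<lambda>a. f a i) powr q" for i
          using lp_le_size[of "\<lambda>a. f a i"] f s that fin by (auto simp: lp_le_def)
      qed
      also have "\<dots> = ?c powr q" by (intro lp_size_powr[symmetric] fin)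
      finally show ?thesis .
    qed
    then show ?thesis using fin unfolding lp_le_def by auto
  qed
  moreover have "0 \<le> ?c" by (rule lp_size_nonneg[OF nn s2])
  ultimately show "lp_summable p (\<lambda>a. lp_size p (f a))"
    "lp_size p (\<lambda>a. lp_size p (f a)) \<le> ?c"
    using lp_leD[of "\<lambda>a. lp_size p (f a)" ?c] nn' by auto
qed

text \<open>One inequality in each order; the second application takes its summability hypotheses
  from the conclusions of the first.\<close>

lemma lp_Fubini:
  fixes f :: "'a \<Rightarrow> 'i \<Rightarrow> real"
  assumes f: "\<And>a i. 0 \<le> f a i" and s: "\<And>i. lp_summable p (\<lambda>a. f a i)"
    and s2: "lp_summable p (\<lambda>i. lp_size p (\<lambda>a. f a i))"
  shows "lp_size p (\<lambda>a. lp_size p (f a)) = lp_size p (\<lambda>i. lp_size p (\<lambda>a. f a i))"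
  using lp_Fubini_le[of f] lp_Fubini_le[of "\<lambda>i a. f a i"] assms by (simp add: order.antisym)

end


section \<open>Sequences and their norms\<close>

lemma scaleC_zero_right [simp]: "scaleC c (0 :: 'x::complex_banach) = 0"
  using scaleC_add_right[of c "0 :: 'x" 0] by simp

lemma scaleC_minus_one:
  fixes x :: "'x::complex_banach"
  shows "scaleC (-1) x = - x"
  using scaleC_of_real[of "-1" x] by simp

lemma scaleC_minus_right:
  fixes x :: "'x::complex_banach"
  shows "scaleC c (- x) = - scaleC c x"
  using scaleC_add_right[of c x "- x"] by (simp add: eq_neg_iff_add_eq_0 add.commute)

lemma scaleC_diff_right:
  fixes x y :: "'x::complex_banach"
  shows "scaleC c (x - y) = scaleC c x - scaleC c y"
  using scaleC_add_right[of c x "- y"] by (simp add: scaleC_minus_right)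

lemma scaleC_scaleR:
  fixes x :: "'x::complex_banach"
  shows "scaleC c (r *\<^sub>R x) = r *\<^sub>R scaleC c x"
  by (metis mult.commute scaleC_of_real scaleC_scaleC)

lemma scaleC_sum_right: "scaleC c (\<Sum>i\<in>S. f i) = (\<Sum>i\<in>S. scaleC c (f i :: 'x::complex_banach))"
  by (induction S rule: infinite_finite_induct) (auto simp: scaleC_add_right)

text \<open>Defined on all sequences, whereas the operator \<open>mop\<close> derived from it is
  zero outside l^p as \<open>bounded_ops\<close> demands. Estimates can thus be written without
  membership side conditions.\<close>

definition rmul :: "('i \<Rightarrow> real) \<Rightarrow> ('i \<Rightarrow> 'x::real_vector) \<Rightarrow> 'i \<Rightarrow> 'x" where
  "rmul \<phi> x = (\<lambda>i. \<phi> i *\<^sub>R x i)"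

lemma rmul_apply: "rmul \<phi> x i = \<phi> i *\<^sub>R x i"
  by (simp add: rmul_def)

lemma rmul_add: "rmul \<phi> (x + y) = rmul \<phi> x + rmul \<phi> y"
  by (auto simp: rmul_def scaleR_add_right)

lemma rmul_diff: "rmul \<phi> (x - y) = rmul \<phi> x - rmul \<phi> y"
  by (auto simp: rmul_def scaleR_diff_right)

lemma finite_cube [simp]: "finite (cube n :: (int ^ 'n::finite) set)"
proof -
  have "cube n \<subseteq> (\<lambda>f. \<chi> j. f j) ` (UNIV \<rightarrow>\<^sub>E {- int n..int n} :: ('n \<Rightarrow> int) set)"
  proof
    fix i :: "int ^ 'n" assume "i \<in> cube n"
    then have "(\<lambda>j. i $ j) \<in> UNIV \<rightarrow>\<^sub>E {- int n..int n}" by (auto simp: cube_def)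
    then show "i \<in> (\<lambda>f. \<chi> j. f j) ` (UNIV \<rightarrow>\<^sub>E {- int n..int n})"
      by (intro image_eqI[of _ _ "\<lambda>j. i $ j"]) auto
  qed
  then show ?thesis by (rule finite_subset) (auto intro!: finite_imageI finite_PiE)
qed

definition linf :: "int ^ 'n::finite \<Rightarrow> nat" where
  "linf i = Max (range (\<lambda>j. nat \<bar>i $ j\<bar>))"

lemma linf_le_iff: "linf i \<le> m \<longleftrightarrow> (\<forall>j. \<bar>i $ j\<bar> \<le> int m)"
  unfolding linf_def by (subst Max_le_iff) (auto simp: nat_le_iff)

lemma mem_cube_iff: "i \<in> cube m \<longleftrightarrow> linf i \<le> m"
  unfolding linf_le_iff cube_def by (simp add: abs_le_iff minus_le_iff conj_commute)

lemma abs_le_linf: "\<bar>i $ j\<bar> \<le> int (linf i)"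
  using linf_le_iff[of i "linf i"] by auto

lemma linf_add: "linf (i + j) \<le> linf i + linf j"
  unfolding linf_le_iff
proof
  fix k
  show "\<bar>(i + j) $ k\<bar> \<le> int (linf i + linf j)"
    using abs_le_linf[of i k] abs_le_linf[of j k] by simp
qed

lemma linf_uminus [simp]: "linf (- i) = linf i"
  by (simp add: linf_def)

lemma linf_diff: "linf (i - j) \<le> linf i + linf j"
  using linf_add[of i "- j"] by simp

lemma linf_zero [simp]: "linf 0 = 0"
  using linf_le_iff[of 0 0] by simp

lemma finite_subset_cube:
  assumes "finite S" obtains m where "S \<subseteq> cube m"
proof
  show "S \<subseteq> cube (Max (insert 0 (linf ` S)))"
    using assms by (auto simp: mem_cube_iff intro!: Max_ge)
qed

section \<open>The normed space l^p, its Fatou property and its completeness\<close>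

context lp_exponent
begin

abbreviation lp :: "('n::finite, 'x::complex_banach) seq set" where
  "lp \<equiv> lp_space p"

abbreviation nrm :: "('n::finite, 'x::complex_banach) seq \<Rightarrow> real" ("\<parallel>_\<parallel>") where
  "\<parallel>x\<parallel> \<equiv> lp_norm p x"

text \<open>For p = 0, a finitely supported y within \<open>e\<close> of x has all i with norm (x i)
  > e in its support; conversely, cutting x off below a small level leaves a finitely supported
  approximant. The closure of the finitely supported sequences thus consists of the bounded
  sequences whose superlevel sets are finite.\<close>

lemma lp_iff:
  "x \<in> lp \<longleftrightarrow> lp_summable p (\<lambda>i. norm (x i)) \<and> (p = 0 \<longrightarrow> (\<forall>e>0. finite {i. norm (x i) > e}))"
proof (cases "p = 0")
  case True
  have lin: "x \<in> linf_space \<longleftrightarrow> bounded (range (\<lambda>i. norm (x i)))" for x :: "('a, 'b) seq"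
    unfolding linf_space_def by (auto simp: bounded_iff)
  show ?thesis
  proof (intro iffI conjI impI allI)
    assume "x \<in> lp"
    then have x: "x \<in> linf_space"
      and ap: "\<And>e. e > 0 \<Longrightarrow> \<exists>y. finite {i. y i \<noteq> 0} \<and> lp_norm \<infinity> (x - y) < e"
      using True by (auto simp: lp_space_def)
    show "lp_summable p (\<lambda>i. norm (x i))" using x lin True by (simp add: lp_summable_def)
    fix e :: real assume "e > 0"
    then obtain y where y: "finite {i. y i \<noteq> 0}" "lp_norm \<infinity> (x - y) < e" using ap by blast
    have "bounded (range y)"
    proof -
      have "range y \<subseteq> insert 0 (y ` {i. y i \<noteq> 0})" by auto
      then show ?thesis using y(1) by (meson finite_imageI finite_imp_bounded finite_insert finite_subset)
    qed
    then have "bounded (range (\<lambda>i. x i - y i))"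
      using x by (auto simp: linf_space_def intro!: bounded_minus_comp)
    then have "bdd_above (range (\<lambda>i. norm (x i - y i)))"
      by (auto simp: bounded_iff bdd_above_def)
    then have "norm (x i - y i) < e" for i
      using y(2) cSUP_upper[of i UNIV "\<lambda>i. norm (x i - y i)"] by (auto simp: lp_norm_def)
    then have "{i. norm (x i) > e} \<subseteq> {i. y i \<noteq> 0}"
      by (auto, metis diff_zero less_asym)
    then show "finite {i. norm (x i) > e}" using y(1) finite_subset by blast
  next
    assume h: "lp_summable p (\<lambda>i. norm (x i)) \<and> (p = 0 \<longrightarrow> (\<forall>e>0. finite {i. norm (x i) > e}))"
    then have x: "x \<in> linf_space" using True lin by (simp add: lp_summable_def)
    have "\<exists>y. finite {i. y i \<noteq> 0} \<and> lp_norm \<infinity> (x - y) < e" if "e > 0" for e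
    proof (intro exI conjI)
      \<comment> \<open>Truncation at level \<open>e / 2\<close> leaves an error of at most
        \<open>e / 2\<close>, hence strictly less than \<open>e\<close>.\<close>
      let ?y = "\<lambda>i. if norm (x i) > e / 2 then x i else 0"
      have "finite {i. norm (x i) > e / 2}" using h True half_gt_zero[OF that] by blast
      then show "finite {i. ?y i \<noteq> 0}" by (rule rev_finite_subset) auto
      have "(SUP i. norm (x i - ?y i)) \<le> e / 2" using that by (intro cSUP_least) auto
      then show "lp_norm \<infinity> (x - ?y) < e" using that by (simp add: lp_norm_def)
    qed
    then show "x \<in> lp" using x True by (auto simp: lp_space_def)
  qed
next
  case False
  then show ?thesis
    by (auto simp: lp_space_def lp_summable_def linf_space_def bounded_iff)
qed

lemma lp_summableD: "x \<in> lp \<Longrightarrow> lp_summable p (\<lambda>i. norm (x i))"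
  by (simp add: lp_iff)

lemma lp_finite_gt: "x \<in> lp \<Longrightarrow> p = 0 \<Longrightarrow> e > 0 \<Longrightarrow> finite {i. norm (x i) > e}"
  using lp_iff[of x] by blast

lemma nrm_nonneg: "x \<in> lp \<Longrightarrow> 0 \<le> \<parallel>x\<parallel>"
  unfolding lp_norm_eq by (intro lp_size_nonneg lp_summableD) auto

lemma norm_coord_le: "x \<in> lp \<Longrightarrow> norm (x i) \<le> \<parallel>x\<parallel>"
  unfolding lp_norm_eq using lp_coord_le[of "\<lambda>i. norm (x i)" i] lp_summableD by auto

lemma lp_solid:
  assumes "y \<in> lp" "\<And>i. norm (x i) \<le> norm (y i)"
  shows "x \<in> lp" "\<parallel>x\<parallel> \<le> \<parallel>y\<parallel>"
proof -
  have "finite {i. norm (x i) > e}" if "finite {i. norm (y i) > e}" for e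
    by (rule rev_finite_subset[OF that]) (use assms(2) in \<open>auto intro: less_le_trans\<close>)
  then show "x \<in> lp" using assms lp_summable_mono[of "\<lambda>i. norm (x i)" "\<lambda>i. norm (y i)"]
    by (auto simp: lp_iff)
  show "\<parallel>x\<parallel> \<le> \<parallel>y\<parallel>" unfolding lp_norm_eq
    using assms by (intro lp_size_mono lp_summableD) auto
qed

lemma lp_dominated:
  assumes "y \<in> lp" "0 \<le> c" "\<And>i. norm (x i) \<le> c * norm (y i)"
  shows "x \<in> lp" "\<parallel>x\<parallel> \<le> c * \<parallel>y\<parallel>"
proof -
  have s: "lp_summable p (\<lambda>i. c * norm (y i))" "lp_size p (\<lambda>i. c * norm (y i)) = c * \<parallel>y\<parallel>"
    using assms lp_mult[of "\<lambda>i. norm (y i)" c] by (auto simp: lp_norm_eq lp_summableD)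
  have f: "finite {i. norm (x i) > e}" if "p = 0" "e > 0" for e
  proof (cases "c = 0")
    case True
    then show ?thesis using assms(3) that by simp
  next
    case False
    then have "e / c > 0" using assms that by simp
    then have "finite {i. norm (y i) > e / c}" using assms(1) that by (intro lp_finite_gt)
    then show ?thesis
      by (rule rev_finite_subset) (use False assms in \<open>auto simp: field_simps intro: less_le_trans\<close>)
  qed
  show "x \<in> lp" using f s(1) assms(3) lp_summable_mono[OF _ _ s(1), of "\<lambda>i. norm (x i)"]
    by (auto simp: lp_iff)
  show "\<parallel>x\<parallel> \<le> c * \<parallel>y\<parallel>"
    using lp_size_mono[OF _ _ s(1), of "\<lambda>i. norm (x i)"] assms(3) s(2) by (simp add: lp_norm_eq)
qed

lemma lp_add_mem:
  assumes "x \<in> lp" "y \<in> lp"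
  shows "x + y \<in> lp" "\<parallel>x + y\<parallel> \<le> \<parallel>x\<parallel> + \<parallel>y\<parallel>"
proof -
  have s: "lp_summable p (\<lambda>i. norm (x i) + norm (y i))"
    "lp_size p (\<lambda>i. norm (x i) + norm (y i)) \<le> \<parallel>x\<parallel> + \<parallel>y\<parallel>"
    using assms lp_add[of "\<lambda>i. norm (x i)" "\<lambda>i. norm (y i)"] by (auto simp: lp_norm_eq lp_summableD)
  have f: "finite {i. norm (x i + y i) > e}" if "p = 0" "e > 0" for e
  proof -
    have "{i. norm (x i + y i) > e} \<subseteq> {i. norm (x i) > e / 2} \<union> {i. norm (y i) > e / 2}"
      by (auto, smt (verit) field_sum_of_halves norm_triangle_ineq)
    moreover have "finite ({i. norm (x i) > e / 2} \<union> {i. norm (y i) > e / 2})"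
      using assms that by (intro finite_UnI lp_finite_gt) auto
    ultimately show ?thesis by (rule finite_subset)
  qed
  show "x + y \<in> lp"
    using f lp_summable_mono[OF _ _ s(1), of "\<lambda>i. norm (x i + y i)"] by (auto simp: lp_iff norm_triangle_ineq)
  show "\<parallel>x + y\<parallel> \<le> \<parallel>x\<parallel> + \<parallel>y\<parallel>"
    using lp_size_mono[OF _ _ s(1), of "\<lambda>i. norm (x i + y i)"] s(2)
    by (simp add: lp_norm_eq norm_triangle_ineq)
qed

lemma lp_zero_mem [simp]: "0 \<in> lp" "\<parallel>0\<parallel> = 0"
  by (auto simp: lp_iff lp_norm_eq)

lemma lp_scaleC:
  assumes "x \<in> lp"
  shows "seq_scaleC c x \<in> lp" "\<parallel>seq_scaleC c x\<parallel> = cmod c * \<parallel>x\<parallel>"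
proof -
  show "seq_scaleC c x \<in> lp"
    by (rule lp_dominated(1)[OF assms, of "cmod c"]) (auto simp: seq_scaleC_def norm_scaleC)
  show "\<parallel>seq_scaleC c x\<parallel> = cmod c * \<parallel>x\<parallel>"
    using lp_mult(2)[of "\<lambda>i. norm (x i)" "cmod c"] assms
    by (simp add: lp_norm_eq seq_scaleC_def norm_scaleC lp_summableD)
qed

lemma lp_uminus:
  assumes "x \<in> lp" shows "- x \<in> lp" "\<parallel>- x\<parallel> = \<parallel>x\<parallel>"
proof -
  show "- x \<in> lp" by (rule lp_solid(1)[OF assms]) simp
  show "\<parallel>- x\<parallel> = \<parallel>x\<parallel>" by (simp add: lp_norm_eq)
qed

lemma lp_diff_mem:
  assumes "x \<in> lp" "y \<in> lp"
  shows "x - y \<in> lp" "\<parallel>x - y\<parallel> \<le> \<parallel>x\<parallel> + \<parallel>y\<parallel>"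
  using lp_add_mem[of x "- y"] lp_uminus[of y] assms by auto

lemma nrm_diff_commute: "\<parallel>x - y\<parallel> = \<parallel>y - x\<parallel>"
  by (simp add: lp_norm_eq norm_minus_commute)

lemma nrm_triangle_sub:
  assumes "x \<in> lp" "y \<in> lp" shows "\<parallel>x\<parallel> \<le> \<parallel>y\<parallel> + \<parallel>x - y\<parallel>"
  using lp_add_mem(2)[of y "x - y"] lp_diff_mem(1)[of x y] assms by simp

lemma nrm_triangle3:
  assumes "x \<in> lp" "y \<in> lp" "z \<in> lp" shows "\<parallel>x - z\<parallel> \<le> \<parallel>x - y\<parallel> + \<parallel>y - z\<parallel>"
  using lp_add_mem(2)[of "x - y" "y - z"] lp_diff_mem(1)[OF assms(1,2)] lp_diff_mem(1)[OF assms(2,3)]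
  by simp

lemma lp_sum_mem:
  assumes "finite S" "\<And>b. b \<in> S \<Longrightarrow> x b \<in> lp"
  shows "(\<Sum>b\<in>S. x b) \<in> lp" "\<parallel>\<Sum>b\<in>S. x b\<parallel> \<le> (\<Sum>b\<in>S. \<parallel>x b\<parallel>)"
proof -
  have "(\<Sum>b\<in>S. x b) \<in> lp \<and> \<parallel>\<Sum>b\<in>S. x b\<parallel> \<le> (\<Sum>b\<in>S. \<parallel>x b\<parallel>)"
    using assms
  proof (induction S rule: finite_induct)
    case (insert b S)
    have eq: "(\<Sum>b\<in>insert b S. x b) = x b + (\<Sum>b\<in>S. x b)"
      "(\<Sum>b\<in>insert b S. \<parallel>x b\<parallel>) = \<parallel>x b\<parallel> + (\<Sum>b\<in>S. \<parallel>x b\<parallel>)"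
      using insert.hyps by (rule sum.insert)+
    have "x b \<in> lp" "(\<Sum>b\<in>S. x b) \<in> lp" "\<parallel>\<Sum>b\<in>S. x b\<parallel> \<le> (\<Sum>b\<in>S. \<parallel>x b\<parallel>)"
      using insert by auto
    then show ?case using lp_add_mem[of "x b" "\<Sum>b\<in>S. x b"] unfolding eq by linarith
  qed auto
  then show "(\<Sum>b\<in>S. x b) \<in> lp" "\<parallel>\<Sum>b\<in>S. x b\<parallel> \<le> (\<Sum>b\<in>S. \<parallel>x b\<parallel>)" by auto
qed

lemma nrm_eq_0D:
  assumes "x \<in> lp" "\<parallel>x\<parallel> \<le> 0" shows "x = 0"
proof
  fix i
  have "norm (x i) \<le> 0" using norm_coord_le[OF assms(1), of i] assms(2) by (rule order_trans)
  then show "x i = 0 i" by simp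
qed

lemma lp_rmul:
  assumes "x \<in> lp" "0 \<le> c" "\<And>i. \<bar>\<phi> i\<bar> \<le> c"
  shows "rmul \<phi> x \<in> lp" "\<parallel>rmul \<phi> x\<parallel> \<le> c * \<parallel>x\<parallel>"
proof -
  have "norm (rmul \<phi> x i) \<le> c * norm (x i)" for i
    using assms(3)[of i] by (simp add: rmul_def mult_right_mono)
  then show "rmul \<phi> x \<in> lp" "\<parallel>rmul \<phi> x\<parallel> \<le> c * \<parallel>x\<parallel>" using lp_dominated[OF assms(1,2)] by auto
qed

lemma lp_translate:
  assumes "x \<in> lp"
  shows "(\<lambda>i. x (i - k)) \<in> lp" "\<parallel>\<lambda>i. x (i - k)\<parallel> = \<parallel>x\<parallel>"
proof -
  have b: "bij (\<lambda>i. i - k)" by (rule bij_betw_byWitness[of _ "\<lambda>i. i + k"]) auto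
  have "finite {i. norm (x (i - k)) > e}" if "finite {i. norm (x i) > e}" for e
  proof -
    have "{i. norm (x (i - k)) > e} = (\<lambda>i. i + k) ` {i. norm (x i) > e}"
      by (auto intro!: image_eqI[of _ _ "_ - k"])
    then show ?thesis using that by simp
  qed
  then show "(\<lambda>i. x (i - k)) \<in> lp" using assms lp_reindex(1)[OF _ _ b, of "\<lambda>i. norm (x i)"]
    by (auto simp: lp_iff)
  show "\<parallel>\<lambda>i. x (i - k)\<parallel> = \<parallel>x\<parallel>"
    using lp_reindex(2)[OF _ _ b, of "\<lambda>i. norm (x i)"] assms by (simp add: lp_norm_eq lp_summableD)
qed

lemma lp_finitely_supported:
  assumes "finite S" "\<And>i. i \<notin> S \<Longrightarrow> x i = 0"
  shows "x \<in> lp" "\<parallel>x\<parallel> \<le> (\<Sum>i\<in>S. norm (x i))"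
proof -
  have "finite {i. norm (x i) > e}" if "e > 0" for e
    by (rule rev_finite_subset[OF assms(1)]) (use assms(2) that in force)
  then show "x \<in> lp" using lp_finite_support(1)[OF assms(1), of "\<lambda>i. norm (x i)"] assms
    by (auto simp: lp_iff)
  show "\<parallel>x\<parallel> \<le> (\<Sum>i\<in>S. norm (x i))" unfolding lp_norm_eq
    using assms by (intro lp_finite_support(2)) auto
qed

text \<open>Bounds on all cubes carry over to the whole sequence without any approximation by
  finitely supported ones. For p = 0 uniform bounds on cubes do not imply membership, so the
  finiteness of the superlevel sets enters as a hypothesis.\<close>

lemma lp_Fatou:
  assumes c: "0 \<le> c" "\<And>m. \<parallel>rmul (indicat_real (cube m)) x\<parallel> \<le> c"
    and z: "p = 0 \<Longrightarrow> \<forall>e>0. finite {i. norm (x i) > e}"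
  shows "x \<in> lp" "\<parallel>x\<parallel> \<le> c"
proof -
  have "lp_le p (\<lambda>i. norm (x i)) c"
  proof (rule lp_le_Fatou)
    fix S :: "(int ^ 'a) set" assume "finite S"
    then obtain m where m: "S \<subseteq> cube m" using finite_subset_cube by blast
    have "rmul (indicat_real (cube m)) x \<in> lp"
      by (rule lp_finitely_supported(1)[OF finite_cube[of m]]) (auto simp: rmul_def)
    then have "lp_le p (\<lambda>i. norm (rmul (indicat_real (cube m)) x i)) c"
      using c lp_le_iff[of "\<lambda>i. norm (rmul (indicat_real (cube m)) x i)" c]
      by (auto simp: lp_norm_eq lp_summableD)
    then show "lp_le p (\<lambda>i. if i \<in> S then norm (x i) else 0) c"
      by (rule lp_le_mono[rotated 2]) (use m in \<open>auto simp: rmul_def indicator_def\<close>)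
  qed (use c in auto)
  then have "lp_summable p (\<lambda>i. norm (x i))" "lp_size p (\<lambda>i. norm (x i)) \<le> c"
    using lp_leD[of "\<lambda>i. norm (x i)" c] c by auto
  then show "x \<in> lp" "\<parallel>x\<parallel> \<le> c" using z by (auto simp: lp_iff lp_norm_eq)
qed

text \<open>On a fixed cube the norm is at most a finite sum of coordinate norms.\<close>

lemma nrm_tendsto_0_cube:
  assumes "\<And>i. (\<lambda>n. x n i) \<longlonglongrightarrow> 0"
  shows "(\<lambda>n. \<parallel>rmul (indicat_real (cube m)) (x n)\<parallel>) \<longlonglongrightarrow> 0"
proof (rule tendsto_sandwich[OF _ _ tendsto_const])
  show "\<forall>\<^sub>F n in sequentially. 0 \<le> \<parallel>rmul (indicat_real (cube m)) (x n)\<parallel>"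
    by (intro always_eventually allI nrm_nonneg lp_finitely_supported(1)[OF finite_cube[of m]])
      (auto simp: rmul_def)
  show "\<forall>\<^sub>F n in sequentially. \<parallel>rmul (indicat_real (cube m)) (x n)\<parallel> \<le> (\<Sum>i\<in>cube m. norm (x n i))"
    by (intro always_eventually allI order_trans[OF lp_finitely_supported(2)[OF finite_cube[of m]]] sum_mono)
      (auto simp: rmul_def)
  show "(\<lambda>n. \<Sum>i\<in>cube m. norm (x n i)) \<longlonglongrightarrow> 0"
    using assms by (intro tendsto_null_sum tendsto_norm_zero)
qed

text \<open>The limit is taken coordinatewise. The rate \<open>e\<close> is part of hypothesis and
  conclusion, so the limit can be estimated against each member of the sequence; this is how the
  Neumann series is handled later.\<close>

lemma lp_complete:
  assumes x: "\<And>n. x n \<in> lp" and cau: "\<And>n m. n \<le> m \<Longrightarrow> \<parallel>x m - x n\<parallel> \<le> e n" and e: "e \<longlonglongrightarrow> 0"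
  obtains y where "y \<in> lp" "\<And>n. \<parallel>y - x n\<parallel> \<le> e n"
proof -
  have en: "0 \<le> e n" for n using cau[of n n] by simp
  have co: "norm (x m i - x n i) \<le> e n" if "n \<le> m" for n m i
    using norm_coord_le[OF lp_diff_mem(1)[OF x[of m] x[of n]], of i] cau[OF that] by simp
  have "Cauchy (\<lambda>n. x n i)" for i
  proof (rule CauchyI)
    fix r :: real assume "r > 0"
    then obtain N where N: "e N < r / 2" using order_tendstoD(2)[OF e, of "r / 2"]
      by (auto simp: eventually_sequentially)
    have "norm (x m i - x n i) < r" if "N \<le> m" "N \<le> n" for m n
    proof -
      have "norm (x m i - x n i) \<le> norm (x m i - x N i) + norm (x n i - x N i)"
        by (metis norm_minus_commute norm_triangle_sub norm_diff_triangle_ineq diff_add_cancel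
            norm_diff_triangle_le order_refl)
      then show ?thesis using co[OF that(1), of i] co[OF that(2), of i] N by simp
    qed
    then show "\<exists>M. \<forall>m\<ge>M. \<forall>n\<ge>M. norm (x m i - x n i) < r" by blast
  qed
  then have "\<exists>y. (\<lambda>n. x n i) \<longlonglongrightarrow> y" for i by (simp add: Cauchy_convergent_iff convergent_def)
  then obtain y where y: "\<And>i. (\<lambda>n. x n i) \<longlonglongrightarrow> y i" by metis
  \<comment> \<open>The auxiliary index \<open>k\<close> is chosen after the cube, so late that
    \<open>x k\<close> is within \<open>r\<close> of \<open>y\<close> there; the Cauchy bound
    compares \<open>x k\<close> with \<open>x n\<close>.\<close>
  have cb: "\<parallel>rmul (indicat_real (cube m)) (y - x n)\<parallel> \<le> e n" for m n
  proof (rule field_le_epsilon)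
    fix r :: real assume "r > 0"
    have "(\<lambda>k. \<parallel>rmul (indicat_real (cube m)) (y - x k)\<parallel>) \<longlonglongrightarrow> 0"
      using y by (intro nrm_tendsto_0_cube) (auto intro!: tendsto_eq_intros)
    then have "\<forall>\<^sub>F k in sequentially. \<parallel>rmul (indicat_real (cube m)) (y - x k)\<parallel> < r"
      using \<open>r > 0\<close> by (rule order_tendstoD)
    then have "\<forall>\<^sub>F k in sequentially. \<parallel>rmul (indicat_real (cube m)) (y - x k)\<parallel> < r \<and> n \<le> k"
      using eventually_ge_at_top[of n] by (rule eventually_conj)
    then obtain k where k: "\<parallel>rmul (indicat_real (cube m)) (y - x k)\<parallel> < r" "n \<le> k"
      by (auto simp: eventually_sequentially)
    have mem: "rmul (indicat_real (cube m)) z \<in> lp" for z :: "('a, 'b) seq"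
      by (rule lp_finitely_supported(1)[OF finite_cube[of m]]) (auto simp: rmul_def)
    have "rmul (indicat_real (cube m)) (y - x n)
        = rmul (indicat_real (cube m)) (y - x k) + rmul (indicat_real (cube m)) (x k - x n)"
      by (auto simp: rmul_def algebra_simps)
    then have "\<parallel>rmul (indicat_real (cube m)) (y - x n)\<parallel>
        \<le> \<parallel>rmul (indicat_real (cube m)) (y - x k)\<parallel> + \<parallel>rmul (indicat_real (cube m)) (x k - x n)\<parallel>"
      using lp_add_mem(2)[OF mem mem] by metis
    moreover have "\<parallel>rmul (indicat_real (cube m)) (x k - x n)\<parallel> \<le> 1 * \<parallel>x k - x n\<parallel>"
      using x by (intro lp_rmul lp_diff_mem) auto
    ultimately show "\<parallel>rmul (indicat_real (cube m)) (y - x n)\<parallel> \<le> e n + r"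
      using k cau[OF k(2)] by linarith
  qed
  have ycn: "norm (y i - x n i) \<le> e n" for i n
  proof (rule tendsto_upperbound)
    show "(\<lambda>m. norm (x m i - x n i)) \<longlonglongrightarrow> norm (y i - x n i)" by (intro tendsto_intros y)
    show "\<forall>\<^sub>F m in sequentially. norm (x m i - x n i) \<le> e n"
      using eventually_ge_at_top[of n] by eventually_elim (rule co)
  qed auto
  \<comment> \<open>Decay of the limit for p = 0: coordinates of \<open>y\<close> and of a late
    \<open>x N\<close> differ by less than \<open>r / 2\<close> uniformly, so large coordinates of
    \<open>y\<close> are large for \<open>x N\<close>.\<close>
  have fin: "finite {i. norm (y i) > r}" if "p = 0" "r > 0" for r
  proof -
    obtain N where N: "e N < r / 2" using order_tendstoD(2)[OF e, of "r / 2"] \<open>r > 0\<close>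
      by (auto simp: eventually_sequentially)
    have "finite {i. norm (x N i) > r / 2}" using x[of N] that by (intro lp_finite_gt) auto
    then show ?thesis
    proof (rule rev_finite_subset, safe)
      fix i assume "r < norm (y i)"
      then show "r / 2 < norm (x N i)"
        using ycn[of i N] N norm_triangle_ineq2[of "y i" "x N i"] by linarith
    qed
  qed
  have fin': "finite {i. norm ((y - x n) i) > r}" if "p = 0" "r > 0" for r n
  proof -
    have "{i. norm ((y - x n) i) > r} \<subseteq> {i. norm (y i) > r / 2} \<union> {i. norm (x n i) > r / 2}"
      by (auto, smt (verit) field_sum_of_halves norm_triangle_ineq4)
    moreover have "finite ({i. norm (y i) > r / 2} \<union> {i. norm (x n i) > r / 2})"
      using that by (intro finite_UnI lp_finite_gt[OF x] fin) auto
    ultimately show ?thesis by (rule finite_subset)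
  qed
  have yx: "y - x n \<in> lp" "\<parallel>y - x n\<parallel> \<le> e n" for n
    using lp_Fatou[OF en cb] fin' by auto
  then have "y \<in> lp" using lp_add_mem(1)[OF yx(1)[of 0] x[of 0]] by simp
  then show thesis using that yx(2) by blast
qed

end


section \<open>Operators\<close>

text \<open>
  Rewriting with a function-valued equation eta-expands its right-hand side, and these rules would
  then push the algebra of sequences to the pointwise level. They are kept for operators only.
\<close>

lemmas fun_apply = plus_fun_apply zero_fun_apply minus_apply uminus_apply

declare fun_apply [simp del]

lemma oper_apply [simp]:
  fixes A B :: "('n::finite, 'x::complex_banach) oper"
  shows "(A + B) x = A x + B x" "(A - B) x = A x - B x" "(- A) x = - A x"
    "(0 :: ('n, 'x) oper) x = 0"
  by (simp_all add: fun_apply)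

text \<open>The actions of \<open>P\<^sub>m\<close> and \<open>Q\<^sub>m\<close> on arbitrary sequences.\<close>

abbreviation cut :: "nat \<Rightarrow> (int ^ 'n::finite \<Rightarrow> 'x::real_vector) \<Rightarrow> int ^ 'n \<Rightarrow> 'x" where
  "cut m \<equiv> rmul (indicat_real (cube m))"

abbreviation tail :: "nat \<Rightarrow> (int ^ 'n::finite \<Rightarrow> 'x::real_vector) \<Rightarrow> int ^ 'n \<Rightarrow> 'x" where
  "tail m \<equiv> rmul (indicat_real (- cube m))"

lemma cut_plus_tail: "cut m x + tail m x = x"
  by (auto simp: rmul_def indicator_def fun_apply)

lemma tail_eq_diff: "tail m x = x - cut m x"
  using cut_plus_tail[of m x] by (simp add: algebra_simps)

lemma rmul_zero [simp]: "rmul \<phi> 0 = 0"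
  by (auto simp: rmul_def fun_apply)

lemma cube_mono: "m \<le> n \<Longrightarrow> cube m \<subseteq> cube n"
  by (auto simp: mem_cube_iff)

lemma tail_tail: "m \<le> n \<Longrightarrow> tail m (tail n x) = tail n x" "m \<le> n \<Longrightarrow> tail n (tail m x) = tail n x"
  using cube_mono[of m n] by (auto simp: rmul_def indicator_def fun_eq_iff)

definition mop :: "ereal \<Rightarrow> (int ^ 'n \<Rightarrow> real) \<Rightarrow> ('n::finite, 'x::complex_banach) oper" where
  "mop p \<phi> = lp_restrict p (rmul \<phi>)"

lemma P_op_eq: "P_op p m = mop p (indicat_real (cube m))"
  unfolding P_op_def mop_def
  by (intro arg_cong[of _ _ "lp_restrict p"]) (auto simp: rmul_def indicator_def fun_eq_iff)

lemma id_op_eq: "id_op p = mop p (\<lambda>_. 1)"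
  unfolding id_op_def mop_def
  by (intro arg_cong[of _ _ "lp_restrict p"]) (auto simp: rmul_def fun_eq_iff)

lemma Q_op_eq: "Q_op p m = mop p (indicat_real (- cube m))"
  unfolding Q_op_def P_op_eq id_op_def mop_def lp_restrict_def
  by (auto simp: fun_eq_iff rmul_def indicator_def fun_apply)

section \<open>Bounded operators, the operator norm, multiplications and shifts\<close>

context lp_exponent
begin

abbreviation ops :: "('n::finite, 'x::complex_banach) oper set" where
  "ops \<equiv> bounded_ops p"

abbreviation opn :: "('n::finite, 'x::complex_banach) oper \<Rightarrow> real" where
  "opn \<equiv> opnorm p"

abbreviation compacts :: "('n::finite, 'x::complex_banach) oper set" where
  "compacts \<equiv> P_compact_ops p"

abbreviation Pops :: "('n::finite, 'x::complex_banach) oper set" where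
  "Pops \<equiv> P_ops p"

lemma lp_cut [simp]: "cut m x \<in> lp"
  by (rule lp_finitely_supported(1)[OF finite_cube[of m]]) (auto simp: rmul_def)

lemma lp_ind:
  assumes "x \<in> lp" shows "rmul (indicat_real S) x \<in> lp" "\<parallel>rmul (indicat_real S) x\<parallel> \<le> \<parallel>x\<parallel>"
  using lp_rmul[OF assms, of 1 "indicat_real S"] by auto

lemma lp_uminus_nrm: "\<parallel>- x\<parallel> = \<parallel>x\<parallel>"
  by (simp add: lp_norm_eq fun_apply)

lemma opsI:
  assumes "\<And>x. x \<notin> lp \<Longrightarrow> T x = 0" "\<And>x. x \<in> lp \<Longrightarrow> T x \<in> lp"
    "\<And>x y. x \<in> lp \<Longrightarrow> y \<in> lp \<Longrightarrow> T (x + y) = T x + T y"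
    "\<And>c x. x \<in> lp \<Longrightarrow> T (seq_scaleC c x) = seq_scaleC c (T x)"
    "\<And>x. x \<in> lp \<Longrightarrow> \<parallel>T x\<parallel> \<le> C * \<parallel>x\<parallel>"
  shows "T \<in> ops"
  unfolding bounded_ops_def using assms by blast

lemma ops_outside: "T \<in> ops \<Longrightarrow> x \<notin> lp \<Longrightarrow> T x = 0"
  and ops_mem: "T \<in> ops \<Longrightarrow> x \<in> lp \<Longrightarrow> T x \<in> lp"
  and ops_add: "T \<in> ops \<Longrightarrow> x \<in> lp \<Longrightarrow> y \<in> lp \<Longrightarrow> T (x + y) = T x + T y"
  and ops_scaleC: "T \<in> ops \<Longrightarrow> x \<in> lp \<Longrightarrow> T (seq_scaleC c x) = seq_scaleC c (T x)"
  unfolding bounded_ops_def by blast+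

lemma seq_scaleC_minus_one: "seq_scaleC (-1) x = - x"
  by (auto simp: seq_scaleC_def scaleC_minus_one fun_apply)

declare ops_mem [simp] lp_add_mem(1) [simp] lp_diff_mem(1) [simp] lp_scaleC(1) [simp] lp_uminus(1) [simp]
  lp_ind(1) [simp]

lemma ops_uminus: "T \<in> ops \<Longrightarrow> x \<in> lp \<Longrightarrow> T (- x) = - T x"
  using ops_scaleC[of T x "-1"] by (simp add: seq_scaleC_minus_one)

lemma ops_diff:
  assumes "T \<in> ops" "x \<in> lp" "y \<in> lp" shows "T (x - y) = T x - T y"
  using ops_add[OF assms(1,2) lp_uminus(1)[OF assms(3)]] ops_uminus[OF assms(1,3)] by simp

lemma ops_zero [simp]: "T \<in> ops \<Longrightarrow> T 0 = 0"
  using ops_diff[of T 0 0] by simp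

lemma ops_sum:
  assumes "T \<in> ops" "finite S" "\<And>b. b \<in> S \<Longrightarrow> x b \<in> lp"
  shows "T (\<Sum>b\<in>S. x b) = (\<Sum>b\<in>S. T (x b))"
  using assms(2,3)
proof (induction S rule: finite_induct)
  case empty
  then show ?case using ops_zero[OF assms(1)] by (simp only: sum.empty)
next
  case (insert b S)
  have "T (x b + (\<Sum>b\<in>S. x b)) = T (x b) + T (\<Sum>b\<in>S. x b)"
    using insert by (intro ops_add[OF assms(1)] lp_sum_mem) auto
  then show ?case using insert unfolding sum.insert[OF insert.hyps] by simp
qed

lemma opn_le:
  assumes "0 \<le> c" "\<And>x. x \<in> lp \<Longrightarrow> \<parallel>T x\<parallel> \<le> c * \<parallel>x\<parallel>" shows "opn T \<le> c"
  unfolding opnorm_def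
proof (rule cSUP_least)
  show "{x \<in> lp. \<parallel>x\<parallel> \<le> 1} \<noteq> {}" using lp_zero_mem by (metis (mono_tags, lifting) empty_iff mem_Collect_eq zero_le_one)
  fix x :: "('a, 'b) seq" assume x: "x \<in> {x \<in> lp. \<parallel>x\<parallel> \<le> 1}"
  then have "c * \<parallel>x\<parallel> \<le> c * 1" using assms(1) by (intro mult_left_mono) auto
  then show "\<parallel>T x\<parallel> \<le> c" using assms(2)[of x] x by simp
qed

lemma opn_upper:
  assumes "T \<in> ops" "x \<in> lp" "\<parallel>x\<parallel> \<le> 1" shows "\<parallel>T x\<parallel> \<le> opn T"
proof -
  obtain C where C: "\<And>x. x \<in> lp \<Longrightarrow> \<parallel>T x\<parallel> \<le> C * \<parallel>x\<parallel>"
    using assms(1) unfolding bounded_ops_def by blast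
  have "\<parallel>T y\<parallel> \<le> \<bar>C\<bar>" if "y \<in> lp" "\<parallel>y\<parallel> \<le> 1" for y
  proof -
    have "C * \<parallel>y\<parallel> \<le> \<bar>C\<bar> * 1"
      using that nrm_nonneg[of y] by (intro mult_mono) auto
    then show ?thesis using C[OF that(1)] by simp
  qed
  then have "bdd_above ((\<lambda>y. \<parallel>T y\<parallel>) ` {x \<in> lp. \<parallel>x\<parallel> \<le> 1})"
    by (intro bdd_aboveI[of _ "\<bar>C\<bar>"]) auto
  then show ?thesis unfolding opnorm_def using assms by (intro cSUP_upper) auto
qed

lemma opn_nonneg:
  fixes T :: "('n::finite, 'x::complex_banach) oper"
  assumes "T \<in> ops" shows "0 \<le> opn T"
  using opn_upper[OF assms, of 0] ops_zero[OF assms] by simp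

lemma opn_bound:
  assumes T: "T \<in> ops" and x: "x \<in> lp" shows "\<parallel>T x\<parallel> \<le> opn T * \<parallel>x\<parallel>"
proof (cases "\<parallel>x\<parallel> = 0")
  case True
  then have "x = 0" using nrm_eq_0D[OF x] by linarith
  then show ?thesis using T True by simp
next
  case False
  then have pos: "\<parallel>x\<parallel> > 0" using nrm_nonneg[OF x] by linarith
  let ?c = "complex_of_real (1 / \<parallel>x\<parallel>)"
  have c: "cmod ?c = 1 / \<parallel>x\<parallel>" using pos by (simp only: norm_of_real) simp
  have m: "seq_scaleC ?c x \<in> lp" "\<parallel>seq_scaleC ?c x\<parallel> = 1"
    using lp_scaleC[OF x, of ?c] pos unfolding c by auto
  have "\<parallel>T (seq_scaleC ?c x)\<parallel> = 1 / \<parallel>x\<parallel> * \<parallel>T x\<parallel>"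
    using lp_scaleC(2)[OF ops_mem[OF T x], of ?c] ops_scaleC[OF T x, of ?c] unfolding c by simp
  moreover have "\<parallel>T (seq_scaleC ?c x)\<parallel> \<le> opn T" using opn_upper[OF T m(1)] m(2) by simp
  ultimately have "1 / \<parallel>x\<parallel> * \<parallel>T x\<parallel> \<le> opn T" by simp
  from mult_left_mono[OF this, of "\<parallel>x\<parallel>"] pos show ?thesis by (simp add: mult.commute)
qed

lemma opn_bound':
  assumes "T \<in> ops" "x \<in> lp" "opn T \<le> c" shows "\<parallel>T x\<parallel> \<le> c * \<parallel>x\<parallel>"
  using opn_bound[OF assms(1,2)] mult_right_mono[OF assms(3) nrm_nonneg[OF assms(2)]] by linarith

lemma seq_scaleC_add: "seq_scaleC c (x + y) = seq_scaleC c x + seq_scaleC c y"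
  by (auto simp: seq_scaleC_def scaleC_add_right fun_apply)

lemma seq_scaleC_diff: "seq_scaleC c (x - y) = seq_scaleC c x - seq_scaleC c y"
  by (auto simp: seq_scaleC_def scaleC_diff_right fun_apply)

lemma seq_scaleC_commute: "seq_scaleC c (seq_scaleC d x) = seq_scaleC d (seq_scaleC c x)"
  by (auto simp: seq_scaleC_def scaleC_scaleC mult.commute)

lemma ops_plus:
  assumes "A \<in> ops" "B \<in> ops" shows "A + B \<in> ops" "opn (A + B) \<le> opn A + opn B"
proof -
  have b: "\<parallel>(A + B) x\<parallel> \<le> (opn A + opn B) * \<parallel>x\<parallel>" if "x \<in> lp" for x
    using lp_add_mem(2)[OF ops_mem[OF assms(1) that] ops_mem[OF assms(2) that]]
      opn_bound[OF assms(1) that] opn_bound[OF assms(2) that] by (simp add: distrib_right)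
  show "A + B \<in> ops"
    by (rule opsI[where C = "opn A + opn B"])
      (use assms b in \<open>auto simp: ops_outside ops_mem ops_add ops_scaleC lp_add_mem seq_scaleC_add\<close>)
  show "opn (A + B) \<le> opn A + opn B"
    using b opn_nonneg assms by (intro opn_le add_nonneg_nonneg) auto
qed

lemma ops_op_scaleC:
  assumes "A \<in> ops" shows "op_scaleC c A \<in> ops"
proof -
  have b: "\<parallel>op_scaleC c A x\<parallel> \<le> (cmod c * opn A) * \<parallel>x\<parallel>" if "x \<in> lp" for x
    using lp_scaleC(2)[OF ops_mem[OF assms that], of c] mult_left_mono[OF opn_bound[OF assms that], of "cmod c"]
    by (simp add: op_scaleC_def mult.assoc)
  show ?thesis
  proof (rule opsI[where C = "cmod c * opn A"])
    show "\<parallel>op_scaleC c A x\<parallel> \<le> (cmod c * opn A) * \<parallel>x\<parallel>" if "x \<in> lp" for x using that by (rule b)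
    show "op_scaleC c A x = 0" if "x \<notin> lp" for x
      using ops_outside[OF assms that] by (auto simp: op_scaleC_def seq_scaleC_def fun_apply fun_eq_iff)
    show "op_scaleC c A x \<in> lp" if "x \<in> lp" for x
      unfolding op_scaleC_def using assms that by (intro lp_scaleC) auto
    show "op_scaleC c A (x + y) = op_scaleC c A x + op_scaleC c A y" if "x \<in> lp" "y \<in> lp" for x y
      using ops_add[OF assms that] by (simp only: op_scaleC_def seq_scaleC_add)
    show "op_scaleC c A (seq_scaleC d x) = seq_scaleC d (op_scaleC c A x)" if "x \<in> lp" for d x
      using seq_scaleC_commute[of c d "A x"] ops_scaleC[OF assms that] by (simp only: op_scaleC_def)
  qed
qed

lemma op_scaleC_apply: "op_scaleC c A x = seq_scaleC c (A x)"
  by (simp add: op_scaleC_def)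

lemma op_scaleC_minus_one: "op_scaleC (-1) A = - A"
  by (rule ext) (simp add: op_scaleC_def seq_scaleC_minus_one)

lemma ops_neg: "A \<in> ops \<Longrightarrow> - A \<in> ops"
  using ops_op_scaleC[of A "-1"] by (simp add: op_scaleC_minus_one)

lemma opn_neg: "opn (- A) = opn A"
proof -
  have "\<parallel>(- A) x\<parallel> = \<parallel>A x\<parallel>" for x by (simp add: lp_uminus_nrm)
  then show ?thesis by (simp add: opnorm_def)
qed

lemma ops_minus:
  assumes "A \<in> ops" "B \<in> ops" shows "A - B \<in> ops" "opn (A - B) \<le> opn A + opn B"
  using ops_plus[of A "- B"] ops_neg[of B] opn_neg[of B] assms by auto

lemma ops_zero_mem: "0 \<in> ops"
  by (rule opsI[where C = 0]) (auto simp: seq_scaleC_def fun_eq_iff fun_apply)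

lemma ops_comp:
  assumes "A \<in> ops" "B \<in> ops" shows "A \<circ> B \<in> ops" "opn (A \<circ> B) \<le> opn A * opn B"
proof -
  have b: "\<parallel>(A \<circ> B) x\<parallel> \<le> (opn A * opn B) * \<parallel>x\<parallel>" if "x \<in> lp" for x
  proof -
    have "\<parallel>A (B x)\<parallel> \<le> opn A * \<parallel>B x\<parallel>" using assms that by (intro opn_bound) auto
    also have "\<dots> \<le> opn A * (opn B * \<parallel>x\<parallel>)"
      using assms that by (intro mult_left_mono opn_bound opn_nonneg)
    finally show ?thesis by (simp add: mult.assoc)
  qed
  show "A \<circ> B \<in> ops"
    by (rule opsI[where C = "opn A * opn B"])
      (use assms b in \<open>auto simp: ops_outside ops_mem ops_add ops_scaleC\<close>)
  show "opn (A \<circ> B) \<le> opn A * opn B"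
    using b opn_nonneg assms by (intro opn_le mult_nonneg_nonneg) auto
qed

lemma mop_apply: "x \<in> lp \<Longrightarrow> mop p \<phi> x = rmul \<phi> x"
  by (simp add: mop_def lp_restrict_def)

lemma mop_mem:
  assumes "0 \<le> c" "\<And>i. \<bar>\<phi> i\<bar> \<le> c"
  shows "mop p \<phi> \<in> ops" "opn (mop p \<phi>) \<le> c"
proof -
  have b: "\<parallel>mop p \<phi> x\<parallel> \<le> c * \<parallel>x\<parallel>" if "x \<in> lp" for x
    using lp_rmul[OF that assms] that by (simp add: mop_apply)
  show "mop p \<phi> \<in> ops"
  proof (rule opsI[where C = c])
    show "\<parallel>mop p \<phi> x\<parallel> \<le> c * \<parallel>x\<parallel>" if "x \<in> lp" for x using that by (rule b)
    show "mop p \<phi> x = 0" if "x \<notin> lp" for x using that by (simp add: mop_def lp_restrict_def)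
    show "mop p \<phi> x \<in> lp" if "x \<in> lp" for x
      using lp_rmul(1)[OF that assms] that by (simp add: mop_apply)
    show "mop p \<phi> (seq_scaleC c x) = seq_scaleC c (mop p \<phi> x)" if "x \<in> lp" for c x
      using that lp_scaleC(1)[OF that, of c]
      by (auto simp: mop_apply rmul_def seq_scaleC_def scaleC_scaleR)
  qed (auto simp: mop_apply lp_add_mem rmul_add)
  show "opn (mop p \<phi>) \<le> c" using assms b by (intro opn_le)
qed

lemma mop_ind_mem [simp]: "mop p (indicat_real S) \<in> ops"
  by (rule mop_mem(1)[of 1]) auto

lemma id_op_mem [simp]: "id_op p \<in> ops"
  unfolding id_op_eq by (rule mop_mem(1)[of 1]) auto

lemma id_op_apply: "x \<in> lp \<Longrightarrow> id_op p x = x"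
  by (simp add: id_op_def lp_restrict_def)

lemma id_op_comp: "A \<in> ops \<Longrightarrow> id_op p \<circ> A = A" "A \<in> ops \<Longrightarrow> A \<circ> id_op p = A"
proof -
  show "id_op p \<circ> A = A" if "A \<in> ops"
  proof
    fix x show "(id_op p \<circ> A) x = A x"
      using that by (cases "x \<in> lp") (auto simp: id_op_apply ops_mem ops_outside)
  qed
  show "A \<circ> id_op p = A" if "A \<in> ops"
  proof
    fix x show "(A \<circ> id_op p) x = A x"
      using that by (cases "x \<in> lp") (auto simp: id_op_apply ops_outside id_op_def lp_restrict_def)
  qed
qed

lemma shift_apply: "x \<in> lp \<Longrightarrow> shift_op p k x = (\<lambda>i. x (i - k))"
  by (simp add: shift_op_def lp_restrict_def)

lemma shift_apply': "x \<in> lp \<Longrightarrow> shift_op p k x i = x (i - k)"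
  by (simp add: shift_apply)

lemma shift_nrm: "x \<in> lp \<Longrightarrow> \<parallel>shift_op p k x\<parallel> = \<parallel>x\<parallel>"
  by (simp add: shift_apply lp_translate)

lemma shift_mem: "shift_op p k \<in> ops"
proof (rule opsI[where C = 1])
  show "shift_op p k x = 0" if "x \<notin> lp" for x :: "('a, 'b) seq"
    using that by (simp add: shift_op_def lp_restrict_def)
  show "shift_op p k (seq_scaleC c x) = seq_scaleC c (shift_op p k x)" if "x \<in> lp"
    for c and x :: "('a, 'b) seq"
    using that lp_scaleC(1)[OF that, of c] by (auto simp: shift_apply seq_scaleC_def)
qed (auto simp: shift_apply lp_translate fun_apply fun_eq_iff)

lemma shift_lp: "x \<in> lp \<Longrightarrow> shift_op p k x \<in> lp"
  by (rule ops_mem[OF shift_mem])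

lemma shift_shift: "x \<in> lp \<Longrightarrow> shift_op p k (shift_op p l x) = shift_op p (k + l) x"
  by (auto simp: shift_apply lp_translate algebra_simps)

lemma shift_zero: "x \<in> lp \<Longrightarrow> shift_op p 0 x = x"
  by (simp add: shift_apply)

lemma shift_cancel: "x \<in> lp \<Longrightarrow> shift_op p k (shift_op p (- k) x) = x"
  "x \<in> lp \<Longrightarrow> shift_op p (- k) (shift_op p k x) = x"
  by (simp_all add: shift_shift shift_zero)

lemma ops_eqI:
  assumes "A \<in> ops" "B \<in> ops" "\<And>x. x \<in> lp \<Longrightarrow> A x = B x" shows "A = B"
proof
  fix x show "A x = B x" using assms by (cases "x \<in> lp") (auto simp: ops_outside)
qed

section \<open>The ideal of operators that are small near infinity on both sides\<close>

lemma nrm_zero_le: "y = 0 \<Longrightarrow> 0 \<le> c \<Longrightarrow> x \<in> lp \<Longrightarrow> \<parallel>y\<parallel> \<le> c * \<parallel>x\<parallel>"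
  using nrm_nonneg[of x] by simp

lemma tail_antimono:
  assumes "x \<in> lp" "m \<le> n" shows "\<parallel>tail n x\<parallel> \<le> \<parallel>tail m x\<parallel>"
  using lp_ind(2)[of "tail m x" "- cube n"] tail_tail(2)[OF assms(2), of x] lp_ind(1)[OF assms(1)] by simp

text \<open>Both quantities in the definition decrease in \<open>n\<close>, so convergence can be tested at a single index.\<close>

lemma compactI:
  assumes K: "K \<in> ops"
    and s: "\<And>e. e > 0 \<Longrightarrow> \<exists>m. \<forall>x\<in>lp. \<parallel>tail m (K x)\<parallel> \<le> e * \<parallel>x\<parallel> \<and> \<parallel>K (tail m x)\<parallel> \<le> e * \<parallel>x\<parallel>"
  shows "K \<in> compacts"
proof -
  have "(\<lambda>n. opn (Q_op p n \<circ> K) + opn (K \<circ> Q_op p n)) \<longlonglongrightarrow> 0"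
  proof (rule LIMSEQ_I)
    fix r :: real assume "r > 0"
    then obtain m where m: "\<And>x. x \<in> lp \<Longrightarrow> \<parallel>tail m (K x)\<parallel> \<le> r / 3 * \<parallel>x\<parallel>"
      "\<And>x. x \<in> lp \<Longrightarrow> \<parallel>K (tail m x)\<parallel> \<le> r / 3 * \<parallel>x\<parallel>"
      using s[of "r / 3"] by auto
    have "norm (opn (Q_op p n \<circ> K) + opn (K \<circ> Q_op p n) - 0) < r" if "m \<le> n" for n
    proof -
      have "opn (Q_op p n \<circ> K) \<le> r / 3"
      proof (rule opn_le)
        fix x :: "('a, 'b) seq" assume x: "x \<in> lp"
        have "\<parallel>tail n (K x)\<parallel> \<le> \<parallel>tail m (K x)\<parallel>" using x K that by (intro tail_antimono) auto
        then show "\<parallel>(Q_op p n \<circ> K) x\<parallel> \<le> r / 3 * \<parallel>x\<parallel>"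
          using m(1)[OF x] ops_mem[OF K x] by (simp add: Q_op_eq mop_apply)
      qed (use \<open>r > 0\<close> in simp)
      moreover have "opn (K \<circ> Q_op p n) \<le> r / 3"
      proof (rule opn_le)
        fix x :: "('a, 'b) seq" assume x: "x \<in> lp"
        have "\<parallel>K (tail m (tail n x))\<parallel> \<le> r / 3 * \<parallel>tail n x\<parallel>" using x by (intro m lp_ind)
        also have "\<dots> \<le> r / 3 * \<parallel>x\<parallel>" using x \<open>r > 0\<close> by (intro mult_left_mono lp_ind) auto
        finally show "\<parallel>(K \<circ> Q_op p n) x\<parallel> \<le> r / 3 * \<parallel>x\<parallel>"
          using x that by (simp add: Q_op_eq mop_apply tail_tail)
      qed (use \<open>r > 0\<close> in simp)
      moreover have "0 \<le> opn (Q_op p n \<circ> K)" "0 \<le> opn (K \<circ> Q_op p n)"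
        using K by (auto intro!: opn_nonneg ops_comp simp: Q_op_eq)
      ultimately show ?thesis using \<open>r > 0\<close> by simp
    qed
    then show "\<exists>m. \<forall>n\<ge>m. norm (opn (Q_op p n \<circ> K) + opn (K \<circ> Q_op p n) - 0) < r" by blast
  qed
  then show ?thesis using K by (simp add: P_compact_ops_def)
qed

lemma compactD:
  assumes "K \<in> compacts"
  shows "K \<in> ops"
    and "e > 0 \<Longrightarrow> \<exists>m. \<forall>n\<ge>m. \<forall>x\<in>lp. \<parallel>tail n (K x)\<parallel> \<le> e * \<parallel>x\<parallel> \<and> \<parallel>K (tail n x)\<parallel> \<le> e * \<parallel>x\<parallel>"
proof -
  show K: "K \<in> ops" using assms by (simp add: P_compact_ops_def)
  assume "e > 0"
  have "(\<lambda>n. opn (Q_op p n \<circ> K) + opn (K \<circ> Q_op p n)) \<longlonglongrightarrow> 0"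
    using assms by (simp add: P_compact_ops_def)
  then have "\<forall>\<^sub>F n in sequentially. opn (Q_op p n \<circ> K) + opn (K \<circ> Q_op p n) < e"
    using \<open>e > 0\<close> by (rule order_tendstoD)
  then obtain m where m: "opn (Q_op p n \<circ> K) + opn (K \<circ> Q_op p n) < e" if "m \<le> n" for n
    by (auto simp: eventually_sequentially)
  have c: "Q_op p n \<circ> K \<in> ops" "K \<circ> Q_op p n \<in> ops" for n
    using K by (auto intro!: ops_comp simp: Q_op_eq)
  have "\<parallel>tail n (K x)\<parallel> \<le> e * \<parallel>x\<parallel> \<and> \<parallel>K (tail n x)\<parallel> \<le> e * \<parallel>x\<parallel>" if "m \<le> n" "x \<in> lp" for n x
  proof -
    have "opn (Q_op p n \<circ> K) \<le> e" "opn (K \<circ> Q_op p n) \<le> e"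
      using m[OF that(1)] opn_nonneg[OF c(1)] opn_nonneg[OF c(2)] by (smt (verit))+
    then show ?thesis
      using opn_bound'[OF c(1) that(2), of n e] opn_bound'[OF c(2) that(2), of n e] that(2) ops_mem[OF K that(2)]
      by (simp add: Q_op_eq mop_apply)
  qed
  then show "\<exists>m. \<forall>n\<ge>m. \<forall>x\<in>lp. \<parallel>tail n (K x)\<parallel> \<le> e * \<parallel>x\<parallel> \<and> \<parallel>K (tail n x)\<parallel> \<le> e * \<parallel>x\<parallel>" by blast
qed

text \<open>Norm closedness of the ideal. Approximation is stated by pointwise estimates, the form
  in which all later approximants are produced.\<close>

lemma compact_limit:
  assumes T: "T \<in> ops"
    and ap: "\<And>e. e > 0 \<Longrightarrow> \<exists>K\<in>compacts. \<forall>x\<in>lp. \<parallel>T x - K x\<parallel> \<le> e * \<parallel>x\<parallel>"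
  shows "T \<in> compacts"
proof (rule compactI[OF T])
  fix e :: real assume "e > 0"
  then obtain K where K: "K \<in> compacts" "\<And>x. x \<in> lp \<Longrightarrow> \<parallel>T x - K x\<parallel> \<le> e / 2 * \<parallel>x\<parallel>"
    using ap[of "e / 2"] by auto
  obtain m where m: "\<And>x. x \<in> lp \<Longrightarrow> \<parallel>tail m (K x)\<parallel> \<le> e / 2 * \<parallel>x\<parallel>"
      "\<And>x. x \<in> lp \<Longrightarrow> \<parallel>K (tail m x)\<parallel> \<le> e / 2 * \<parallel>x\<parallel>"
    using compactD(2)[OF K(1), of "e / 2"] \<open>e > 0\<close> by force
  note mem = ops_mem[OF T] ops_mem[OF compactD(1)[OF K(1)]]
  have "\<parallel>tail m (T x)\<parallel> \<le> e * \<parallel>x\<parallel> \<and> \<parallel>T (tail m x)\<parallel> \<le> e * \<parallel>x\<parallel>" if x: "x \<in> lp" for x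
  proof
    have "\<parallel>tail m (T x)\<parallel> \<le> \<parallel>tail m (K x)\<parallel> + \<parallel>tail m (T x) - tail m (K x)\<parallel>"
      using x mem by (intro nrm_triangle_sub lp_ind) auto
    moreover have "\<parallel>tail m (T x) - tail m (K x)\<parallel> \<le> \<parallel>T x - K x\<parallel>"
      unfolding rmul_diff[symmetric] using x mem by (intro lp_ind lp_diff_mem) auto
    ultimately show "\<parallel>tail m (T x)\<parallel> \<le> e * \<parallel>x\<parallel>" using m(1)[OF x] K(2)[OF x] by argo
    have y: "tail m x \<in> lp" using x by (rule lp_ind)
    have "\<parallel>T (tail m x)\<parallel> \<le> \<parallel>K (tail m x)\<parallel> + \<parallel>T (tail m x) - K (tail m x)\<parallel>"
      using y mem by (intro nrm_triangle_sub) auto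
    moreover have "\<parallel>T (tail m x) - K (tail m x)\<parallel> \<le> e / 2 * \<parallel>tail m x\<parallel>" using y by (rule K(2))
    moreover have "\<dots> \<le> e / 2 * \<parallel>x\<parallel>" using x \<open>e > 0\<close> by (intro mult_left_mono lp_ind) auto
    ultimately show "\<parallel>T (tail m x)\<parallel> \<le> e * \<parallel>x\<parallel>" using m(2)[OF x] by argo
  qed
  then show "\<exists>m. \<forall>x\<in>lp. \<parallel>tail m (T x)\<parallel> \<le> e * \<parallel>x\<parallel> \<and> \<parallel>T (tail m x)\<parallel> \<le> e * \<parallel>x\<parallel>" by blast
qed

lemma compact_plus:
  assumes "K \<in> compacts" "K' \<in> compacts" shows "K + K' \<in> compacts"
proof (rule compactI)
  note ops = compactD(1)[OF assms(1)] compactD(1)[OF assms(2)]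
  show "K + K' \<in> ops" using ops by (rule ops_plus)
  fix e :: real assume "e > 0"
  then have e: "e / 2 > 0" by simp
  from compactD(2)[OF assms(1) e] compactD(2)[OF assms(2) e] obtain m m' where
    m: "\<And>x n. x \<in> lp \<Longrightarrow> m \<le> n \<Longrightarrow> \<parallel>tail n (K x)\<parallel> \<le> e / 2 * \<parallel>x\<parallel> \<and> \<parallel>K (tail n x)\<parallel> \<le> e / 2 * \<parallel>x\<parallel>" and
    m': "\<And>x n. x \<in> lp \<Longrightarrow> m' \<le> n \<Longrightarrow> \<parallel>tail n (K' x)\<parallel> \<le> e / 2 * \<parallel>x\<parallel> \<and> \<parallel>K' (tail n x)\<parallel> \<le> e / 2 * \<parallel>x\<parallel>"
    by blast
  let ?n = "max m m'"
  have "\<parallel>tail ?n ((K + K') x)\<parallel> \<le> e * \<parallel>x\<parallel> \<and> \<parallel>(K + K') (tail ?n x)\<parallel> \<le> e * \<parallel>x\<parallel>" if x: "x \<in> lp" for x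
  proof
    have "\<parallel>tail ?n (K x) + tail ?n (K' x)\<parallel> \<le> \<parallel>tail ?n (K x)\<parallel> + \<parallel>tail ?n (K' x)\<parallel>"
      using x ops by (intro lp_add_mem lp_ind) auto
    then show "\<parallel>tail ?n ((K + K') x)\<parallel> \<le> e * \<parallel>x\<parallel>" 
      using m[OF x max.cobounded1[of m m']] m'[OF x max.cobounded2[of m' m]] unfolding oper_apply rmul_add by argo
    have "\<parallel>K (tail ?n x) + K' (tail ?n x)\<parallel> \<le> \<parallel>K (tail ?n x)\<parallel> + \<parallel>K' (tail ?n x)\<parallel>"
      using x ops by (intro lp_add_mem lp_ind) auto
    then show "\<parallel>(K + K') (tail ?n x)\<parallel> \<le> e * \<parallel>x\<parallel>"
      using m[OF x max.cobounded1[of m m']] m'[OF x max.cobounded2[of m' m]] unfolding oper_apply by argo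
  qed
  then show "\<exists>m. \<forall>x\<in>lp. \<parallel>tail m ((K + K') x)\<parallel> \<le> e * \<parallel>x\<parallel> \<and> \<parallel>(K + K') (tail m x)\<parallel> \<le> e * \<parallel>x\<parallel>"
    by blast
qed

lemma compact_neg: "K \<in> compacts \<Longrightarrow> - K \<in> compacts"
proof (rule compactI)
  assume K: "K \<in> compacts"
  show "- K \<in> ops" using compactD(1)[OF K] by (rule ops_neg)
  have "\<parallel>tail m ((- K) x)\<parallel> = \<parallel>tail m (K x)\<parallel>" "\<parallel>(- K) x\<parallel> = \<parallel>K x\<parallel>" for m x
    by (simp_all add: lp_norm_eq rmul_def fun_apply)
  then show "\<exists>m. \<forall>x\<in>lp. \<parallel>tail m ((- K) x)\<parallel> \<le> e * \<parallel>x\<parallel> \<and> \<parallel>(- K) (tail m x)\<parallel> \<le> e * \<parallel>x\<parallel>" if "e > 0" for e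
    using compactD(2)[OF K that] by fastforce
qed

lemma compact_diff: "K \<in> compacts \<Longrightarrow> K' \<in> compacts \<Longrightarrow> K - K' \<in> compacts"
  using compact_plus[of K "- K'"] compact_neg[of K'] by simp

lemma compact_zero: "0 \<in> compacts"
  by (rule compactI[OF ops_zero_mem]) (auto simp: rmul_zero intro!: mult_nonneg_nonneg nrm_nonneg)

lemma compact_mop:
  assumes "0 \<le> c" "\<And>i. \<bar>\<phi> i\<bar> \<le> c" "finite {i. \<phi> i \<noteq> 0}"
  shows "mop p \<phi> \<in> compacts"
proof (rule compactI[OF mop_mem(1)[OF assms(1,2)]])
  obtain m where m: "{i. \<phi> i \<noteq> 0} \<subseteq> cube m" using finite_subset_cube[OF assms(3)] by blast
  then have z: "\<phi> i = 0 \<or> i \<in> cube m" for i by auto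
  have "tail m (mop p \<phi> x) = 0 \<and> mop p \<phi> (tail m x) = 0" if "x \<in> lp" for x
    using that z lp_ind(1)[OF that, of "- cube m"]
    by (auto simp: mop_apply rmul_def indicator_def fun_eq_iff fun_apply)
  then show "\<exists>m. \<forall>x\<in>lp. \<parallel>tail m (mop p \<phi> x)\<parallel> \<le> e * \<parallel>x\<parallel> \<and> \<parallel>mop p \<phi> (tail m x)\<parallel> \<le> e * \<parallel>x\<parallel>"
    if "e > 0" for e
    using that by (intro exI[of _ m] ballI conjI nrm_zero_le) auto
qed

lemma compact_cut: "mop p (indicat_real (cube m)) \<in> compacts"
  by (rule compact_mop[of 1]) (auto simp: indicator_def)

section \<open>The algebra of operators that multiply the ideal into itself\<close>

lemma Pops_ops: "T \<in> Pops \<Longrightarrow> T \<in> ops"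
  by (simp add: P_ops_def)

lemma Pops_compact: "T \<in> Pops \<Longrightarrow> K \<in> compacts \<Longrightarrow> T \<circ> K \<in> compacts"
  "T \<in> Pops \<Longrightarrow> K \<in> compacts \<Longrightarrow> K \<circ> T \<in> compacts"
  by (auto simp: P_ops_def)

lemma compact_comp:
  assumes "K \<in> compacts" "K' \<in> compacts" shows "K \<circ> K' \<in> compacts"
proof (rule compactI)
  note o = compactD(1)[OF assms(1)] compactD(1)[OF assms(2)]
  show "K \<circ> K' \<in> ops" using o by (rule ops_comp)
  \<comment> \<open>A positive common majorant of both norms, so that \<open>e / c\<close> is
    defined. The left factor absorbs the outer tail, the right factor the inner one.\<close>
  define c where "c = 1 + opn K + opn K'"
  have c: "c > 0" "opn K \<le> c" "opn K' \<le> c"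
    using opn_nonneg[OF o(1)] opn_nonneg[OF o(2)] by (auto simp: c_def)
  fix e :: real assume "e > 0"
  then have d: "e / c > 0" using c by simp
  from compactD(2)[OF assms(1) d] compactD(2)[OF assms(2) d] obtain m m' where
    m: "\<And>x n. x \<in> lp \<Longrightarrow> m \<le> n \<Longrightarrow> \<parallel>tail n (K x)\<parallel> \<le> e / c * \<parallel>x\<parallel>" and
    m': "\<And>x n. x \<in> lp \<Longrightarrow> m' \<le> n \<Longrightarrow> \<parallel>K' (tail n x)\<parallel> \<le> e / c * \<parallel>x\<parallel>"
    by blast
  let ?n = "max m m'"
  have "\<parallel>tail ?n ((K \<circ> K') x)\<parallel> \<le> e * \<parallel>x\<parallel> \<and> \<parallel>(K \<circ> K') (tail ?n x)\<parallel> \<le> e * \<parallel>x\<parallel>" if x: "x \<in> lp" for x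
  proof
    have "\<parallel>tail ?n (K (K' x))\<parallel> \<le> e / c * \<parallel>K' x\<parallel>" using x o by (intro m) auto
    also have "\<dots> \<le> e / c * (c * \<parallel>x\<parallel>)" using x o c d by (intro mult_left_mono opn_bound') auto
    finally show "\<parallel>tail ?n ((K \<circ> K') x)\<parallel> \<le> e * \<parallel>x\<parallel>" using c by simp
    have "\<parallel>K (K' (tail ?n x))\<parallel> \<le> c * \<parallel>K' (tail ?n x)\<parallel>"
      using x o c by (intro opn_bound') auto
    also have "\<dots> \<le> c * (e / c * \<parallel>x\<parallel>)" using x c by (intro mult_left_mono m') auto
    finally show "\<parallel>(K \<circ> K') (tail ?n x)\<parallel> \<le> e * \<parallel>x\<parallel>" using c by simp
  qed
  then show "\<exists>m. \<forall>x\<in>lp. \<parallel>tail m ((K \<circ> K') x)\<parallel> \<le> e * \<parallel>x\<parallel> \<and> \<parallel>(K \<circ> K') (tail m x)\<parallel> \<le> e * \<parallel>x\<parallel>"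
    by blast
qed

text \<open>
  The hypothesis says that \<open>TP\<^sub>m\<close> and \<open>P\<^sub>mT\<close> are \<open>\<P>\<close>-compact, and then so are
  \<open>TK = lim TP\<^sub>mK\<close> and \<open>KT = lim KP\<^sub>mT\<close>.
\<close>

lemma PopsI:
  fixes T :: "('n::finite, 'x::complex_banach) oper"
  assumes T: "T \<in> ops"
    and s: "\<And>m e. e > 0 \<Longrightarrow> \<exists>l. \<forall>x\<in>lp. \<parallel>cut m (T (tail l x))\<parallel> \<le> e * \<parallel>x\<parallel> \<and> \<parallel>tail l (T (cut m x))\<parallel> \<le> e * \<parallel>x\<parallel>"
  shows "T \<in> Pops"
proof -
  let ?P = "\<lambda>m. mop p (indicat_real (cube m)) :: ('n, 'x) oper"
  have ct: "cut m (tail n x) = 0" "tail n (cut m x) = 0" if "m \<le> n" for m n and x :: "('n, 'x) seq"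
    using cube_mono[OF that] by (auto simp: rmul_def indicator_def fun_eq_iff fun_apply)
  have TP: "T \<circ> ?P m \<in> compacts" and PT: "?P m \<circ> T \<in> compacts" for m
  proof -
    have ex: "\<exists>n\<ge>m. \<forall>x\<in>lp. \<parallel>cut m (T (tail n x))\<parallel> \<le> e * \<parallel>x\<parallel> \<and> \<parallel>tail n (T (cut m x))\<parallel> \<le> e * \<parallel>x\<parallel>"
      if e: "e > 0" for e
    proof -
      obtain l where l: "\<And>x. x \<in> lp \<Longrightarrow> \<parallel>cut m (T (tail l x))\<parallel> \<le> e * \<parallel>x\<parallel>"
        "\<And>x. x \<in> lp \<Longrightarrow> \<parallel>tail l (T (cut m x))\<parallel> \<le> e * \<parallel>x\<parallel>"
        using s[OF e, of m] by blast
      \<comment> \<open>Both estimates persist when \<open>l\<close> grows; \<open>n \<ge> m\<close>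
        makes the remaining products of \<open>cut m\<close> and \<open>tail n\<close>
        vanish.\<close>
      define n where "n = max l m"
      have n: "l \<le> n" "m \<le> n" by (auto simp: n_def)
      have "\<parallel>cut m (T (tail n x))\<parallel> \<le> e * \<parallel>x\<parallel> \<and> \<parallel>tail n (T (cut m x))\<parallel> \<le> e * \<parallel>x\<parallel>" if x: "x \<in> lp" for x
      proof
        have "\<parallel>cut m (T (tail l (tail n x)))\<parallel> \<le> e * \<parallel>tail n x\<parallel>" using x by (intro l) simp
        also have "\<dots> \<le> e * \<parallel>x\<parallel>" using e x by (intro mult_left_mono lp_ind) auto
        finally show "\<parallel>cut m (T (tail n x))\<parallel> \<le> e * \<parallel>x\<parallel>" by (simp add: tail_tail n)
        have "\<parallel>tail n (T (cut m x))\<parallel> \<le> \<parallel>tail l (T (cut m x))\<parallel>" using T n by (intro tail_antimono) simp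
        then show "\<parallel>tail n (T (cut m x))\<parallel> \<le> e * \<parallel>x\<parallel>" using l(2)[OF x] by linarith
      qed
      then show ?thesis using n(2) by blast
    qed
    show "T \<circ> ?P m \<in> compacts"
    proof (rule compactI)
      fix e :: real assume e: "e > 0"
      obtain n where n: "m \<le> n" "\<And>x. x \<in> lp \<Longrightarrow> \<parallel>tail n (T (cut m x))\<parallel> \<le> e * \<parallel>x\<parallel>" using ex[OF e] by blast
      show "\<exists>l. \<forall>x\<in>lp. \<parallel>tail l ((T \<circ> ?P m) x)\<parallel> \<le> e * \<parallel>x\<parallel> \<and> \<parallel>(T \<circ> ?P m) (tail l x)\<parallel> \<le> e * \<parallel>x\<parallel>"
        using n e T by (intro exI[of _ n]) (auto simp: mop_apply ct nrm_nonneg)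
    qed (use T in \<open>auto intro: ops_comp(1)\<close>)
    show "?P m \<circ> T \<in> compacts"
    proof (rule compactI)
      fix e :: real assume e: "e > 0"
      obtain n where n: "m \<le> n" "\<And>x. x \<in> lp \<Longrightarrow> \<parallel>cut m (T (tail n x))\<parallel> \<le> e * \<parallel>x\<parallel>" using ex[OF e] by blast
      show "\<exists>l. \<forall>x\<in>lp. \<parallel>tail l ((?P m \<circ> T) x)\<parallel> \<le> e * \<parallel>x\<parallel> \<and> \<parallel>(?P m \<circ> T) (tail l x)\<parallel> \<le> e * \<parallel>x\<parallel>"
        using n e T by (intro exI[of _ n]) (auto simp: mop_apply ct nrm_nonneg)
    qed (use T in \<open>auto intro: ops_comp(1)\<close>)
  qed
  have "T \<circ> K \<in> compacts \<and> K \<circ> T \<in> compacts" if K: "K \<in> compacts" for K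
  proof
    note Ko = compactD(1)[OF K]
    define c where "c = 1 + opn T"
    have c: "c > 0" "opn T \<le> c" using opn_nonneg[OF T] by (auto simp: c_def)
    have tailK: "\<exists>m. \<forall>x\<in>lp. \<parallel>tail m (K x)\<parallel> \<le> e / c * \<parallel>x\<parallel> \<and> \<parallel>K (tail m x)\<parallel> \<le> e / c * \<parallel>x\<parallel>" if "e > 0" for e
      using compactD(2)[OF K, of "e / c"] c that by (metis divide_pos_pos order_refl)
    show "T \<circ> K \<in> compacts"
    proof (rule compact_limit[OF ops_comp(1)[OF T Ko]])
      fix e :: real assume "e > 0"
      then obtain m where m: "\<And>x. x \<in> lp \<Longrightarrow> \<parallel>tail m (K x)\<parallel> \<le> e / c * \<parallel>x\<parallel>" using tailK by blast
      have "\<parallel>(T \<circ> K) x - ((T \<circ> ?P m) \<circ> K) x\<parallel> \<le> e * \<parallel>x\<parallel>" if x: "x \<in> lp" for x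
      proof -
        have "(T \<circ> K) x - ((T \<circ> ?P m) \<circ> K) x = T (tail m (K x))"
          using ops_diff[OF T ops_mem[OF Ko x] lp_cut] x Ko by (simp add: mop_apply tail_eq_diff)
        from arg_cong[OF this, of "lp_norm p"]
        have "\<parallel>(T \<circ> K) x - ((T \<circ> ?P m) \<circ> K) x\<parallel> = \<parallel>T (tail m (K x))\<parallel>" .
        also have "\<dots> \<le> c * \<parallel>tail m (K x)\<parallel>" using x T Ko c by (intro opn_bound') auto
        also have "\<dots> \<le> c * (e / c * \<parallel>x\<parallel>)" using m[OF x] c by (intro mult_left_mono) auto
        finally show ?thesis using c by simp
      qed
      then show "\<exists>K'\<in>compacts. \<forall>x\<in>lp. \<parallel>(T \<circ> K) x - K' x\<parallel> \<le> e * \<parallel>x\<parallel>"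
        using compact_comp[OF TP K] by blast
    qed
    show "K \<circ> T \<in> compacts"
    proof (rule compact_limit[OF ops_comp(1)[OF Ko T]])
      fix e :: real assume "e > 0"
      then obtain m where m: "\<And>x. x \<in> lp \<Longrightarrow> \<parallel>K (tail m x)\<parallel> \<le> e / c * \<parallel>x\<parallel>" using tailK by blast
      have "\<parallel>(K \<circ> T) x - (K \<circ> (?P m \<circ> T)) x\<parallel> \<le> e * \<parallel>x\<parallel>" if x: "x \<in> lp" for x
      proof -
        have Tx: "T x \<in> lp" using x T by simp
        have "(K \<circ> T) x - (K \<circ> (?P m \<circ> T)) x = K (tail m (T x))"
          using ops_diff[OF Ko Tx lp_cut] Tx by (simp add: mop_apply tail_eq_diff)
        from arg_cong[OF this, of "lp_norm p"]
        have "\<parallel>(K \<circ> T) x - (K \<circ> (?P m \<circ> T)) x\<parallel> = \<parallel>K (tail m (T x))\<parallel>" .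
        also have "\<dots> \<le> e / c * \<parallel>T x\<parallel>" by (rule m[OF Tx])
        also have "\<dots> \<le> e / c * (c * \<parallel>x\<parallel>)" using \<open>e > 0\<close> x T c by (intro mult_left_mono opn_bound') auto
        finally show ?thesis using c by simp
      qed
      then show "\<exists>K'\<in>compacts. \<forall>x\<in>lp. \<parallel>(K \<circ> T) x - K' x\<parallel> \<le> e * \<parallel>x\<parallel>"
        using compact_comp[OF K PT] by blast
    qed
  qed
  then show ?thesis using T by (simp add: P_ops_def)
qed

text \<open>The cutoff to a cube belongs to the ideal, hence so does its product with
  \<open>T\<close>. This off-diagonal decay is how membership in \<open>Pops\<close> is exploited by
  the later estimates.\<close>

lemma Pops_cut_tail:
  assumes "T \<in> Pops" "e > 0"
  shows "\<exists>l. \<forall>n\<ge>l. \<forall>x\<in>lp. \<parallel>cut m (T (tail n x))\<parallel> \<le> e * \<parallel>x\<parallel>"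
proof -
  have "mop p (indicat_real (cube m)) \<circ> T \<in> compacts"
    using assms compact_cut by (intro Pops_compact)
  from compactD(2)[OF this assms(2)] show ?thesis
    using ops_mem[OF Pops_ops[OF assms(1)]] lp_ind(1) by (fastforce simp: mop_apply)
qed

lemma Pops_comp:
  assumes "A \<in> Pops" "B \<in> Pops" shows "A \<circ> B \<in> Pops"
  using assms ops_comp(1) by (auto simp: P_ops_def comp_assoc) (metis comp_assoc)

lemma Pops_plus:
  assumes "A \<in> Pops" "B \<in> Pops" shows "A + B \<in> Pops"
proof -
  have "(A + B) \<circ> K \<in> compacts \<and> K \<circ> (A + B) \<in> compacts" if K: "K \<in> compacts" for K
  proof -
    note o = Pops_ops[OF assms(1)] Pops_ops[OF assms(2)] compactD(1)[OF K]
    have "(A + B) \<circ> K = (A \<circ> K) + (B \<circ> K)" by (rule ext) simp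
    moreover have "K \<circ> (A + B) = (K \<circ> A) + (K \<circ> B)"
      by (rule ops_eqI) (use o in \<open>auto intro!: ops_comp ops_plus simp: ops_add ops_mem\<close>)
    ultimately show ?thesis
      using compact_plus[OF Pops_compact(1)[OF assms(1) K] Pops_compact(1)[OF assms(2) K]]
        compact_plus[OF Pops_compact(2)[OF assms(1) K] Pops_compact(2)[OF assms(2) K]] by simp
  qed
  then show ?thesis using assms ops_plus(1) by (auto simp: P_ops_def)
qed

lemma compact_op_scaleC: "K \<in> compacts \<Longrightarrow> op_scaleC c K \<in> compacts"
proof (rule compactI)
  assume K: "K \<in> compacts"
  note Ko = compactD(1)[OF K]
  show "op_scaleC c K \<in> ops" using Ko by (rule ops_op_scaleC)
  fix e :: real assume e: "e > 0"
  then obtain m where m: "\<And>x. x \<in> lp \<Longrightarrow> \<parallel>tail m (K x)\<parallel> \<le> e / (1 + cmod c) * \<parallel>x\<parallel> \<and> \<parallel>K (tail m x)\<parallel> \<le> e / (1 + cmod c) * \<parallel>x\<parallel>"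
    using compactD(2)[OF K, of "e / (1 + cmod c)"] by (force simp: add_pos_nonneg)
  have ce: "cmod c * (e / (1 + cmod c) * t) \<le> e * t" if "0 \<le> t" for t
  proof -
    have "cmod c * (e / (1 + cmod c)) \<le> e" using e by (simp add: field_simps add_pos_nonneg)
    then show ?thesis using mult_right_mono[OF _ that] by (metis mult.assoc)
  qed
  have "\<parallel>tail m (op_scaleC c K x)\<parallel> \<le> e * \<parallel>x\<parallel> \<and> \<parallel>op_scaleC c K (tail m x)\<parallel> \<le> e * \<parallel>x\<parallel>" if x: "x \<in> lp" for x
  proof
    note le = ce[OF nrm_nonneg[OF x]]
    have "tail m (op_scaleC c K x) = seq_scaleC c (tail m (K x))"
      by (auto simp: op_scaleC_def seq_scaleC_def rmul_def scaleC_scaleR)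
    then have "\<parallel>tail m (op_scaleC c K x)\<parallel> = cmod c * \<parallel>tail m (K x)\<parallel>"
      using lp_scaleC(2)[OF lp_ind(1)[OF ops_mem[OF Ko x]]] by simp
    also have "\<dots> \<le> cmod c * (e / (1 + cmod c) * \<parallel>x\<parallel>)" using m[OF x] by (intro mult_left_mono) auto
    finally show "\<parallel>tail m (op_scaleC c K x)\<parallel> \<le> e * \<parallel>x\<parallel>" using le by linarith
    have "\<parallel>op_scaleC c K (tail m x)\<parallel> = cmod c * \<parallel>K (tail m x)\<parallel>"
      unfolding op_scaleC_def by (rule lp_scaleC(2)[OF ops_mem[OF Ko lp_ind(1)[OF x]]])
    also have "\<dots> \<le> cmod c * (e / (1 + cmod c) * \<parallel>x\<parallel>)" using m[OF x] by (intro mult_left_mono) auto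
    finally show "\<parallel>op_scaleC c K (tail m x)\<parallel> \<le> e * \<parallel>x\<parallel>" using le by linarith
  qed
  then show "\<exists>m. \<forall>x\<in>lp. \<parallel>tail m (op_scaleC c K x)\<parallel> \<le> e * \<parallel>x\<parallel> \<and> \<parallel>op_scaleC c K (tail m x)\<parallel> \<le> e * \<parallel>x\<parallel>"
    by blast
qed

lemma Pops_op_scaleC:
  assumes "A \<in> Pops" shows "op_scaleC c A \<in> Pops"
proof -
  have "op_scaleC c A \<circ> K \<in> compacts \<and> K \<circ> op_scaleC c A \<in> compacts" if K: "K \<in> compacts" for K
  proof -
    note o = Pops_ops[OF assms] compactD(1)[OF K]
    have "op_scaleC c A \<circ> K = op_scaleC c (A \<circ> K)" by (auto simp: op_scaleC_def)
    moreover have "K \<circ> op_scaleC c A = op_scaleC c (K \<circ> A)"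
      by (rule ops_eqI) (use o in \<open>auto intro!: ops_comp ops_op_scaleC simp: op_scaleC_apply ops_scaleC\<close>)
    ultimately show ?thesis
      using compact_op_scaleC[OF Pops_compact(1)[OF assms K]] compact_op_scaleC[OF Pops_compact(2)[OF assms K]]
      by simp
  qed
  then show ?thesis using assms ops_op_scaleC by (auto simp: P_ops_def)
qed

lemma Pops_neg: "A \<in> Pops \<Longrightarrow> - A \<in> Pops"
  using Pops_op_scaleC[of A "-1"] by (simp add: op_scaleC_minus_one)

lemma Pops_minus: "A \<in> Pops \<Longrightarrow> B \<in> Pops \<Longrightarrow> A - B \<in> Pops"
  using Pops_plus[of A "- B"] Pops_neg[of B] by simp

lemma Pops_id: "id_op p \<in> Pops"
  by (auto simp: P_ops_def id_op_comp compactD(1))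

lemma compacts_subset_Pops: "K \<in> compacts \<Longrightarrow> K \<in> Pops"
  using compact_comp compactD(1) by (auto simp: P_ops_def)

text \<open>Norm closedness of the algebra: T K and K T are limits of S K and K S in the closed
  ideal. It keeps the sum of the Neumann series inside the algebra.\<close>

lemma Pops_limit:
  assumes T: "T \<in> ops"
    and ap: "\<And>e. e > 0 \<Longrightarrow> \<exists>S\<in>Pops. \<forall>x\<in>lp. \<parallel>T x - S x\<parallel> \<le> e * \<parallel>x\<parallel>"
  shows "T \<in> Pops"
proof -
  have "T \<circ> K \<in> compacts \<and> K \<circ> T \<in> compacts" if K: "K \<in> compacts" for K
  proof
    note Ko = compactD(1)[OF K]
    define c where "c = 1 + opn K"
    have c: "c > 0" "opn K \<le> c" using opn_nonneg[OF Ko] by (auto simp: c_def)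
    have ex: "\<exists>S\<in>Pops. \<forall>x\<in>lp. \<parallel>T x - S x\<parallel> \<le> e / c * \<parallel>x\<parallel>" if "e > 0" for e
      using that c by (intro ap) simp
    show "T \<circ> K \<in> compacts"
    proof (rule compact_limit)
      show "T \<circ> K \<in> ops" using T Ko by (rule ops_comp)
      fix e :: real assume "e > 0"
      then obtain S where S: "S \<in> Pops" "\<And>x. x \<in> lp \<Longrightarrow> \<parallel>T x - S x\<parallel> \<le> e / c * \<parallel>x\<parallel>"
        using ex by blast
      have "\<parallel>(T \<circ> K) x - (S \<circ> K) x\<parallel> \<le> e * \<parallel>x\<parallel>" if x: "x \<in> lp" for x
      proof -
        have "\<parallel>T (K x) - S (K x)\<parallel> \<le> e / c * \<parallel>K x\<parallel>" using x Ko by (intro S) auto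
        also have "\<dots> \<le> e / c * (c * \<parallel>x\<parallel>)"
          using x Ko c \<open>e > 0\<close> by (intro mult_left_mono opn_bound') auto
        finally show ?thesis using c by simp
      qed
      then show "\<exists>K'\<in>compacts. \<forall>x\<in>lp. \<parallel>(T \<circ> K) x - K' x\<parallel> \<le> e * \<parallel>x\<parallel>"
        using Pops_compact(1)[OF S(1) K] by blast
    qed
    show "K \<circ> T \<in> compacts"
    proof (rule compact_limit)
      show "K \<circ> T \<in> ops" using Ko T by (rule ops_comp)
      fix e :: real assume "e > 0"
      then obtain S where S: "S \<in> Pops" "\<And>x. x \<in> lp \<Longrightarrow> \<parallel>T x - S x\<parallel> \<le> e / c * \<parallel>x\<parallel>"
        using ex by blast
      note So = Pops_ops[OF S(1)]
      have "\<parallel>(K \<circ> T) x - (K \<circ> S) x\<parallel> \<le> e * \<parallel>x\<parallel>" if x: "x \<in> lp" for x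
      proof -
        have "(K \<circ> T) x - (K \<circ> S) x = K (T x - S x)" using x T So Ko by (simp add: ops_diff ops_mem)
        moreover have "\<parallel>K (T x - S x)\<parallel> \<le> c * \<parallel>T x - S x\<parallel>"
          using x T So Ko c by (intro opn_bound' lp_diff_mem) auto
        moreover have "\<dots> \<le> c * (e / c * \<parallel>x\<parallel>)" using x c by (intro mult_left_mono S) auto
        ultimately show ?thesis using c by simp
      qed
      then show "\<exists>K'\<in>compacts. \<forall>x\<in>lp. \<parallel>(K \<circ> T) x - K' x\<parallel> \<le> e * \<parallel>x\<parallel>"
        using Pops_compact(2)[OF S(1) K] by blast
    qed
  qed
  then show ?thesis using T by (simp add: P_ops_def)
qed

text \<open>Finite band width without matrix entries, which need not determine an operator when p =
  \<infinity>: coordinate i of T x depends only on x in the ball of radius w about i, and by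
  linearity it suffices to speak about vanishing.\<close>

definition propagation_le :: "nat \<Rightarrow> ('n::finite, 'x::complex_banach) oper \<Rightarrow> bool" where
  "propagation_le w T \<longleftrightarrow>
     (\<forall>x\<in>lp. \<forall>i. (\<forall>j. linf (i - j) \<le> w \<longrightarrow> x j = 0) \<longrightarrow> T x i = 0)"

text \<open>With l = m + w both products required by \<open>PopsI\<close> are zero, since a point of
  \<open>cube m\<close> and one outside \<open>cube (m + w)\<close> are more than w apart.\<close>

lemma Pops_propagation:
  assumes T: "T \<in> ops" and w: "propagation_le w T"
  shows "T \<in> Pops"
proof (rule PopsI[OF T])
  fix m :: nat and e :: real assume "e > 0"
  have "cut m (T (tail (m + w) x)) = 0 \<and> tail (m + w) (T (cut m x)) = 0" if x: "x \<in> lp" for x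
  proof
    show "cut m (T (tail (m + w) x)) = 0"
    proof
      fix i
      show "cut m (T (tail (m + w) x)) i = 0 i"
      proof (cases "i \<in> cube m")
        case True
        have "tail (m + w) x j = 0" if "linf (i - j) \<le> w" for j
        proof -
          have "linf j \<le> m + w" using True that linf_diff[of i "i - j"] by (simp add: mem_cube_iff)
          then show ?thesis by (simp add: rmul_def mem_cube_iff)
        qed
        then have "T (tail (m + w) x) i = 0" using w lp_ind(1)[OF x] by (simp add: propagation_le_def)
        then show ?thesis by (simp add: rmul_apply fun_apply)
      qed (simp add: rmul_apply fun_apply)
    qed
    show "tail (m + w) (T (cut m x)) = 0"
    proof
      fix i
      show "tail (m + w) (T (cut m x)) i = 0 i"
      proof (cases "i \<in> cube (m + w)")
        case False
        have "cut m x j = 0" if "linf (i - j) \<le> w" for j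
        proof -
          have "\<not> linf j \<le> m" using False that linf_add[of j "i - j"] by (simp add: mem_cube_iff)
          then show ?thesis by (simp add: rmul_def mem_cube_iff)
        qed
        then have "T (cut m x) i = 0" using w lp_ind(1)[OF x] by (simp add: propagation_le_def)
        then show ?thesis by (simp add: rmul_apply fun_apply)
      qed (simp add: rmul_apply fun_apply)
    qed
  qed
  then show "\<exists>l. \<forall>x\<in>lp. \<parallel>cut m (T (tail l x))\<parallel> \<le> e * \<parallel>x\<parallel> \<and> \<parallel>tail l (T (cut m x))\<parallel> \<le> e * \<parallel>x\<parallel>"
    using \<open>e > 0\<close> by (intro exI[of _ "m + w"] ballI conjI nrm_zero_le) auto
qed

lemma Pops_shift: "shift_op p k \<in> Pops"
  by (rule Pops_propagation[OF shift_mem, where w = "linf k"])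
    (auto simp: propagation_le_def shift_apply)

text \<open>The series is summed pointwise by completeness of l^p. The stated side is the one that
  turns an approximate right inverse of B into a right inverse modulo the ideal.\<close>

lemma Neumann_right_inverse:
  assumes E: "E \<in> Pops" and half: "\<And>x. x \<in> lp \<Longrightarrow> \<parallel>E x\<parallel> \<le> 1 / 2 * \<parallel>x\<parallel>"
  obtains J where "J \<in> Pops" "(id_op p + E) \<circ> J = id_op p"
proof -
  note Eo = Pops_ops[OF E]
  \<comment> \<open>Partial sums of the Neumann series: \<open>S n\<close> is the sum of (-E)^j over
    j < n, generated by the fixed-point iteration for J = I - E J.\<close>
  define S where "S = (\<lambda>n. ((\<lambda>T. id_op p - (E \<circ> T)) ^^ n) (0 :: ('a, 'b) oper))"
  have S0: "S 0 = 0" and SS: "S (Suc n) = id_op p - (E \<circ> S n)" for n by (auto simp: S_def)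
  have SP: "S n \<in> Pops" for n
  proof (induction n)
    case 0
    show ?case unfolding S0 using compact_zero by (rule compacts_subset_Pops)
  next
    case (Suc n)
    then show ?case unfolding SS by (intro Pops_minus Pops_id Pops_comp E)
  qed
  note So = Pops_ops[OF SP]
  have SSx: "S (Suc n) x = x - E (S n x)" if "x \<in> lp" for n x
    using that by (simp add: SS id_op_apply)
  have step: "\<parallel>S (Suc n) x - S n x\<parallel> \<le> (1 / 2) ^ n * \<parallel>x\<parallel>" if x: "x \<in> lp" for n x
  proof (induction n)
    case 0
    have "S (Suc 0) x - S 0 x = x" unfolding SSx[OF x] S0 using Eo by simp
    then show ?case by simp
  next
    case (Suc n)
    have mem: "S (Suc n) x \<in> lp" "S n x \<in> lp" using ops_mem[OF So x] by auto
    have "S (Suc (Suc n)) x - S (Suc n) x = E (S n x) - E (S (Suc n) x)"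
      by (simp only: SSx[OF x, of "Suc n"] SSx[OF x, of n]) simp
    also have "\<dots> = E (S n x - S (Suc n) x)" using mem by (simp add: ops_diff[OF Eo])
    finally have "\<parallel>S (Suc (Suc n)) x - S (Suc n) x\<parallel> \<le> 1 / 2 * \<parallel>S n x - S (Suc n) x\<parallel>"
      using half[OF lp_diff_mem(1)[OF mem(2,1)]] by simp
    then show ?case using Suc by (simp add: nrm_diff_commute[of "S n x"])
  qed
  have cau: "\<parallel>S m x - S n x\<parallel> \<le> 2 * (1 / 2) ^ n * \<parallel>x\<parallel>" if x: "x \<in> lp" and "n \<le> m" for x n m
  proof -
    \<comment> \<open>The exact geometric sum is carried through the induction; only afterwards is
      the negative term dropped.\<close>
    have "\<parallel>S m x - S n x\<parallel> \<le> (2 * (1 / 2) ^ n - 2 * (1 / 2) ^ m) * \<parallel>x\<parallel>"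
      using that(2)
    proof (induction m rule: dec_induct)
      case (step m)
      have "\<parallel>S (Suc m) x - S n x\<parallel> \<le> \<parallel>S (Suc m) x - S m x\<parallel> + \<parallel>S m x - S n x\<parallel>"
        using ops_mem[OF So x] by (intro nrm_triangle3)
      also have "\<dots> \<le> (1 / 2) ^ m * \<parallel>x\<parallel> + (2 * (1 / 2) ^ n - 2 * (1 / 2) ^ m) * \<parallel>x\<parallel>"
        using \<open>\<And>x n. x \<in> lp \<Longrightarrow> \<parallel>S (Suc n) x - S n x\<parallel> \<le> (1 / 2) ^ n * \<parallel>x\<parallel>\<close>[OF x, of m] step by simp
      also have "\<dots> = (2 * (1 / 2) ^ n - 2 * (1 / 2) ^ Suc m) * \<parallel>x\<parallel>" by (simp add: algebra_simps)
      finally show ?case .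
    qed simp
    also have "\<dots> \<le> 2 * (1 / 2) ^ n * \<parallel>x\<parallel>" using nrm_nonneg[OF x] by (intro mult_right_mono) auto
    finally show ?thesis .
  qed
  have half0: "(\<lambda>n. 2 * (1 / 2 :: real) ^ n * t) \<longlonglongrightarrow> 0" for t
    by (intro tendsto_mult_left_zero tendsto_mult_right_zero LIMSEQ_power_zero) auto
  have "\<exists>y. y \<in> lp \<and> (\<forall>n. \<parallel>y - S n x\<parallel> \<le> 2 * (1 / 2) ^ n * \<parallel>x\<parallel>)" if x: "x \<in> lp" for x
    using lp_complete[of "\<lambda>n. S n x" "\<lambda>n. 2 * (1 / 2) ^ n * \<parallel>x\<parallel>", OF ops_mem[OF So x] cau[OF x] half0]
    by metis
  then obtain J0 where J0: "\<And>x. x \<in> lp \<Longrightarrow> J0 x \<in> lp \<and> (\<forall>n. \<parallel>J0 x - S n x\<parallel> \<le> 2 * (1 / 2) ^ n * \<parallel>x\<parallel>)"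
    by metis
  define J where "J = lp_restrict p J0"
  have Jx: "J x \<in> lp" "\<parallel>J x - S n x\<parallel> \<le> 2 * (1 / 2) ^ n * \<parallel>x\<parallel>" if "x \<in> lp" for x n
    using J0[OF that] that by (auto simp: J_def lp_restrict_def)
  \<comment> \<open>Linearity of \<open>J\<close> and the equation J + E J = I hold up to errors
    decaying like 2^(-n), because they hold for the iterates; this turns such estimates into
    equalities.\<close>
  have uniq: "y = z" if yz: "y \<in> lp" "z \<in> lp" and le: "\<And>n. \<parallel>y - z\<parallel> \<le> 2 * (1 / 2) ^ n * t"
    for y z :: "('a, 'b) seq" and t :: real
  proof -
    have "\<parallel>y - z\<parallel> \<le> 0" by (rule tendsto_lowerbound[OF half0[of t]]) (use le in auto)
    then show ?thesis using nrm_eq_0D[OF lp_diff_mem(1)[OF yz]] by simp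
  qed
  have Jo: "J \<in> ops"
  proof (rule opsI[where C = 2])
    show "J x = 0" if "x \<notin> lp" for x using that by (simp add: J_def lp_restrict_def)
    show "J x \<in> lp" if "x \<in> lp" for x using Jx that by blast
    show "\<parallel>J x\<parallel> \<le> 2 * \<parallel>x\<parallel>" if "x \<in> lp" for x using Jx(2)[OF that, of 0] by (simp add: S0)
    show "J (x + y) = J x + J y" if x: "x \<in> lp" "y \<in> lp" for x y
    proof (rule uniq[of _ _ "2 * (\<parallel>x\<parallel> + \<parallel>y\<parallel>)"])
      fix n
      have eq: "J (x + y) - (J x + J y) = (J (x + y) - S n (x + y)) - ((J x - S n x) + (J y - S n y))"
        using x by (simp add: ops_add[OF So])
      have "\<parallel>J (x + y) - (J x + J y)\<parallel> \<le> \<parallel>J (x + y) - S n (x + y)\<parallel> + (\<parallel>J x - S n x\<parallel> + \<parallel>J y - S n y\<parallel>)"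
        unfolding eq using x Jx(1) ops_mem[OF So] lp_add_mem(1)[OF x]
        by (intro order_trans[OF lp_diff_mem(2)] add_mono lp_add_mem lp_diff_mem order_refl) auto
      also have "\<dots> \<le> 2 * (1 / 2) ^ n * \<parallel>x + y\<parallel> + (2 * (1 / 2) ^ n * \<parallel>x\<parallel> + 2 * (1 / 2) ^ n * \<parallel>y\<parallel>)"
        using x lp_add_mem(1)[OF x] by (intro add_mono Jx)
      also have "\<dots> \<le> 2 * (1 / 2) ^ n * (\<parallel>x\<parallel> + \<parallel>y\<parallel>) + (2 * (1 / 2) ^ n * \<parallel>x\<parallel> + 2 * (1 / 2) ^ n * \<parallel>y\<parallel>)"
        using lp_add_mem(2)[OF x] by (intro add_mono mult_left_mono) auto
      finally show "\<parallel>J (x + y) - (J x + J y)\<parallel> \<le> 2 * (1 / 2) ^ n * (2 * (\<parallel>x\<parallel> + \<parallel>y\<parallel>))"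
        by (simp add: algebra_simps)
    qed (use x Jx lp_add_mem in auto)
    show "J (seq_scaleC c x) = seq_scaleC c (J x)" if x: "x \<in> lp" for c x
    proof (rule uniq[of _ _ "2 * cmod c * \<parallel>x\<parallel>"])
      fix n
      note cx = lp_scaleC[OF x, of c]
      have eq: "J (seq_scaleC c x) - seq_scaleC c (J x)
          = (J (seq_scaleC c x) - S n (seq_scaleC c x)) - seq_scaleC c (J x - S n x)"
        using x by (simp add: ops_scaleC[OF So] seq_scaleC_diff)
      have mem: "J x - S n x \<in> lp" using x Jx ops_mem[OF So] by (intro lp_diff_mem) auto
      have "\<parallel>J (seq_scaleC c x) - seq_scaleC c (J x)\<parallel>
          \<le> \<parallel>J (seq_scaleC c x) - S n (seq_scaleC c x)\<parallel> + \<parallel>seq_scaleC c (J x - S n x)\<parallel>"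
        unfolding eq by (rule lp_diff_mem(2)) (use cx(1) x Jx ops_mem[OF So] mem in auto)
      also have "\<dots> \<le> 2 * (1 / 2) ^ n * (cmod c * \<parallel>x\<parallel>) + cmod c * (2 * (1 / 2) ^ n * \<parallel>x\<parallel>)"
        unfolding lp_scaleC(2)[OF mem] using Jx(2)[OF cx(1), of n] Jx(2)[OF x, of n]
        by (intro add_mono mult_left_mono) (auto simp: cx(2))
      finally show "\<parallel>J (seq_scaleC c x) - seq_scaleC c (J x)\<parallel> \<le> 2 * (1 / 2) ^ n * (2 * cmod c * \<parallel>x\<parallel>)"
        by (simp add: algebra_simps)
    qed (use x Jx lp_scaleC in auto)
  qed
  have "J \<in> Pops"
  proof (rule Pops_limit[OF Jo])
    fix e :: real assume "e > 0"
    then obtain n where n: "2 * (1 / 2 :: real) ^ n * 1 < e"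
      using order_tendstoD(2)[OF half0[of 1], of e] by (auto simp: eventually_sequentially)
    have "\<parallel>J x - S n x\<parallel> \<le> e * \<parallel>x\<parallel>" if "x \<in> lp" for x
    proof -
      have "2 * (1 / 2) ^ n * \<parallel>x\<parallel> \<le> e * \<parallel>x\<parallel>"
        using n nrm_nonneg[OF that] by (intro mult_right_mono) auto
      then show ?thesis using Jx(2)[OF that, of n] by linarith
    qed
    then show "\<exists>S\<in>Pops. \<forall>x\<in>lp. \<parallel>J x - S x\<parallel> \<le> e * \<parallel>x\<parallel>" using SP by blast
  qed
  moreover have "(id_op p + E) \<circ> J = id_op p"
  proof (rule ops_eqI)
    show "(id_op p + E) \<circ> J \<in> ops" using Eo Jo by (intro ops_comp ops_plus) auto
    fix x :: "('a, 'b) seq" assume x: "x \<in> lp"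
    note m = Jx(1)[OF x] ops_mem[OF Eo Jx(1)[OF x]] ops_mem[OF So x]
    have "J x + E (J x) = x"
    proof (rule uniq[of _ _ "2 * \<parallel>x\<parallel>"])
      fix n
      have eq: "J x + E (J x) - x = (J x - S (Suc n) x) + E (J x - S n x)"
        unfolding SSx[OF x] using m by (simp add: ops_diff[OF Eo])
      have "\<parallel>J x + E (J x) - x\<parallel> \<le> \<parallel>J x - S (Suc n) x\<parallel> + \<parallel>E (J x - S n x)\<parallel>"
        unfolding eq using m Eo by (intro lp_add_mem lp_diff_mem) auto
      moreover have "\<parallel>E (J x - S n x)\<parallel> \<le> 1 / 2 * \<parallel>J x - S n x\<parallel>" using m by (intro half lp_diff_mem)
      ultimately have "\<parallel>J x + E (J x) - x\<parallel> \<le> 2 * (1 / 2) ^ Suc n * \<parallel>x\<parallel> + 1 / 2 * (2 * (1 / 2) ^ n * \<parallel>x\<parallel>)"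
        using Jx(2)[OF x, of "Suc n"] Jx(2)[OF x, of n] by linarith
      also have "\<dots> \<le> 2 * (1 / 2) ^ n * (2 * \<parallel>x\<parallel>)" using nrm_nonneg[OF x] by simp
      finally show "\<parallel>J x + E (J x) - x\<parallel> \<le> 2 * (1 / 2) ^ n * (2 * \<parallel>x\<parallel>)" .
    qed (use m x lp_add_mem in auto)
    then show "((id_op p + E) \<circ> J) x = id_op p x" using x m by (simp add: id_op_apply)
  qed simp
  ultimately show thesis using that by blast
qed

end


section \<open>Commutators with cutoff functions\<close>

text \<open>As a function of \<open>linf i\<close> it is 1 up to k, falls with slope 1/k and is 0
  from 2k on. For k = 0 division by zero yields the constant 1, which is why the support lemmas
  assume \<open>0 < k\<close>.\<close>

definition bump :: "nat \<Rightarrow> int ^ 'n::finite \<Rightarrow> real" where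
  "bump k i = max 0 (min 1 (2 - real (linf i) / real k))"

lemma bump_bounds: "0 \<le> bump k i" "bump k i \<le> 1"
  by (auto simp: bump_def)

lemma bump_eq_1: "0 < k \<Longrightarrow> i \<in> cube k \<Longrightarrow> bump k i = 1"
  by (auto simp: bump_def mem_cube_iff min_def max_def field_simps)

lemma bump_eq_0: "0 < k \<Longrightarrow> i \<notin> cube (2 * k) \<Longrightarrow> bump k i = 0"
  by (auto simp: bump_def mem_cube_iff min_def max_def field_simps)

lemma linf_diff_le: "real (linf i) - real (linf j) \<le> real (linf (i - j))"
  using linf_add[of "i - j" j] by simp

lemma bump_lipschitz: "\<bar>bump k i - bump k j\<bar> \<le> real (linf (i - j)) / real k"
proof -
  have "\<bar>bump k i - bump k j\<bar> \<le> \<bar>(2 - real (linf i) / real k) - (2 - real (linf j) / real k)\<bar>"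
    unfolding bump_def by linarith
  also have "\<dots> = \<bar>real (linf i) - real (linf j)\<bar> / real k"
    by (simp add: diff_divide_distrib[symmetric] abs_minus_commute)
  also have "\<dots> \<le> real (linf (i - j)) / real k"
    using linf_diff_le[of i j] linf_diff_le[of j i] linf_uminus[of "i - j"]
    by (intro divide_right_mono) (auto simp: abs_le_iff)
  finally show ?thesis .
qed

text \<open>For \<open>linf \<alpha> \<le> k\<close> the difference lives in the cube of radius 3k,
  where the Lipschitz bound applies. The localisation matters for finite exponents: it makes the
  size of the difference small relative to that of the bump.\<close>

lemma bump_shift_le_indicator:
  assumes "0 < k" "linf \<alpha> \<le> k"
  shows "\<bar>bump k (i - \<alpha>) - bump k i\<bar> \<le> real (linf \<alpha>) / real k * indicat_real (cube (3 * k)) i"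
proof (cases "i \<in> cube (3 * k)")
  case True
  then show ?thesis using bump_lipschitz[of k "i - \<alpha>" i] by simp
next
  case False
  then have "i \<notin> cube (2 * k)" "i - \<alpha> \<notin> cube (2 * k)"
    using assms linf_add[of "i - \<alpha>" \<alpha>] by (auto simp: mem_cube_iff)
  then show ?thesis using assms False by (simp add: bump_eq_0)
qed

abbreviation commutator :: "('n::finite, 'x::complex_banach) oper \<Rightarrow> (int ^ 'n \<Rightarrow> real)
    \<Rightarrow> ('n, 'x) seq \<Rightarrow> ('n, 'x) seq" where
  "commutator T \<phi> x \<equiv> T (rmul \<phi> x) - rmul \<phi> (T x)"

section \<open>Averages over all translates of a cutoff function\<close>

context lp_exponent
begin

lemma indicator_summable: "finite S \<Longrightarrow> lp_summable p (indicat_real S)"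
  by (rule lp_finite_support(1)) (auto simp: indicator_def)

text \<open>A doubling estimate with a constant independent of k: the cube of radius 3k is covered
  by translates of the cube of radius k along 2k times the vectors with entries in {-1, 0,
  1}.\<close>

lemma indicator_cube_triple:
  "lp_size p (indicat_real (cube (3 * k) :: (int ^ 'n::finite) set))
     \<le> real (card (cube 1 :: (int ^ 'n) set)) * lp_size p (indicat_real (cube k :: (int ^ 'n) set))"
proof -
  let ?t = "\<lambda>\<tau> :: int ^ 'n. (\<chi> j. 2 * int k * \<tau> $ j) :: int ^ 'n"
  let ?g = "\<lambda>\<tau> i. indicat_real (cube k) (i - ?t \<tau>)"
  have b: "bij (\<lambda>i. i - t)" for t :: "int ^ 'n"
    by (rule bij_betw_byWitness[of _ "\<lambda>i. i + t"]) auto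
  have g: "lp_summable p (?g \<tau>)" "lp_size p (?g \<tau>) = lp_size p (indicat_real (cube k :: (int ^ 'n) set))" for \<tau>
    using lp_reindex[OF _ indicator_summable b, of "cube k :: (int ^ 'n) set"] by auto
  have "lp_size p (indicat_real (cube (3 * k) :: (int ^ 'n) set)) \<le> lp_size p (\<lambda>i. \<Sum>\<tau>\<in>cube 1. ?g \<tau> i)"
  proof (rule lp_size_mono)
    show "lp_summable p (\<lambda>i. \<Sum>\<tau>\<in>cube 1. ?g \<tau> i)" by (rule lp_finite_sum) (auto simp: g)
    fix i :: "int ^ 'n"
    show "indicat_real (cube (3 * k)) i \<le> (\<Sum>\<tau>\<in>cube 1. ?g \<tau> i)"
    proof (cases "i \<in> cube (3 * k)")
      case True
      \<comment> \<open>Coordinates beyond k in absolute value lie between k and 3k, and a step of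
        2k towards the origin brings them into [-k, k].\<close>
      define \<tau> :: "int ^ 'n" where
        "\<tau> = (\<chi> j. if i $ j < - int k then -1 else if i $ j > int k then 1 else 0)"
      have "\<tau> \<in> cube 1" by (auto simp: \<tau>_def cube_def)
      moreover have "i - ?t \<tau> \<in> cube k"
        unfolding cube_def
      proof (rule CollectI, rule allI)
        fix j
        have "- (3 * int k) \<le> i $ j" "i $ j \<le> 3 * int k" using True by (auto simp: cube_def)
        then show "(i - ?t \<tau>) $ j \<in> {- int k..int k}" by (auto simp: \<tau>_def)
      qed
      ultimately have "1 \<le> (\<Sum>\<tau>\<in>cube 1. ?g \<tau> i)"
        using member_le_sum[of \<tau> "cube 1" "\<lambda>\<tau>. ?g \<tau> i"] by simp
      then show ?thesis using True by simp
    qed (simp add: sum_nonneg)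
  qed auto
  also have "\<dots> \<le> (\<Sum>\<tau>\<in>cube 1. lp_size p (?g \<tau>))" by (rule lp_finite_sum) (auto simp: g)
  also have "\<dots> = real (card (cube 1 :: (int ^ 'n) set)) * lp_size p (indicat_real (cube k :: (int ^ 'n) set))"
    by (simp add: g)
  finally show ?thesis .
qed

lemma bump_summable: "0 < k \<Longrightarrow> lp_summable p (bump k :: int ^ 'n::finite \<Rightarrow> real)"
  by (rule lp_finite_support(1)[OF finite_cube[of "2 * k"]]) (auto simp: bump_bounds bump_eq_0)

lemma indicator_le_bump:
  "0 < k \<Longrightarrow> lp_size p (indicat_real (cube k :: (int ^ 'n::finite) set)) \<le> lp_size p (bump k :: int ^ 'n \<Rightarrow> real)"
  by (rule lp_size_mono[OF _ _ bump_summable]) (auto simp: indicator_def bump_bounds bump_eq_1)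

lemma bump_size_pos:
  assumes "0 < k" shows "0 < lp_size p (bump k :: int ^ 'n::finite \<Rightarrow> real)"
proof -
  have "(bump k :: int ^ 'n \<Rightarrow> real) 0 = 1" using assms by (intro bump_eq_1) (auto simp: mem_cube_iff)
  then show ?thesis
    using lp_coord_le[OF _ bump_summable[OF assms], of "0 :: int ^ 'n"] by (simp add: bump_bounds)
qed

text \<open>For fixed \<open>i\<close> the map s \<mapsto> i - s is a bijection of the lattice, so
  the size over s of d(i - s) g(i) is \<open>lp_size p d * g i\<close>; interchanging the two sizes
  gives the product. The identity is exact, so no constant is lost when local estimates are
  averaged.\<close>

lemma lp_average:
  fixes d g :: "int ^ 'n::finite \<Rightarrow> real"
  assumes d: "\<And>i. 0 \<le> d i" "lp_summable p d" and g: "\<And>i. 0 \<le> g i" "lp_summable p g"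
  shows "lp_summable p (\<lambda>i. d (i - s) * g i)"
    and "lp_summable p (\<lambda>s. lp_size p (\<lambda>i. d (i - s) * g i))"
    and "lp_size p (\<lambda>s. lp_size p (\<lambda>i. d (i - s) * g i)) = lp_size p d * lp_size p g"
proof -
  let ?f = "\<lambda>s i. d (i - s) * g i"
  have b: "bij (\<lambda>s. i - s)" for i :: "int ^ 'n"
    by (rule bij_betw_byWitness[of _ "\<lambda>s. i - s"]) auto
  have r: "lp_summable p (\<lambda>s. d (i - s))" "lp_size p (\<lambda>s. d (i - s)) = lp_size p d" for i
    using lp_reindex[OF d b] by auto
  have s1: "lp_summable p (\<lambda>s. ?f s i)" "lp_size p (\<lambda>s. ?f s i) = lp_size p d * g i" for i
    using lp_mult[OF _ r(1), where c = "g i"] d g r by (auto simp: mult.commute)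
  have s2: "lp_summable p (\<lambda>i. lp_size p (\<lambda>s. ?f s i))"
    unfolding s1 using d g by (intro lp_mult lp_size_nonneg) auto
  have nn: "0 \<le> ?f s i" for s i using d g by simp
  show "lp_summable p (?f s)" "lp_summable p (\<lambda>s. lp_size p (?f s))"
    using lp_Fubini_le(1,2)[OF nn s1(1) s2] by auto
  have "lp_size p (\<lambda>s. lp_size p (?f s)) = lp_size p (\<lambda>i. lp_size p (\<lambda>s. ?f s i))"
    by (rule lp_Fubini[OF nn s1(1) s2])
  also have "\<dots> = lp_size p d * lp_size p g"
    unfolding s1 using d g by (intro lp_mult lp_size_nonneg) auto
  finally show "lp_size p (\<lambda>s. lp_size p (?f s)) = lp_size p d * lp_size p g" .
qed

lemma rmul_bump [simp]: "x \<in> lp \<Longrightarrow> rmul (\<lambda>i. bump k (i - s)) x \<in> lp"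
  and rmul_bump_le: "x \<in> lp \<Longrightarrow> \<parallel>rmul (\<lambda>i. bump k (i - s)) x\<parallel> \<le> \<parallel>x\<parallel>"
  using lp_rmul[of x 1 "\<lambda>i. bump k (i - s)"] by (auto simp: abs_of_nonneg bump_bounds)

lemma bump_average:
  fixes x :: "('n::finite, 'x::complex_banach) seq"
  assumes "0 < k" "x \<in> lp"
  shows "lp_summable p (\<lambda>s. \<parallel>rmul (\<lambda>i. bump k (i - s)) x\<parallel>)"
    and "lp_size p (\<lambda>s. \<parallel>rmul (\<lambda>i. bump k (i - s)) x\<parallel>) = lp_size p (bump k :: int ^ 'n \<Rightarrow> real) * \<parallel>x\<parallel>"
  using lp_average[OF bump_bounds(1) bump_summable[OF assms(1)], of "\<lambda>i. norm (x i)"] assms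
  by (auto simp: lp_norm_eq rmul_def abs_of_nonneg bump_bounds lp_summableD)

text \<open>Uniform in the centre \<open>s\<close>, so that the property is invariant under
  conjugation by shifts and passes to limit operators with the same threshold
  \<open>k0\<close>.\<close>

definition small_commutators :: "('n::finite, 'x::complex_banach) oper \<Rightarrow> bool" where
  "small_commutators T \<longleftrightarrow>
     (\<forall>e>0. \<exists>k0>0. \<forall>k\<ge>k0. \<forall>s. \<forall>x\<in>lp. \<parallel>commutator T (\<lambda>i. bump k (i - s)) x\<parallel> \<le> e * \<parallel>x\<parallel>)"

text \<open>The errors for all centres are measured together, in the size used by
  \<open>bump_average\<close>; dividing by the size of the bump leaves an error
  \<open>e * \<parallel>x\<parallel>\<close>. For finite exponents a bound that is merely uniform in
  \<open>s\<close> could not be summed over infinitely many centres.\<close>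

definition small_average_commutators :: "('n::finite, 'x::complex_banach) oper \<Rightarrow> bool" where
  "small_average_commutators T \<longleftrightarrow>
     (\<forall>e>0. \<exists>k0>0. \<forall>k\<ge>k0. \<forall>x\<in>lp.
        lp_summable p (\<lambda>s. \<parallel>commutator T (\<lambda>i. bump k (i - s)) x\<parallel>) \<and>
        lp_size p (\<lambda>s. \<parallel>commutator T (\<lambda>i. bump k (i - s)) x\<parallel>)
          \<le> e * lp_size p (bump k :: int ^ 'n \<Rightarrow> real) * \<parallel>x\<parallel>)"

text \<open>The approximants carry their own small commutators because the patching argument moves
  the approximant, not T, past the cutoff functions.\<close>

definition finite_propagation_limit :: "('n::finite, 'x::complex_banach) oper \<Rightarrow> bool" where
  "finite_propagation_limit T \<longleftrightarrow>
     (\<forall>e>0. \<exists>B\<in>ops. \<exists>w. propagation_le w B \<and> small_commutators B \<and> (\<forall>x\<in>lp. \<parallel>T x - B x\<parallel> \<le> e * \<parallel>x\<parallel>))"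

section \<open>Commutators of band operators and of band-dominated operators\<close>

lemma coeff_bound:
  assumes "a \<in> coeff_space"
  obtains M where "0 \<le> M" "\<And>i v. norm (blinfun_apply (a i) v) \<le> M * norm v"
proof -
  obtain M where M: "\<And>i. norm (a i) \<le> M" using assms by (auto simp: coeff_space_def bounded_iff)
  have "norm (blinfun_apply (a i) v) \<le> M * norm v" for i v
    using norm_blinfun[of "a i" v] mult_right_mono[OF M, of "norm v" i] by simp
  moreover have "0 \<le> M" using M[of undefined] norm_ge_zero order_trans by blast
  ultimately show thesis using that by blast
qed

lemma diagonal_op:
  assumes a: "a \<in> coeff_space" and M: "0 \<le> M" "\<And>i v. norm (blinfun_apply (a i) v) \<le> M * norm v"
  shows "mult_op p a \<circ> shift_op p \<alpha> \<in> ops"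
    and "x \<in> lp \<Longrightarrow> (mult_op p a \<circ> shift_op p \<alpha>) x i = blinfun_apply (a i) (x (i - \<alpha>))"
proof -
  have ap: "mult_op p a x i = blinfun_apply (a i) (x i)" if "x \<in> lp" for x i
    using that by (simp add: mult_op_def lp_restrict_def)
  have d: "mult_op p a x \<in> lp" "\<parallel>mult_op p a x\<parallel> \<le> M * \<parallel>x\<parallel>" if "x \<in> lp" for x
    using lp_dominated[OF that M(1), of "mult_op p a x"] M(2) ap[OF that] by auto
  have m: "mult_op p a \<in> ops"
  proof (rule opsI[where C = M])
    show "mult_op p a x = 0" if "x \<notin> lp" for x using that by (simp add: mult_op_def lp_restrict_def)
    show "mult_op p a x \<in> lp" if "x \<in> lp" for x using that by (rule d)
    show "\<parallel>mult_op p a x\<parallel> \<le> M * \<parallel>x\<parallel>" if "x \<in> lp" for x using that by (rule d)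
    show "mult_op p a (x + y) = mult_op p a x + mult_op p a y" if "x \<in> lp" "y \<in> lp" for x y
      using that by (intro ext) (simp add: ap fun_apply blinfun.add_right)
    show "mult_op p a (seq_scaleC c x) = seq_scaleC c (mult_op p a x)" if "x \<in> lp" for c x
      using a that lp_scaleC(1)[OF that, of c]
      by (intro ext) (simp add: ap seq_scaleC_def coeff_space_def)
  qed
  then show "mult_op p a \<circ> shift_op p \<alpha> \<in> ops" by (rule ops_comp(1)[OF _ shift_mem])
  show "(mult_op p a \<circ> shift_op p \<alpha>) x i = blinfun_apply (a i) (x (i - \<alpha>))" if "x \<in> lp"
    using that by (simp add: ap shift_lp shift_apply')
qed

text \<open>Commuting with multiplication by \<phi> multiplies the coefficient of the shift by
  \<alpha> with \<phi>(i - \<alpha>) - \<phi>(i). \<open>M\<close> bounds the coefficients, and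
  \<open>S\<close> is the finite set of shifts that occur.\<close>

lemma band_op_structure:
  fixes B :: "('n::finite, 'x::complex_banach) oper"
  assumes "B \<in> band_ops p"
  obtains S :: "(int ^ 'n) set" and M where "B \<in> ops" "finite S" "\<And>\<alpha>. 0 \<le> M \<alpha>" "\<exists>w. propagation_le w B"
    "\<And>\<phi> x i. x \<in> lp \<Longrightarrow> rmul \<phi> x \<in> lp \<Longrightarrow>
       norm (commutator B \<phi> x i) \<le> (\<Sum>\<alpha>\<in>S. M \<alpha> * (\<bar>\<phi> (i - \<alpha>) - \<phi> i\<bar> * norm (x (i - \<alpha>))))"
proof -
  obtain S a where B: "B = (\<Sum>\<alpha>\<in>S. mult_op p (a \<alpha>) \<circ> shift_op p \<alpha>)"
    and S: "finite S" and a: "\<And>\<alpha>. \<alpha> \<in> S \<Longrightarrow> a \<alpha> \<in> coeff_space"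
    using assms by (auto simp: band_ops_def)
  have "\<exists>M\<ge>0. \<alpha> \<in> S \<longrightarrow> (\<forall>i v. norm (blinfun_apply (a \<alpha> i) v) \<le> M * norm v)" for \<alpha>
  proof (cases "\<alpha> \<in> S")
    case True
    then show ?thesis using coeff_bound[OF a[OF True]] by metis
  next
    case False
    then show ?thesis by (intro exI[of _ 0]) simp
  qed
  then obtain M where M: "\<And>\<alpha>. 0 \<le> M \<alpha>"
    "\<And>\<alpha> i v. \<alpha> \<in> S \<Longrightarrow> norm (blinfun_apply (a \<alpha> i) v) \<le> M \<alpha> * norm v"
    by metis
  let ?D = "\<lambda>\<alpha>. mult_op p (a \<alpha>) \<circ> shift_op p \<alpha>"
  have Bx: "B x i = (\<Sum>\<alpha>\<in>S. blinfun_apply (a \<alpha> i) (x (i - \<alpha>)))" if "x \<in> lp" for x i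
  proof -
    have "(\<Sum>\<alpha>\<in>T. ?D \<alpha>) x i = (\<Sum>\<alpha>\<in>T. ?D \<alpha> x i)" if "finite T" for T
      using that
    proof (induction T rule: finite_induct)
      case (insert \<alpha> T)
      have "(\<Sum>\<alpha>\<in>insert \<alpha> T. ?D \<alpha>) = ?D \<alpha> + (\<Sum>\<alpha>\<in>T. ?D \<alpha>)" using insert.hyps by (rule sum.insert)
      then show ?case using insert by (simp add: fun_apply)
    qed (simp add: fun_apply)
    from this[OF S] show ?thesis
      unfolding B using that by (simp add: diagonal_op(2)[OF a M(1) M(2)] del: comp_apply)
  qed
  have "(\<Sum>\<alpha>\<in>T. ?D \<alpha>) \<in> ops" if "T \<subseteq> S" for T
    using finite_subset[OF that S] that
  proof (induction T rule: finite_induct)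
    case empty
    show ?case unfolding sum.empty by (rule ops_zero_mem)
  next
    case (insert \<alpha> T)
    have D: "?D \<alpha> \<in> ops" using insert by (intro diagonal_op(1)[OF a M(1) M(2)]) auto
    have "(\<Sum>\<alpha>\<in>T. ?D \<alpha>) \<in> ops" using insert by blast
    then show ?case unfolding sum.insert[OF insert.hyps] by (rule ops_plus(1)[OF D])
  qed
  then have Bo: "B \<in> ops" unfolding B by simp
  obtain w where w: "S \<subseteq> cube w" using finite_subset_cube[OF S] by blast
  have "propagation_le w B"
    unfolding propagation_le_def
  proof (intro ballI allI impI)
    fix x :: "('n, 'x) seq" and i assume x: "x \<in> lp" and z: "\<forall>j. linf (i - j) \<le> w \<longrightarrow> x j = 0"
    have "x (i - \<alpha>) = 0" if "\<alpha> \<in> S" for \<alpha> using z w that by (auto simp: mem_cube_iff)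
    then show "B x i = 0" by (simp add: Bx[OF x])
  qed
  moreover have "norm (commutator B \<phi> x i) \<le> (\<Sum>\<alpha>\<in>S. M \<alpha> * (\<bar>\<phi> (i - \<alpha>) - \<phi> i\<bar> * norm (x (i - \<alpha>))))"
    if x: "x \<in> lp" "rmul \<phi> x \<in> lp" for \<phi> x i
  proof -
    have "commutator B \<phi> x i = (\<Sum>\<alpha>\<in>S. (\<phi> (i - \<alpha>) - \<phi> i) *\<^sub>R blinfun_apply (a \<alpha> i) (x (i - \<alpha>)))"
      unfolding minus_apply rmul_apply[of \<phi> "B x"] Bx[OF x(1)] Bx[OF x(2)]
      by (simp add: rmul_apply blinfun.scaleR_right scaleR_sum_right sum_subtractf scaleR_diff_left)
    also have "norm \<dots> \<le> (\<Sum>\<alpha>\<in>S. \<bar>\<phi> (i - \<alpha>) - \<phi> i\<bar> * (M \<alpha> * norm (x (i - \<alpha>))))"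
      using M by (intro sum_norm_le) (auto intro!: mult_left_mono)
    finally show ?thesis by (simp add: mult.left_commute)
  qed
  ultimately show thesis using that[of S M] Bo S M(1) by blast
qed

lemma band_small_commutators:
  fixes B :: "('n::finite, 'x::complex_banach) oper"
  assumes "B \<in> band_ops p"
  shows "small_commutators B" "small_average_commutators B"
proof -
  obtain S :: "(int ^ 'n) set" and M where Bo: "B \<in> ops" and S: "finite S" and M: "\<And>\<alpha>. 0 \<le> M \<alpha>"
    and com: "\<And>\<phi> x i. x \<in> lp \<Longrightarrow> rmul \<phi> x \<in> lp \<Longrightarrow>
       norm (commutator B \<phi> x i) \<le> (\<Sum>\<alpha>\<in>S. M \<alpha> * (\<bar>\<phi> (i - \<alpha>) - \<phi> i\<bar> * norm (x (i - \<alpha>))))"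
    by (rule band_op_structure[OF assms]) blast
  \<comment> \<open>The slope 1/k of the bump bounds the commutator by \<open>L / k\<close> times
    the norm.\<close>
  define L where "L = (\<Sum>\<alpha>\<in>S. M \<alpha> * real (linf \<alpha>))"
  have L: "0 \<le> L" unfolding L_def using M by (intro sum_nonneg) auto
  have sh: "lp_summable p (\<lambda>i. norm (x (i - \<alpha>)))" "lp_size p (\<lambda>i. norm (x (i - \<alpha>))) = \<parallel>x\<parallel>"
    if "x \<in> lp" for x :: "('n, 'x) seq" and \<alpha>
    using lp_translate[OF that, of \<alpha>] by (auto simp: lp_norm_eq lp_iff)
  show "small_commutators B"
    unfolding small_commutators_def
  proof (intro allI impI)
    fix e :: real assume "e > 0"
    obtain k0 where k0: "L / e < real k0" using reals_Archimedean2 by blast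
    have "\<parallel>commutator B (\<lambda>i. bump k (i - s)) x\<parallel> \<le> e * \<parallel>x\<parallel>" if k: "Suc k0 \<le> k" and x: "x \<in> lp" for k s x
    proof -
      let ?f = "\<lambda>\<alpha> i. (M \<alpha> * (real (linf \<alpha>) / real k)) * norm (x (i - \<alpha>))"
      have f: "lp_summable p (?f \<alpha>)" "lp_size p (?f \<alpha>) = M \<alpha> * (real (linf \<alpha>) / real k) * \<parallel>x\<parallel>" for \<alpha>
        using lp_mult[OF _ sh(1)[OF x], where c = "M \<alpha> * (real (linf \<alpha>) / real k)"] M sh(2)[OF x] by auto
      have fs: "lp_summable p (\<lambda>i. \<Sum>\<alpha>\<in>S. ?f \<alpha> i)"
        using S M f by (intro lp_finite_sum) auto
      have "norm (commutator B (\<lambda>i. bump k (i - s)) x i) \<le> (\<Sum>\<alpha>\<in>S. ?f \<alpha> i)" for i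
      proof -
        have "norm (commutator B (\<lambda>i. bump k (i - s)) x i)
            \<le> (\<Sum>\<alpha>\<in>S. M \<alpha> * (\<bar>bump k (i - \<alpha> - s) - bump k (i - s)\<bar> * norm (x (i - \<alpha>))))"
          using x by (intro com) auto
        also have "\<dots> \<le> (\<Sum>\<alpha>\<in>S. ?f \<alpha> i)"
        proof (rule sum_mono)
          fix \<alpha>
          have "\<bar>bump k (i - \<alpha> - s) - bump k (i - s)\<bar> \<le> real (linf \<alpha>) / real k"
            using bump_lipschitz[of k "i - \<alpha> - s" "i - s"] by simp
          then have "M \<alpha> * (\<bar>bump k (i - \<alpha> - s) - bump k (i - s)\<bar> * norm (x (i - \<alpha>)))
              \<le> M \<alpha> * (real (linf \<alpha>) / real k * norm (x (i - \<alpha>)))"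
            using M by (intro mult_left_mono mult_right_mono) auto
          then show "M \<alpha> * (\<bar>bump k (i - \<alpha> - s) - bump k (i - s)\<bar> * norm (x (i - \<alpha>))) \<le> ?f \<alpha> i"
            by (simp add: mult.assoc)
        qed
        finally show ?thesis .
      qed
      then have "\<parallel>commutator B (\<lambda>i. bump k (i - s)) x\<parallel> \<le> lp_size p (\<lambda>i. \<Sum>\<alpha>\<in>S. ?f \<alpha> i)"
        unfolding lp_norm_eq by (intro lp_size_mono fs) auto
      also have "\<dots> \<le> (\<Sum>\<alpha>\<in>S. lp_size p (?f \<alpha>))" using S M f by (intro lp_finite_sum) auto
      also have "\<dots> = L / real k * \<parallel>x\<parallel>"
        unfolding f(2) L_def by (simp add: sum_divide_distrib sum_distrib_right)
      also have "\<dots> \<le> e * \<parallel>x\<parallel>"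
      proof (rule mult_right_mono[OF _ nrm_nonneg[OF x]])
        have "real k0 < real k" using k by simp
        then have "L / e < real k" using k0 by linarith
        then show "L / real k \<le> e" using \<open>e > 0\<close> k by (simp add: field_simps)
      qed
      finally show ?thesis .
    qed
    then show "\<exists>k0>0. \<forall>k\<ge>k0. \<forall>s. \<forall>x\<in>lp. \<parallel>commutator B (\<lambda>i. bump k (i - s)) x\<parallel> \<le> e * \<parallel>x\<parallel>"
      by (intro exI[of _ "Suc k0"]) auto
  qed
  obtain w where w: "S \<subseteq> cube w" using finite_subset_cube[OF S] by blast
  \<comment> \<open>The doubling constant of \<open>indicator_cube_triple\<close>; it compares the
    region of radius 3k that carries the differences with the bump of radius k.\<close>
  define c where "c = real (card (cube 1 :: (int ^ 'n) set))"
  have c: "0 \<le> c" by (simp add: c_def)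
  show "small_average_commutators B"
    unfolding small_average_commutators_def
  proof (intro allI impI)
    fix e :: real assume "e > 0"
    \<comment> \<open>Besides this threshold, \<open>k\<close> is taken beyond \<open>w\<close>, so
      that every shift in \<open>S\<close> has length at most \<open>k\<close> and the differences
      stay in the cube of radius 3k.\<close>
    obtain k0 where k0: "L * c / e < real k0" using reals_Archimedean2 by blast
    let ?N = "\<lambda>k. lp_size p (bump k :: int ^ 'n \<Rightarrow> real)"
    have "lp_summable p (\<lambda>s. \<parallel>commutator B (\<lambda>i. bump k (i - s)) x\<parallel>) \<and>
          lp_size p (\<lambda>s. \<parallel>commutator B (\<lambda>i. bump k (i - s)) x\<parallel>) \<le> e * ?N k * \<parallel>x\<parallel>"
      if k: "Suc (k0 + w) \<le> k" and x: "x \<in> lp" for k x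
    proof -
      \<comment> \<open>The cutoff centred at \<open>s\<close> contributes d \<alpha> (i - s) to the
        commutator, so the size over all \<open>s\<close> is an instance of
        \<open>lp_average\<close>.\<close>
      define d where "d = (\<lambda>(\<alpha> :: int ^ 'n) i. \<bar>bump k (i - \<alpha>) - bump k i\<bar> :: real)"
      have d0: "0 \<le> d \<alpha> i" for \<alpha> i by (simp add: d_def)
      have kp: "0 < k" using k by simp
      have dle: "d \<alpha> i \<le> real (linf \<alpha>) / real k * indicat_real (cube (3 * k)) i" if "\<alpha> \<in> S" for \<alpha> i
        unfolding d_def using that w k by (intro bump_shift_le_indicator) (auto simp: mem_cube_iff)
      have ind: "lp_summable p (\<lambda>i. r * indicat_real (cube (3 * k) :: (int ^ 'n) set) i)"
        "lp_size p (\<lambda>i. r * indicat_real (cube (3 * k) :: (int ^ 'n) set) i)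
          = r * lp_size p (indicat_real (cube (3 * k) :: (int ^ 'n) set))" if "0 \<le> r" for r
        using lp_mult[OF _ indicator_summable[of "cube (3 * k) :: (int ^ 'n) set"] that] by auto
      have ds: "lp_summable p (d \<alpha>)" if "\<alpha> \<in> S" for \<alpha>
        using dle[OF that] d0 by (intro lp_summable_mono[OF _ _ ind(1)[of "real (linf \<alpha>) / real k"]]) auto
      have dn: "lp_size p (d \<alpha>) \<le> real (linf \<alpha>) / real k * (c * ?N k)" if "\<alpha> \<in> S" for \<alpha>
      proof -
        have "lp_size p (d \<alpha>) \<le> real (linf \<alpha>) / real k * lp_size p (indicat_real (cube (3 * k) :: (int ^ 'n) set))"
        proof -
          have "lp_size p (d \<alpha>) \<le> lp_size p (\<lambda>i. real (linf \<alpha>) / real k * indicat_real (cube (3 * k) :: (int ^ 'n) set) i)"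
            using d0 dle[OF that] by (rule lp_size_mono) (intro ind(1), simp)
          also have "\<dots> = real (linf \<alpha>) / real k * lp_size p (indicat_real (cube (3 * k) :: (int ^ 'n) set))"
            by (rule ind(2)) simp
          finally show ?thesis .
        qed
        also have "\<dots> \<le> real (linf \<alpha>) / real k * (c * lp_size p (indicat_real (cube k :: (int ^ 'n) set)))"
          unfolding c_def by (intro mult_left_mono indicator_cube_triple) auto
        also have "\<dots> \<le> real (linf \<alpha>) / real k * (c * ?N k)"
          using c by (intro mult_left_mono indicator_le_bump kp) auto
        finally show ?thesis .
      qed
      let ?f = "\<lambda>\<alpha> s. lp_size p (\<lambda>i. d \<alpha> (i - s) * norm (x (i - \<alpha>)))"
      have av: "lp_summable p (\<lambda>i. d \<alpha> (i - s) * norm (x (i - \<alpha>)))"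
        "lp_summable p (?f \<alpha>)" "lp_size p (?f \<alpha>) = lp_size p (d \<alpha>) * \<parallel>x\<parallel>" if "\<alpha> \<in> S" for \<alpha> s
        using lp_average[OF d0 ds[OF that] norm_ge_zero sh(1)[OF x]] sh(2)[OF x] by auto
      have f0: "0 \<le> ?f \<alpha> s" if "\<alpha> \<in> S" for \<alpha> s using av(1)[OF that] d0 by (intro lp_size_nonneg) auto
      have Mf: "lp_summable p (\<lambda>s. M \<alpha> * ?f \<alpha> s)" "lp_size p (\<lambda>s. M \<alpha> * ?f \<alpha> s) = M \<alpha> * lp_size p (?f \<alpha>)"
        if "\<alpha> \<in> S" for \<alpha> using lp_mult[OF f0 av(2) M] that by auto
      have fs: "lp_summable p (\<lambda>s. \<Sum>\<alpha>\<in>S. M \<alpha> * ?f \<alpha> s)"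
        using S M f0 Mf by (intro lp_finite_sum) auto
      have cs: "\<parallel>commutator B (\<lambda>i. bump k (i - s)) x\<parallel> \<le> (\<Sum>\<alpha>\<in>S. M \<alpha> * ?f \<alpha> s)" for s
      proof -
        let ?g = "\<lambda>\<alpha> i. M \<alpha> * (d \<alpha> (i - s) * norm (x (i - \<alpha>)))"
        have g: "lp_summable p (?g \<alpha>)" "lp_size p (?g \<alpha>) = M \<alpha> * ?f \<alpha> s" if "\<alpha> \<in> S" for \<alpha>
          using lp_mult[OF _ av(1)[OF that] M, of s] d0 by auto
        have "norm (commutator B (\<lambda>i. bump k (i - s)) x i) \<le> (\<Sum>\<alpha>\<in>S. ?g \<alpha> i)" for i
        proof -
          have e: "i - s - \<alpha> = i - \<alpha> - s" for \<alpha> by (simp add: algebra_simps)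
          show ?thesis unfolding d_def e using x by (intro com) auto
        qed
        then have "\<parallel>commutator B (\<lambda>i. bump k (i - s)) x\<parallel> \<le> lp_size p (\<lambda>i. \<Sum>\<alpha>\<in>S. ?g \<alpha> i)"
          unfolding lp_norm_eq using S M d0 g by (intro lp_size_mono lp_finite_sum) auto
        also have "\<dots> \<le> (\<Sum>\<alpha>\<in>S. lp_size p (?g \<alpha>))" using S M d0 g by (intro lp_finite_sum) auto
        finally show ?thesis using g by simp
      qed
      have c0: "0 \<le> \<parallel>commutator B (\<lambda>i. bump k (i - s)) x\<parallel>" for s
        using Bo x by (intro nrm_nonneg) simp
      have "lp_size p (\<lambda>s. \<parallel>commutator B (\<lambda>i. bump k (i - s)) x\<parallel>) \<le> lp_size p (\<lambda>s. \<Sum>\<alpha>\<in>S. M \<alpha> * ?f \<alpha> s)"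
        using c0 cs fs by (rule lp_size_mono)
      also have "\<dots> \<le> (\<Sum>\<alpha>\<in>S. lp_size p (\<lambda>s. M \<alpha> * ?f \<alpha> s))"
        using S M f0 Mf by (intro lp_finite_sum) auto
      also have "\<dots> = (\<Sum>\<alpha>\<in>S. M \<alpha> * (lp_size p (d \<alpha>) * \<parallel>x\<parallel>))" by (simp add: Mf av)
      also have "\<dots> \<le> (\<Sum>\<alpha>\<in>S. M \<alpha> * (real (linf \<alpha>) / real k * (c * ?N k) * \<parallel>x\<parallel>))"
        using M dn nrm_nonneg[OF x] by (intro sum_mono mult_left_mono mult_right_mono) auto
      also have "\<dots> = L * c / real k * (?N k * \<parallel>x\<parallel>)"
        unfolding L_def sum_distrib_right sum_divide_distrib by (intro sum.cong) auto
      also have "\<dots> \<le> e * (?N k * \<parallel>x\<parallel>)"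
      proof (rule mult_right_mono)
        have "real k0 < real k" using k by simp
        then have "L * c / e < real k" using k0 by linarith
        then show "L * c / real k \<le> e" using \<open>e > 0\<close> k by (simp add: field_simps)
        show "0 \<le> ?N k * \<parallel>x\<parallel>" using bump_size_pos[OF kp, where ?'n = 'n] nrm_nonneg[OF x] by simp
      qed
      finally show ?thesis using lp_summable_mono[OF c0 cs fs] by (simp add: mult.assoc)
    qed
    then show "\<exists>k0>0. \<forall>k\<ge>k0. \<forall>x\<in>lp. lp_summable p (\<lambda>s. \<parallel>commutator B (\<lambda>i. bump k (i - s)) x\<parallel>) \<and>
          lp_size p (\<lambda>s. \<parallel>commutator B (\<lambda>i. bump k (i - s)) x\<parallel>) \<le> e * ?N k * \<parallel>x\<parallel>"
      by (intro exI[of _ "Suc (k0 + w)"]) auto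
  qed
qed

text \<open>The commutator of T is that of B plus that of T - B. Both terms of the latter keep their
  cutoff function instead of being estimated by d times the norm of x, because only then can they be
  averaged over all translates.\<close>

lemma commutator_perturbation:
  fixes T B :: "('n::finite, 'x::complex_banach) oper"
  assumes T: "T \<in> ops" and B: "B \<in> ops" and d: "0 \<le> d" and ap: "\<And>x. x \<in> lp \<Longrightarrow> \<parallel>T x - B x\<parallel> \<le> d * \<parallel>x\<parallel>"
    and x: "x \<in> lp" and \<phi>: "\<And>i. \<bar>\<phi> i\<bar> \<le> 1"
  shows "\<parallel>commutator T \<phi> x\<parallel> \<le> \<parallel>commutator B \<phi> x\<parallel> + (d * \<parallel>rmul \<phi> x\<parallel> + \<parallel>rmul \<phi> (T x - B x)\<parallel>)"
proof -
  have r: "rmul \<phi> y \<in> lp" if "y \<in> lp" for y :: "('n, 'x) seq" using lp_rmul(1)[OF that, of 1 \<phi>] \<phi> by simp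
  have eq: "commutator T \<phi> x = commutator B \<phi> x + ((T (rmul \<phi> x) - B (rmul \<phi> x)) - rmul \<phi> (T x - B x))"
    by (simp add: rmul_diff)
  have "\<parallel>commutator T \<phi> x\<parallel>
      = \<parallel>commutator B \<phi> x + ((T (rmul \<phi> x) - B (rmul \<phi> x)) - rmul \<phi> (T x - B x))\<parallel>"
    by (rule arg_cong[OF eq])
  moreover have "\<parallel>commutator B \<phi> x + ((T (rmul \<phi> x) - B (rmul \<phi> x)) - rmul \<phi> (T x - B x))\<parallel>
      \<le> \<parallel>commutator B \<phi> x\<parallel> + \<parallel>(T (rmul \<phi> x) - B (rmul \<phi> x)) - rmul \<phi> (T x - B x)\<parallel>"
    by (rule lp_add_mem(2)) (use T B x r in auto)
  moreover have "\<parallel>(T (rmul \<phi> x) - B (rmul \<phi> x)) - rmul \<phi> (T x - B x)\<parallel>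
      \<le> \<parallel>T (rmul \<phi> x) - B (rmul \<phi> x)\<parallel> + \<parallel>rmul \<phi> (T x - B x)\<parallel>"
    by (rule lp_diff_mem(2)) (use T B x r in auto)
  moreover have "\<parallel>T (rmul \<phi> x) - B (rmul \<phi> x)\<parallel> \<le> d * \<parallel>rmul \<phi> x\<parallel>" using x r by (intro ap)
  ultimately show ?thesis by linarith
qed

text \<open>All three properties hold for band operators and survive norm limits. In the averaged
  case the perturbation terms are handled by \<open>bump_average\<close>, which turns them into the
  size of the bump times the norms of x and of (T - B) x; three errors of e/4 remain.\<close>

lemma band_dominated_structure:
  fixes T :: "('n::finite, 'x::complex_banach) oper"
  assumes "T \<in> band_dominated_ops p"
  shows "T \<in> ops" "small_commutators T" "small_average_commutators T" "finite_propagation_limit T"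
proof -
  show To: "T \<in> ops" using assms by (simp add: band_dominated_ops_def)
  have ex: "\<exists>B\<in>band_ops p. B \<in> ops \<and> (\<forall>x\<in>lp. \<parallel>T x - B x\<parallel> \<le> e * \<parallel>x\<parallel>)" if "e > 0" for e
  proof -
    obtain B where B: "B \<in> band_ops p" "opn (T - B) < e"
      using assms \<open>e > 0\<close> by (auto simp: band_dominated_ops_def)
    have Bo: "B \<in> ops" using band_op_structure[OF B(1)] by blast
    have "\<parallel>T x - B x\<parallel> \<le> e * \<parallel>x\<parallel>" if "x \<in> lp" for x
      using opn_bound'[OF ops_minus(1)[OF To Bo] that, of e] B(2) by simp
    then show ?thesis using B(1) Bo by blast
  qed
  show "finite_propagation_limit T"
    unfolding finite_propagation_limit_def
  proof (intro allI impI)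
    fix e :: real assume "e > 0"
    then obtain B where B: "B \<in> band_ops p" "B \<in> ops" "\<forall>x\<in>lp. \<parallel>T x - B x\<parallel> \<le> e * \<parallel>x\<parallel>"
      using ex by blast
    moreover obtain w where "propagation_le w B" using band_op_structure[OF B(1)] by blast
    ultimately show "\<exists>B\<in>ops. \<exists>w. propagation_le w B \<and> small_commutators B \<and>
        (\<forall>x\<in>lp. \<parallel>T x - B x\<parallel> \<le> e * \<parallel>x\<parallel>)"
      using band_small_commutators(1)[OF B(1)] by blast
  qed
  note bb = bump_bounds
  have b1: "\<bar>bump k (i - s)\<bar> \<le> 1" for k i s by (simp add: abs_of_nonneg bb)
  show "small_commutators T"
    unfolding small_commutators_def
  proof (intro allI impI)
    fix e :: real assume "e > 0"
    then have e4: "e / 4 > 0" by simp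
    obtain B where B: "B \<in> band_ops p" "B \<in> ops" "\<And>x. x \<in> lp \<Longrightarrow> \<parallel>T x - B x\<parallel> \<le> e / 4 * \<parallel>x\<parallel>"
      using ex[OF e4] by blast
    obtain k0 where k0: "k0 > 0" "\<And>k s x. k0 \<le> k \<Longrightarrow> x \<in> lp \<Longrightarrow> \<parallel>commutator B (\<lambda>i. bump k (i - s)) x\<parallel> \<le> e / 4 * \<parallel>x\<parallel>"
      using band_small_commutators(1)[OF B(1), unfolded small_commutators_def, rule_format, OF e4] by blast
    have "\<parallel>commutator T (\<lambda>i. bump k (i - s)) x\<parallel> \<le> e * \<parallel>x\<parallel>" if "k0 \<le> k" and x: "x \<in> lp" for k s x
    proof -
      let ?\<phi> = "\<lambda>i. bump k (i - s)"
      have "\<parallel>commutator T ?\<phi> x\<parallel> \<le> \<parallel>commutator B ?\<phi> x\<parallel> + (e / 4 * \<parallel>rmul ?\<phi> x\<parallel> + \<parallel>rmul ?\<phi> (T x - B x)\<parallel>)"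
        using \<open>e > 0\<close> by (intro commutator_perturbation To B x b1) auto
      moreover have "e / 4 * \<parallel>rmul ?\<phi> x\<parallel> \<le> e / 4 * \<parallel>x\<parallel>"
        using \<open>e > 0\<close> x by (intro mult_left_mono rmul_bump_le) auto
      moreover have "\<parallel>rmul ?\<phi> (T x - B x)\<parallel> \<le> \<parallel>T x - B x\<parallel>" using x To B by (intro rmul_bump_le) auto
      moreover have "0 \<le> e * \<parallel>x\<parallel>" using nrm_nonneg[OF x] \<open>e > 0\<close> by simp
      ultimately show ?thesis using k0(2)[OF that, of s] B(3)[OF x] by argo
    qed
    then show "\<exists>k0>0. \<forall>k\<ge>k0. \<forall>s. \<forall>x\<in>lp. \<parallel>commutator T (\<lambda>i. bump k (i - s)) x\<parallel> \<le> e * \<parallel>x\<parallel>"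
      using k0(1) by blast
  qed
  show "small_average_commutators T"
    unfolding small_average_commutators_def
  proof (intro allI impI)
    fix e :: real assume "e > 0"
    then have e4: "e / 4 > 0" by simp
    obtain B where B: "B \<in> band_ops p" "B \<in> ops" "\<And>x. x \<in> lp \<Longrightarrow> \<parallel>T x - B x\<parallel> \<le> e / 4 * \<parallel>x\<parallel>"
      using ex[OF e4] by blast
    let ?N = "\<lambda>k. lp_size p (bump k :: int ^ 'n \<Rightarrow> real)"
    obtain k0 where k0: "k0 > 0" "\<And>k x. k0 \<le> k \<Longrightarrow> x \<in> lp \<Longrightarrow>
        lp_summable p (\<lambda>s. \<parallel>commutator B (\<lambda>i. bump k (i - s)) x\<parallel>)"
        "\<And>k x. k0 \<le> k \<Longrightarrow> x \<in> lp \<Longrightarrow>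
        lp_size p (\<lambda>s. \<parallel>commutator B (\<lambda>i. bump k (i - s)) x\<parallel>) \<le> e / 4 * ?N k * \<parallel>x\<parallel>"
      using band_small_commutators(2)[OF B(1), unfolded small_average_commutators_def, rule_format, OF e4]
      by blast
    have "lp_summable p (\<lambda>s. \<parallel>commutator T (\<lambda>i. bump k (i - s)) x\<parallel>) \<and>
        lp_size p (\<lambda>s. \<parallel>commutator T (\<lambda>i. bump k (i - s)) x\<parallel>) \<le> e * ?N k * \<parallel>x\<parallel>"
      if k: "k0 \<le> k" and x: "x \<in> lp" for k x
    proof -
      have kp: "0 < k" using k k0(1) by simp
      let ?\<phi> = "\<lambda>s i. bump k (i - s)"
      let ?a = "\<lambda>s. \<parallel>commutator B (?\<phi> s) x\<parallel>"
      let ?b = "\<lambda>s. e / 4 * \<parallel>rmul (?\<phi> s) x\<parallel>" and ?c = "\<lambda>s. \<parallel>rmul (?\<phi> s) (T x - B x)\<parallel>"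
      have TB: "T x - B x \<in> lp" using x To B by simp
      have nn: "0 \<le> ?a s" "0 \<le> ?b s" "0 \<le> ?c s" "0 \<le> \<parallel>commutator T (?\<phi> s) x\<parallel>" for s
        using x To B \<open>e > 0\<close> by (auto intro!: nrm_nonneg mult_nonneg_nonneg)
      note av = bump_average[OF kp x] bump_average[OF kp TB]
      have b: "lp_summable p ?b" "lp_size p ?b = e / 4 * (?N k * \<parallel>x\<parallel>)"
        using lp_mult[OF nrm_nonneg[OF rmul_bump[OF x]] av(1), of "e / 4"] e4 av(2) by auto
      have bc: "lp_summable p (\<lambda>s. ?b s + ?c s)" "lp_size p (\<lambda>s. ?b s + ?c s) \<le> lp_size p ?b + lp_size p ?c"
        by (rule lp_add[OF nn(2) b(1) nn(3) av(3)])+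
      have bc0: "0 \<le> ?b s + ?c s" for s using nn(2,3) by (rule add_nonneg_nonneg)
      have abc: "lp_summable p (\<lambda>s. ?a s + (?b s + ?c s))"
        "lp_size p (\<lambda>s. ?a s + (?b s + ?c s)) \<le> lp_size p ?a + lp_size p (\<lambda>s. ?b s + ?c s)"
        by (rule lp_add[OF nn(1) k0(2)[OF k x] bc0 bc(1)])+
      have le: "\<parallel>commutator T (?\<phi> s) x\<parallel> \<le> ?a s + (?b s + ?c s)" for s
        using \<open>e > 0\<close> by (intro commutator_perturbation To B x b1) auto
      have "lp_size p (\<lambda>s. \<parallel>commutator T (?\<phi> s) x\<parallel>) \<le> lp_size p (\<lambda>s. ?a s + (?b s + ?c s))"
        using nn(4) le abc(1) by (rule lp_size_mono)
      moreover have "?N k * \<parallel>T x - B x\<parallel> \<le> ?N k * (e / 4 * \<parallel>x\<parallel>)"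
        using bump_size_pos[OF kp, where ?'n = 'n] B(3)[OF x] by (intro mult_left_mono) auto
      moreover have "0 \<le> e * ?N k * \<parallel>x\<parallel>"
        using bump_size_pos[OF kp, where ?'n = 'n] nrm_nonneg[OF x] \<open>e > 0\<close> by simp
      moreover have "?N k * (e / 4 * \<parallel>x\<parallel>) = e * ?N k * \<parallel>x\<parallel> / 4" "e / 4 * (?N k * \<parallel>x\<parallel>) = e * ?N k * \<parallel>x\<parallel> / 4"
        "e / 4 * ?N k * \<parallel>x\<parallel> = e * ?N k * \<parallel>x\<parallel> / 4" by simp_all
      ultimately have "lp_size p (\<lambda>s. \<parallel>commutator T (?\<phi> s) x\<parallel>) \<le> e * ?N k * \<parallel>x\<parallel>"
        using bc(2) abc(2) k0(3)[OF k x] av(4) b(2) by linarith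
      then show ?thesis using lp_summable_mono[OF nn(4) le abc(1)] by simp
    qed
    then show "\<exists>k0>0. \<forall>k\<ge>k0. \<forall>x\<in>lp. lp_summable p (\<lambda>s. \<parallel>commutator T (\<lambda>i. bump k (i - s)) x\<parallel>) \<and>
        lp_size p (\<lambda>s. \<parallel>commutator T (\<lambda>i. bump k (i - s)) x\<parallel>) \<le> e * ?N k * \<parallel>x\<parallel>"
      using k0(1) by blast
  qed
qed

lemma commutator_shifted:
  assumes "x \<in> lp"
  shows "commutator (T - op_scaleC z (id_op p)) (\<lambda>i. bump k (i - s)) x = commutator T (\<lambda>i. bump k (i - s)) x"
proof -
  have "rmul \<phi> (seq_scaleC z x) = seq_scaleC z (rmul \<phi> x)" for \<phi> :: "int ^ 'a \<Rightarrow> real"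
    by (auto simp: rmul_def seq_scaleC_def scaleC_scaleR)
  then show ?thesis using assms by (simp add: op_scaleC_apply id_op_apply rmul_diff)
qed

text \<open>Scalars commute with multiplication by functions and have propagation 0, so the three
  properties depend on T only up to scalars.\<close>

lemma structure_minus_scalar:
  fixes T :: "('n::finite, 'x::complex_banach) oper"
  assumes T: "T \<in> ops"
  shows "small_commutators T \<Longrightarrow> small_commutators (T - op_scaleC z (id_op p))"
    and "small_average_commutators T \<Longrightarrow> small_average_commutators (T - op_scaleC z (id_op p))"
    and "finite_propagation_limit T \<Longrightarrow> finite_propagation_limit (T - op_scaleC z (id_op p))"
proof -
  have sc: "small_commutators (B - op_scaleC z (id_op p))" if "small_commutators B"
    for B :: "('n, 'x) oper"
    using that unfolding small_commutators_def by (simp only: commutator_shifted cong: ball_cong)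
  show "small_commutators T \<Longrightarrow> small_commutators (T - op_scaleC z (id_op p))" by (rule sc)
  show "small_average_commutators T \<Longrightarrow> small_average_commutators (T - op_scaleC z (id_op p))"
    unfolding small_average_commutators_def by (simp only: commutator_shifted cong: ball_cong)
  assume fp: "finite_propagation_limit T"
  show "finite_propagation_limit (T - op_scaleC z (id_op p))"
    unfolding finite_propagation_limit_def
  proof (intro allI impI)
    fix e :: real assume "e > 0"
    then obtain B w where B: "B \<in> ops" "propagation_le w B" "small_commutators B"
      "\<And>x. x \<in> lp \<Longrightarrow> \<parallel>T x - B x\<parallel> \<le> e * \<parallel>x\<parallel>"
      using fp unfolding finite_propagation_limit_def by blast
    have "propagation_le w (B - op_scaleC z (id_op p))"
      unfolding propagation_le_def
    proof (intro ballI allI impI)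
      fix x :: "('n, 'x) seq" and i
      assume x: "x \<in> lp" and h: "\<forall>j. linf (i - j) \<le> w \<longrightarrow> x j = 0"
      then have "B x i = 0" using B(2) by (auto simp: propagation_le_def)
      moreover have "x i = 0" using h by simp
      ultimately show "(B - op_scaleC z (id_op p)) x i = 0"
        using x by (simp add: op_scaleC_apply id_op_apply fun_apply seq_scaleC_def)
    qed
    moreover have "B - op_scaleC z (id_op p) \<in> ops" using B(1) by (intro ops_minus ops_op_scaleC) auto
    moreover have "\<parallel>(T - op_scaleC z (id_op p)) x - (B - op_scaleC z (id_op p)) x\<parallel> \<le> e * \<parallel>x\<parallel>" if "x \<in> lp" for x
      using B(4)[OF that] by simp
    ultimately show "\<exists>B\<in>ops. \<exists>w. propagation_le w B \<and> small_commutators B \<and>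
        (\<forall>x\<in>lp. \<parallel>(T - op_scaleC z (id_op p)) x - B x\<parallel> \<le> e * \<parallel>x\<parallel>)"
      using sc[OF B(3)] by blast
  qed
qed

text \<open>Averaging over all translates of one bump is an exact isometry up to a constant factor, so lower
  bounds on windows of a fixed size globalise without loss in the constant.\<close>

lemma lower_bound_globalisation:
  fixes T :: "('n::finite, 'x::complex_banach) oper" and y :: "('n, 'x) seq"
  assumes T: "T \<in> ops" and y: "y \<in> lp" and k: "0 < k" and \<kappa>: "0 \<le> \<kappa>"
    and loc: "\<And>s. \<kappa> * \<parallel>rmul (\<lambda>i. bump k (i - s)) y\<parallel> \<le> \<parallel>T (rmul (\<lambda>i. bump k (i - s)) y)\<parallel>"
    and com: "lp_summable p (\<lambda>s. \<parallel>commutator T (\<lambda>i. bump k (i - s)) y\<parallel>)"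
      "lp_size p (\<lambda>s. \<parallel>commutator T (\<lambda>i. bump k (i - s)) y\<parallel>) \<le> e * lp_size p (bump k :: int ^ 'n \<Rightarrow> real) * \<parallel>y\<parallel>"
  shows "(\<kappa> - e) * \<parallel>y\<parallel> \<le> \<parallel>T y\<parallel>"
proof -
  let ?\<phi> = "\<lambda>s i. bump k (i - s)" and ?N = "lp_size p (bump k :: int ^ 'n \<Rightarrow> real)"
  have Ty: "T y \<in> lp" using T y by simp
  note av = bump_average[OF k y] bump_average[OF k Ty]
  have nn: "0 \<le> \<parallel>rmul (?\<phi> s) y\<parallel>" "0 \<le> \<parallel>rmul (?\<phi> s) (T y)\<parallel>" "0 \<le> \<parallel>commutator T (?\<phi> s) y\<parallel>" for s
    using T y by (auto intro!: nrm_nonneg)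
  have s1: "lp_summable p (\<lambda>s. \<parallel>rmul (?\<phi> s) (T y)\<parallel> + \<parallel>commutator T (?\<phi> s) y\<parallel>)"
    "lp_size p (\<lambda>s. \<parallel>rmul (?\<phi> s) (T y)\<parallel> + \<parallel>commutator T (?\<phi> s) y\<parallel>)
      \<le> ?N * \<parallel>T y\<parallel> + e * ?N * \<parallel>y\<parallel>"
  proof -
    show "lp_summable p (\<lambda>s. \<parallel>rmul (?\<phi> s) (T y)\<parallel> + \<parallel>commutator T (?\<phi> s) y\<parallel>)"
      using nn av com by (intro lp_add) auto
    have "lp_size p (\<lambda>s. \<parallel>rmul (?\<phi> s) (T y)\<parallel> + \<parallel>commutator T (?\<phi> s) y\<parallel>)
      \<le> lp_size p (\<lambda>s. \<parallel>rmul (?\<phi> s) (T y)\<parallel>) + lp_size p (\<lambda>s. \<parallel>commutator T (?\<phi> s) y\<parallel>)"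
      using nn av com by (intro lp_add) auto
    then show "lp_size p (\<lambda>s. \<parallel>rmul (?\<phi> s) (T y)\<parallel> + \<parallel>commutator T (?\<phi> s) y\<parallel>)
      \<le> ?N * \<parallel>T y\<parallel> + e * ?N * \<parallel>y\<parallel>" using av(4) com(2) by linarith
  qed
  have "\<kappa> * \<parallel>rmul (?\<phi> s) y\<parallel> \<le> \<parallel>rmul (?\<phi> s) (T y)\<parallel> + \<parallel>commutator T (?\<phi> s) y\<parallel>" for s
    using loc[of s] nrm_triangle_sub[of "T (rmul (?\<phi> s) y)" "rmul (?\<phi> s) (T y)"] T y by simp
  then have "lp_size p (\<lambda>s. \<kappa> * \<parallel>rmul (?\<phi> s) y\<parallel>) \<le> ?N * \<parallel>T y\<parallel> + e * ?N * \<parallel>y\<parallel>"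
    using \<kappa> nn by (intro order_trans[OF lp_size_mono[OF _ _ s1(1)] s1(2)]) auto
  moreover have "lp_size p (\<lambda>s. \<kappa> * \<parallel>rmul (?\<phi> s) y\<parallel>) = \<kappa> * (?N * \<parallel>y\<parallel>)"
    using lp_mult(2)[OF nn(1) av(1) \<kappa>] av(2) by simp
  ultimately have "?N * ((\<kappa> - e) * \<parallel>y\<parallel>) \<le> ?N * \<parallel>T y\<parallel>" by (simp add: algebra_simps)
  then show ?thesis using bump_size_pos[OF k, where ?'n = 'n] by simp
qed

end


section \<open>Limit operators of operators invertible modulo the ideal\<close>

text \<open>Errors arise as e times a quantity fixed beforehand. Testing with e/(1 + \<bar>M\<bar>)
  absorbs that factor, whatever its sign.\<close>

lemma le_of_le_add_small:
  fixes a b M :: real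
  assumes "\<And>e. 0 < e \<Longrightarrow> a \<le> b + e * M" shows "a \<le> b"
proof (rule field_le_epsilon)
  fix e :: real assume e: "0 < e"
  have "e / (1 + \<bar>M\<bar>) * M \<le> e"
  proof -
    have "e / (1 + \<bar>M\<bar>) * M \<le> e / (1 + \<bar>M\<bar>) * (1 + \<bar>M\<bar>)" using e by (intro mult_left_mono) auto
    then show ?thesis by simp
  qed
  then show "a \<le> b + e" using assms[of "e / (1 + \<bar>M\<bar>)"] e by simp
qed

lemma int_linf: "int (linf i) = Max (range (\<lambda>j. \<bar>i $ j\<bar>))"
proof -
  have "int (linf i) = Max (int ` range (\<lambda>j. nat \<bar>i $ j\<bar>))"
    unfolding linf_def by (rule mono_Max_commute) (auto intro: monoI)
  also have "int ` range (\<lambda>j. nat \<bar>i $ j\<bar>) = range (\<lambda>j. \<bar>i $ j\<bar>)" by (simp add: image_image)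
  finally show ?thesis .
qed

lemma tends_to_infinity_iff:
  "tends_to_infinity h \<longleftrightarrow> (\<forall>m. \<forall>\<^sub>F n in sequentially. m \<le> linf (h n))"
proof -
  have "tends_to_infinity h \<longleftrightarrow> filterlim (\<lambda>n. int (linf (h n))) at_top sequentially"
    by (simp add: tends_to_infinity_def int_linf)
  also have "\<dots> \<longleftrightarrow> (\<forall>m. \<forall>\<^sub>F n in sequentially. m \<le> linf (h n))"
    unfolding filterlim_at_top
  proof safe
    fix m :: nat assume "\<forall>Z. \<forall>\<^sub>F n in sequentially. Z \<le> int (linf (h n))"
    then show "\<forall>\<^sub>F n in sequentially. m \<le> linf (h n)" by (auto dest!: spec[of _ "int m"])
  next
    fix Z :: int assume "\<forall>m. \<forall>\<^sub>F n in sequentially. m \<le> linf (h n)"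
    then have "\<forall>\<^sub>F n in sequentially. nat Z \<le> linf (h n)" by blast
    then show "\<forall>\<^sub>F n in sequentially. Z \<le> int (linf (h n))" by eventually_elim simp
  qed
  finally show ?thesis .
qed

section \<open>Conjugation by shifts and convergence on windows\<close>

context lp_exponent
begin

lemma rmul_bump_centred [simp]: "x \<in> lp \<Longrightarrow> rmul (bump k) x \<in> lp"
  using rmul_bump[of x k 0] by simp

abbreviation conj_shift :: "int ^ 'n::finite \<Rightarrow> ('n, 'x::complex_banach) oper \<Rightarrow> ('n, 'x) oper" where
  "conj_shift k T \<equiv> shift_op p (- k) \<circ> T \<circ> shift_op p k"

lemma conj_shift_apply: "conj_shift k T x = shift_op p (- k) (T (shift_op p k x))"
  by simp

lemma conj_shift_ops: "T \<in> ops \<Longrightarrow> conj_shift k T \<in> ops"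
  by (intro ops_comp shift_mem)

lemma conj_shift_Pops: "T \<in> Pops \<Longrightarrow> conj_shift k T \<in> Pops"
  by (intro Pops_comp Pops_shift)

lemma conj_shift_nrm: "T \<in> ops \<Longrightarrow> x \<in> lp \<Longrightarrow> \<parallel>conj_shift k T x\<parallel> = \<parallel>T (shift_op p k x)\<parallel>"
  by (simp add: shift_nrm shift_lp)

lemma conj_shift_comp:
  assumes "S \<in> ops" "T \<in> ops" "x \<in> lp"
  shows "conj_shift k S (conj_shift k T x) = conj_shift k (S \<circ> T) x"
  using assms by (simp add: shift_cancel shift_lp)

lemma conj_shift_id: "x \<in> lp \<Longrightarrow> conj_shift k (id_op p) x = x"
  by (simp add: shift_cancel shift_lp id_op_apply)

lemma conj_shift_diff:
  assumes "S \<in> ops" "T \<in> ops" "x \<in> lp"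
  shows "conj_shift k (S - T) x = conj_shift k S x - conj_shift k T x"
  using assms by (simp add: ops_diff[OF shift_mem] shift_lp)

lemma rmul_shift:
  assumes x: "x \<in> lp" and \<phi>: "\<And>i. \<bar>\<phi> i\<bar> \<le> 1"
  shows "rmul \<phi> (shift_op p (- k) x) = shift_op p (- k) (rmul (\<lambda>i. \<phi> (i - k)) x)"
    and "rmul (\<lambda>i. \<phi> (i - k)) (shift_op p k x) = shift_op p k (rmul \<phi> x)"
proof -
  have r: "rmul (\<lambda>i. \<phi> (i - k)) x \<in> lp" "rmul \<phi> x \<in> lp"
    using lp_rmul(1)[OF x, of 1] \<phi> by auto
  show "rmul \<phi> (shift_op p (- k) x) = shift_op p (- k) (rmul (\<lambda>i. \<phi> (i - k)) x)"
    by (rule ext) (simp add: rmul_apply shift_apply' x r)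
  show "rmul (\<lambda>i. \<phi> (i - k)) (shift_op p k x) = shift_op p k (rmul \<phi> x)"
    by (rule ext) (simp add: rmul_apply shift_apply' x r)
qed

lemma rmul_shift_nrm:
  assumes x: "x \<in> lp" and \<phi>: "\<And>i. \<bar>\<phi> i\<bar> \<le> 1"
  shows "\<parallel>rmul \<phi> (shift_op p (- k) x)\<parallel> = \<parallel>rmul (\<lambda>i. \<phi> (i - k)) x\<parallel>"
proof -
  have r: "rmul (\<lambda>i. \<phi> (i - k)) x \<in> lp" using lp_rmul(1)[OF x, of 1 "\<lambda>i. \<phi> (i - k)"] \<phi> by auto
  show ?thesis using shift_nrm[OF r, of "- k"] rmul_shift(1)[of x \<phi> k] x \<phi> by simp
qed

text \<open>The cube of radius m about k misses \<open>cube l\<close> once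
  \<open>linf k > m + l\<close>, so a window that has been shifted far out sees only the
  tail.\<close>

lemma cut_shift_le:
  assumes x: "x \<in> lp" and k: "m + l < linf k"
  shows "\<parallel>cut m (shift_op p (- k) x)\<parallel> \<le> \<parallel>tail l x\<parallel>"
proof -
  have "\<parallel>cut m (shift_op p (- k) x)\<parallel> = \<parallel>rmul (\<lambda>i. indicat_real (cube m) (i - k)) x\<parallel>"
    using x by (intro rmul_shift_nrm) auto
  also have "\<dots> \<le> \<parallel>tail l x\<parallel>"
  proof (rule lp_solid(2)[OF lp_ind(1)[OF x]])
    fix i
    have "i \<notin> cube l" if "i - k \<in> cube m"
      using that k linf_diff[of "i" "i - k"] by (auto simp: mem_cube_iff)
    then show "norm (rmul (\<lambda>i. indicat_real (cube m) (i - k)) x i) \<le> norm (tail l x i)"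
      by (auto simp: rmul_apply indicator_def)
  qed
  finally show ?thesis .
qed

lemma shift_cut_tail:
  assumes x: "x \<in> lp" and k: "m + l < linf k"
  shows "tail l (shift_op p k (cut m x)) = shift_op p k (cut m x)"
proof
  fix i
  have "i \<notin> cube l" if "i - k \<in> cube m"
    using that k linf_diff[of "i" "i - k"] by (auto simp: mem_cube_iff)
  then show "tail l (shift_op p k (cut m x)) i = shift_op p k (cut m x) i"
    by (auto simp: rmul_apply shift_apply' indicator_def)
qed

text \<open>Testing the convergence with the cutoff to a cube gives closeness in operator norm, once
  for the output seen through a window and once for inputs supported in it.\<close>

lemma P_strong_limit_window:
  assumes lim: "P_strong_limit p T L" and e: "0 < e"
  shows "\<forall>\<^sub>F n in sequentially. \<forall>x\<in>lp. \<parallel>cut m (T n x - L x)\<parallel> \<le> e * \<parallel>x\<parallel> \<and> \<parallel>T n (cut m x) - L (cut m x)\<parallel> \<le> e * \<parallel>x\<parallel>"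
proof -
  let ?K = "mop p (indicat_real (cube m))"
  have o: "T n \<in> ops" "L \<in> ops" for n using lim by (auto simp: P_strong_limit_def)
  have "(\<lambda>n. opn (?K \<circ> (T n - L)) + opn ((T n - L) \<circ> ?K)) \<longlonglongrightarrow> 0"
    using lim compact_cut unfolding P_strong_limit_def by blast
  then have "\<forall>\<^sub>F n in sequentially. opn (?K \<circ> (T n - L)) + opn ((T n - L) \<circ> ?K) < e"
    using e by (rule order_tendstoD)
  then show ?thesis
  proof eventually_elim
    fix n assume le: "opn (?K \<circ> (T n - L)) + opn ((T n - L) \<circ> ?K) < e"
    have KT: "?K \<circ> (T n - L) \<in> ops" "(T n - L) \<circ> ?K \<in> ops"
      using o by (auto intro!: ops_comp(1) ops_minus(1))
    have le1: "opn (?K \<circ> (T n - L)) \<le> e" and le2: "opn ((T n - L) \<circ> ?K) \<le> e"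
      using le opn_nonneg[OF KT(1)] opn_nonneg[OF KT(2)] by linarith+
    show "\<forall>x\<in>lp. \<parallel>cut m (T n x - L x)\<parallel> \<le> e * \<parallel>x\<parallel> \<and> \<parallel>T n (cut m x) - L (cut m x)\<parallel> \<le> e * \<parallel>x\<parallel>"
      using opn_bound'[OF KT(1) _ le1] opn_bound'[OF KT(2) _ le2] o by (simp add: mop_apply)
  qed
qed

lemma P_strong_limit_ops:
  "P_strong_limit p T L \<Longrightarrow> L \<in> ops" "P_strong_limit p T L \<Longrightarrow> T n \<in> ops"
  by (auto simp: P_strong_limit_def)

lemma is_limit_opD:
  assumes "is_limit_op p B h L"
  shows "L \<in> ops" "\<forall>\<^sub>F n in sequentially. m \<le> linf (h n)"
    "P_strong_limit p (\<lambda>n. conj_shift (h n) B) L"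
  using assms by (auto simp: is_limit_op_def tends_to_infinity_iff P_strong_limit_ops)

text \<open>Conjugation by a shift moves the centre of the cutoff function from s to k + s and
  preserves the norm; a bound uniform in the centre is therefore inherited by all
  conjugates.\<close>

lemma conj_shift_commutator:
  assumes T: "T \<in> ops" and x: "x \<in> lp"
  shows "\<parallel>commutator (conj_shift k T) (\<lambda>i. bump r (i - s)) x\<parallel>
    = \<parallel>commutator T (\<lambda>i. bump r (i - (k + s))) (shift_op p k x)\<parallel>"
proof -
  have b: "\<bar>bump r (i - s)\<bar> \<le> 1" for i by (simp add: abs_of_nonneg bump_bounds)
  have e: "i - k - s = i - (k + s)" for i by (simp add: algebra_simps)
  have 1: "rmul (\<lambda>i. bump r (i - (k + s))) (shift_op p k x) = shift_op p k (rmul (\<lambda>i. bump r (i - s)) x)"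
    using rmul_shift(2)[where \<phi> = "\<lambda>i. bump r (i - s)" and k = k, OF x b] by (simp only: e)
  have Tx: "T (shift_op p k x) \<in> lp" using T x by (simp add: shift_lp)
  have 2: "rmul (\<lambda>i. bump r (i - s)) (shift_op p (- k) (T (shift_op p k x)))
      = shift_op p (- k) (rmul (\<lambda>i. bump r (i - (k + s))) (T (shift_op p k x)))"
    using rmul_shift(1)[where \<phi> = "\<lambda>i. bump r (i - s)" and k = k, OF Tx b] by (simp only: e)
  have mem: "commutator T (\<lambda>i. bump r (i - (k + s))) (shift_op p k x) \<in> lp"
    using T x by (simp add: shift_lp)
  have "commutator (conj_shift k T) (\<lambda>i. bump r (i - s)) x
      = shift_op p (- k) (commutator T (\<lambda>i. bump r (i - (k + s))) (shift_op p k x))"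
    unfolding conj_shift_apply 2 1[symmetric]
    by (rule ops_diff[OF shift_mem, symmetric]) (use T x in \<open>auto simp: shift_lp\<close>)
  from arg_cong[OF this, of "lp_norm p"] show ?thesis using shift_nrm[OF mem] by simp
qed

lemma bump_support_cut: "0 < k \<Longrightarrow> cut (2 * k + linf s) (rmul (\<lambda>i. bump k (i - s)) x) = rmul (\<lambda>i. bump k (i - s)) x"
  and bump_cut: "0 < k \<Longrightarrow> rmul (\<lambda>i. bump k (i - s)) (cut (2 * k + linf s) x) = rmul (\<lambda>i. bump k (i - s)) x"
proof -
  have "i \<in> cube (2 * k + linf s)" if "0 < k" "bump k (i - s) \<noteq> 0" for i
    using that bump_eq_0[of k "i - s"] linf_add[of "i - s" s]
    by (cases "i - s \<in> cube (2 * k)") (auto simp: mem_cube_iff)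
  then show "0 < k \<Longrightarrow> cut (2 * k + linf s) (rmul (\<lambda>i. bump k (i - s)) x) = rmul (\<lambda>i. bump k (i - s)) x"
    "0 < k \<Longrightarrow> rmul (\<lambda>i. bump k (i - s)) (cut (2 * k + linf s) x) = rmul (\<lambda>i. bump k (i - s)) x"
    by (auto simp: rmul_def indicator_def fun_eq_iff)
qed

text \<open>For fixed k and s the cutoff sees only the window of radius 2k + \<open>linf s\<close>,
  and there some conjugate of B is close to L. The index n depends on k and s, but the threshold k0
  comes from B alone.\<close>

lemma small_commutators_limit_op:
  assumes B: "B \<in> ops" and sc: "small_commutators B" and lim: "is_limit_op p B h L"
  shows "small_commutators L"
  unfolding small_commutators_def
proof (intro allI impI)
  fix e :: real assume "e > 0"
  then have e3: "e / 3 > 0" by simp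
  note L = is_limit_opD(1)[OF lim]
  obtain k0 where k0: "k0 > 0" "\<And>k s x. k0 \<le> k \<Longrightarrow> x \<in> lp \<Longrightarrow> \<parallel>commutator B (\<lambda>i. bump k (i - s)) x\<parallel> \<le> e / 3 * \<parallel>x\<parallel>"
    using sc[unfolded small_commutators_def, rule_format, OF e3] by blast
  have "\<parallel>commutator L (\<lambda>i. bump k (i - s)) x\<parallel> \<le> e * \<parallel>x\<parallel>" if k: "k0 \<le> k" and x: "x \<in> lp" for k s x
  proof -
    let ?\<phi> = "rmul (\<lambda>i. bump k (i - s))" and ?m = "2 * k + linf s"
    have kp: "0 < k" using k k0 by simp
    obtain n where n: "\<And>x. x \<in> lp \<Longrightarrow> \<parallel>cut ?m (conj_shift (h n) B x - L x)\<parallel> \<le> e / 3 * \<parallel>x\<parallel>"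
      "\<And>x. x \<in> lp \<Longrightarrow> \<parallel>conj_shift (h n) B (cut ?m x) - L (cut ?m x)\<parallel> \<le> e / 3 * \<parallel>x\<parallel>"
      using eventually_happens[OF P_strong_limit_window[OF is_limit_opD(3)[OF lim] e3, of ?m]] by auto
    let ?B = "conj_shift (h n) B"
    have Bn: "?B \<in> ops" using B by (rule conj_shift_ops)
    have x': "?\<phi> x \<in> lp" using x by simp
    have eq: "commutator L (\<lambda>i. bump k (i - s)) x
        = commutator ?B (\<lambda>i. bump k (i - s)) x - ((?B (?\<phi> x) - L (?\<phi> x)) - ?\<phi> (?B x - L x))"
      by (simp add: rmul_diff del: comp_apply)
    have "\<parallel>commutator L (\<lambda>i. bump k (i - s)) x\<parallel>
        = \<parallel>commutator ?B (\<lambda>i. bump k (i - s)) x - ((?B (?\<phi> x) - L (?\<phi> x)) - ?\<phi> (?B x - L x))\<parallel>"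
      by (rule arg_cong[OF eq])
    moreover have "\<parallel>commutator ?B (\<lambda>i. bump k (i - s)) x - ((?B (?\<phi> x) - L (?\<phi> x)) - ?\<phi> (?B x - L x))\<parallel>
        \<le> \<parallel>commutator ?B (\<lambda>i. bump k (i - s)) x\<parallel> + \<parallel>(?B (?\<phi> x) - L (?\<phi> x)) - ?\<phi> (?B x - L x)\<parallel>"
      by (rule lp_diff_mem(2)) (use Bn L x in \<open>auto simp del: comp_apply\<close>)
    moreover have "\<parallel>(?B (?\<phi> x) - L (?\<phi> x)) - ?\<phi> (?B x - L x)\<parallel> \<le> \<parallel>?B (?\<phi> x) - L (?\<phi> x)\<parallel> + \<parallel>?\<phi> (?B x - L x)\<parallel>"
      by (rule lp_diff_mem(2)) (use Bn L x in \<open>auto simp del: comp_apply\<close>)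
    moreover have "\<parallel>?B (?\<phi> x) - L (?\<phi> x)\<parallel> \<le> e / 3 * \<parallel>?\<phi> x\<parallel>"
      using n(2)[OF x'] unfolding bump_support_cut[OF kp] .
    moreover have "e / 3 * \<parallel>?\<phi> x\<parallel> \<le> e / 3 * \<parallel>x\<parallel>"
      using e3 by (intro mult_left_mono rmul_bump_le x) auto
    moreover have "\<parallel>?\<phi> (?B x - L x)\<parallel> \<le> e / 3 * \<parallel>x\<parallel>"
    proof -
      have "\<parallel>?\<phi> (?B x - L x)\<parallel> = \<parallel>?\<phi> (cut ?m (?B x - L x))\<parallel>" unfolding bump_cut[OF kp] ..
      also have "\<dots> \<le> \<parallel>cut ?m (?B x - L x)\<parallel>" by (rule rmul_bump_le) simp
      also have "\<dots> \<le> e / 3 * \<parallel>x\<parallel>" by (rule n(1)[OF x])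
      finally show ?thesis .
    qed
    moreover have "\<parallel>commutator ?B (\<lambda>i. bump k (i - s)) x\<parallel> \<le> e / 3 * \<parallel>x\<parallel>"
      unfolding conj_shift_commutator[OF B x]
      using k0(2)[OF k shift_lp[OF x]] shift_nrm[OF x] by simp
    ultimately show ?thesis by argo
  qed
  then show "\<exists>k0>0. \<forall>k\<ge>k0. \<forall>s. \<forall>x\<in>lp. \<parallel>commutator L (\<lambda>i. bump k (i - s)) x\<parallel> \<le> e * \<parallel>x\<parallel>"
    using k0(1) by blast
qed

text \<open>A single conjugate of B close to L on the output window suffices, as it has off-diagonal
  decay of its own. The result lets L be applied to sequences that converge only on windows.\<close>

lemma limit_op_cut_tail:
  assumes B: "B \<in> Pops" and lim: "is_limit_op p B h L" and e: "e > 0"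
  shows "\<exists>l. \<forall>x\<in>lp. \<parallel>cut m (L (tail l x))\<parallel> \<le> e * \<parallel>x\<parallel>"
proof -
  have e2: "e / 2 > 0" using e by simp
  obtain n where n: "\<And>x. x \<in> lp \<Longrightarrow> \<parallel>cut m (conj_shift (h n) B x - L x)\<parallel> \<le> e / 2 * \<parallel>x\<parallel>"
    using eventually_happens[OF P_strong_limit_window[OF is_limit_opD(3)[OF lim] e2, of m]] by auto
  let ?B = "conj_shift (h n) B"
  have Bn: "?B \<in> Pops" using B by (rule conj_shift_Pops)
  note Bo = Pops_ops[OF Bn] is_limit_opD(1)[OF lim]
  obtain l where l: "\<And>x. x \<in> lp \<Longrightarrow> \<parallel>cut m (?B (tail l x))\<parallel> \<le> e / 2 * \<parallel>x\<parallel>"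
    using Pops_cut_tail[OF Bn e2, of m] by blast
  have "\<parallel>cut m (L (tail l x))\<parallel> \<le> e * \<parallel>x\<parallel>" if x: "x \<in> lp" for x
  proof -
    have t: "tail l x \<in> lp" using x by simp
    have "\<parallel>cut m (L (tail l x))\<parallel> \<le> \<parallel>cut m (?B (tail l x))\<parallel> + \<parallel>cut m (L (tail l x)) - cut m (?B (tail l x))\<parallel>"
      by (rule nrm_triangle_sub) auto
    moreover have "\<parallel>cut m (L (tail l x)) - cut m (?B (tail l x))\<parallel> = \<parallel>cut m (?B (tail l x) - L (tail l x))\<parallel>"
      unfolding rmul_diff by (rule nrm_diff_commute)
    moreover have "\<parallel>cut m (?B (tail l x) - L (tail l x))\<parallel> \<le> e / 2 * \<parallel>tail l x\<parallel>" by (rule n[OF t])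
    moreover have "e / 2 * \<parallel>tail l x\<parallel> \<le> e / 2 * \<parallel>x\<parallel>" using e2 lp_ind(2)[OF x] by (intro mult_left_mono) auto
    ultimately show ?thesis using l[OF x] by argo
  qed
  then show ?thesis by blast
qed

section \<open>Bounded invertibility of limit operators\<close>

lemma inverse_of_bijective:
  assumes L: "L \<in> ops" and c: "0 \<le> c" and low: "\<And>x. x \<in> lp \<Longrightarrow> \<parallel>x\<parallel> \<le> c * \<parallel>L x\<parallel>"
    and sur: "\<And>y. y \<in> lp \<Longrightarrow> \<exists>x\<in>lp. L x = y"
  obtains D where "D \<in> ops" "L \<circ> D = id_op p" "D \<circ> L = id_op p" "opn D \<le> c"
proof -
  obtain D0 where D0: "\<And>y. y \<in> lp \<Longrightarrow> D0 y \<in> lp \<and> L (D0 y) = y" using sur by metis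
  have inj: "x = y" if "x \<in> lp" "y \<in> lp" "L x = L y" for x y
  proof -
    have "\<parallel>x - y\<parallel> \<le> 0" using low[of "x - y"] that by (simp add: ops_diff[OF L])
    then show ?thesis using nrm_eq_0D[of "x - y"] that by simp
  qed
  define D where "D = lp_restrict p D0"
  have D: "D y \<in> lp" "L (D y) = y" if "y \<in> lp" for y
    using D0[OF that] that by (auto simp: D_def lp_restrict_def)
  have b: "\<parallel>D y\<parallel> \<le> c * \<parallel>y\<parallel>" if "y \<in> lp" for y using low[OF D(1)[OF that]] D(2)[OF that] by simp
  have Do: "D \<in> ops"
  proof (rule opsI[where C = c])
    show "D x = 0" if "x \<notin> lp" for x using that by (simp add: D_def lp_restrict_def)
    show "D (x + y) = D x + D y" if "x \<in> lp" "y \<in> lp" for x y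
      by (rule inj) (use that D L in \<open>auto simp: ops_add\<close>)
    show "D (seq_scaleC a x) = seq_scaleC a (D x)" if "x \<in> lp" for a x
      by (rule inj) (use that D L in \<open>auto simp: ops_scaleC\<close>)
  qed (use D b in auto)
  show thesis
  proof (rule that[OF Do])
    show "L \<circ> D = id_op p" by (rule ops_eqI) (use L Do D in \<open>auto simp: id_op_apply intro!: ops_comp(1)\<close>)
    show "D \<circ> L = id_op p"
    proof (rule ops_eqI)
      fix x :: "('a, 'b) seq" assume x: "x \<in> lp"
      have "D (L x) = x" by (rule inj) (use L D x in auto)
      then show "(D \<circ> L) x = id_op p x" using x by (simp add: id_op_apply)
    qed (use L Do in \<open>auto intro!: ops_comp(1)\<close>)
    show "opn D \<le> c" using c b by (rule opn_le)
  qed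
qed

text \<open>A finitely supported u shifted far out lies where C B is close to the identity, and the
  conjugates of B applied to u converge to L u in norm. For general x the bump cutoffs reduce to
  this case at the cost of a commutator.\<close>

lemma limit_op_lower_bound:
  fixes x :: "('n::finite, 'x::complex_banach) seq"
  assumes B: "B \<in> Pops" "small_commutators B" and C: "C \<in> Pops" "opn C \<le> c"
    and K: "(C \<circ> B) - id_op p \<in> compacts" and lim: "is_limit_op p B h L" and x: "x \<in> lp"
  shows "\<parallel>x\<parallel> \<le> c * \<parallel>L x\<parallel>"
proof -
  note Bo = Pops_ops[OF B(1)] and Co = Pops_ops[OF C(1)] and Lo = is_limit_opD(1)[OF lim]
  note Ko = compactD(1)[OF K]
  have c: "0 \<le> c" using opn_nonneg[OF Co] C(2) by linarith
  have fin: "\<parallel>u\<parallel> \<le> c * \<parallel>L u\<parallel>" if u: "u \<in> lp" "cut m u = u" for u m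
  proof (rule le_of_le_add_small[where M = "(c + 1) * \<parallel>u\<parallel>"])
    fix e :: real assume e: "e > 0"
    obtain l where l: "\<And>x. x \<in> lp \<Longrightarrow> \<parallel>((C \<circ> B) - id_op p) (tail l x)\<parallel> \<le> e * \<parallel>x\<parallel>"
      using compactD(2)[OF K e] by blast
    have "\<forall>\<^sub>F n in sequentially. Suc (m + l) \<le> linf (h n) \<and>
      (\<forall>x\<in>lp. \<parallel>cut m (conj_shift (h n) B x - L x)\<parallel> \<le> e * \<parallel>x\<parallel> \<and> \<parallel>conj_shift (h n) B (cut m x) - L (cut m x)\<parallel> \<le> e * \<parallel>x\<parallel>)"
      by (intro eventually_conj is_limit_opD(2)[OF lim] P_strong_limit_window[OF is_limit_opD(3)[OF lim] e])
    from eventually_happens[OF this] obtain n where n: "m + l < linf (h n)"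
      "\<And>x. x \<in> lp \<Longrightarrow> \<parallel>conj_shift (h n) B (cut m x) - L (cut m x)\<parallel> \<le> e * \<parallel>x\<parallel>"
      by (auto simp: Suc_le_eq)
    let ?B = "conj_shift (h n) B" and ?C = "conj_shift (h n) C"
    note on = conj_shift_ops[OF Bo, of "h n"] conj_shift_ops[OF Co, of "h n"]
    have Bu: "?B u \<in> lp" using ops_mem[OF on(1) u(1)] .
    have "conj_shift (h n) ((C \<circ> B) - id_op p) u = ?C (?B u) - u"
      using u Bo Co by (simp only: conj_shift_diff[OF ops_comp(1)[OF Co Bo] id_op_mem] conj_shift_comp conj_shift_id)
    then have "\<parallel>?C (?B u) - u\<parallel> = \<parallel>((C \<circ> B) - id_op p) (shift_op p (h n) u)\<parallel>"
      using conj_shift_nrm[OF Ko u(1), of "h n"] by simp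
    \<comment> \<open>As u lives in \<open>cube m\<close> and \<open>h n\<close> is beyond m + l,
      the shifted u is its own tail, where C B - I is small.\<close>
    also have "shift_op p (h n) u = tail l (shift_op p (h n) u)"
      using shift_cut_tail[OF u(1) n(1)] u(2) by simp
    also have "\<parallel>((C \<circ> B) - id_op p) (tail l (shift_op p (h n) u))\<parallel> \<le> e * \<parallel>shift_op p (h n) u\<parallel>"
      by (rule l[OF shift_lp[OF u(1)]])
    also have "\<dots> = e * \<parallel>u\<parallel>" using u by (simp add: shift_nrm)
    finally have 1: "\<parallel>?C (?B u) - u\<parallel> \<le> e * \<parallel>u\<parallel>" .
    have 2: "\<parallel>?C (?B u)\<parallel> \<le> c * \<parallel>?B u\<parallel>"
      unfolding conj_shift_nrm[OF Co Bu]
      using opn_bound'[OF Co shift_lp[OF Bu] C(2), of "h n"] unfolding shift_nrm[OF Bu] .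
    have 3: "\<parallel>?B u\<parallel> \<le> \<parallel>L u\<parallel> + e * \<parallel>u\<parallel>"
      using nrm_triangle_sub[OF Bu ops_mem[OF Lo u(1)]] n(2)[OF u(1)] unfolding u(2) by linarith
    have 4: "\<parallel>u\<parallel> \<le> \<parallel>?C (?B u)\<parallel> + \<parallel>?C (?B u) - u\<parallel>"
      using nrm_triangle_sub[OF u(1) ops_mem[OF on(2) Bu]] nrm_diff_commute[of u "?C (?B u)"] by linarith
    have "c * \<parallel>?B u\<parallel> \<le> c * (\<parallel>L u\<parallel> + e * \<parallel>u\<parallel>)" using c 3 by (rule mult_left_mono[rotated])
    then have "\<parallel>u\<parallel> \<le> c * (\<parallel>L u\<parallel> + e * \<parallel>u\<parallel>) + e * \<parallel>u\<parallel>" using 1 2 4 by linarith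
    then show "\<parallel>u\<parallel> \<le> c * \<parallel>L u\<parallel> + e * ((c + 1) * \<parallel>u\<parallel>)" by (simp add: algebra_simps)
  qed
  have sc: "small_commutators L" by (rule small_commutators_limit_op[OF Bo B(2) lim])
  have cutb: "\<parallel>cut m x\<parallel> \<le> c * \<parallel>L x\<parallel>" for m
  proof (rule le_of_le_add_small[where M = "c * \<parallel>x\<parallel>"])
    fix e :: real assume e: "e > 0"
    obtain k0 where k0: "k0 > 0" "\<And>k s x. k0 \<le> k \<Longrightarrow> x \<in> lp \<Longrightarrow> \<parallel>commutator L (\<lambda>i. bump k (i - s)) x\<parallel> \<le> e * \<parallel>x\<parallel>"
      using sc[unfolded small_commutators_def, rule_format, OF e] by blast
    \<comment> \<open>At least m, so that the bump is 1 on \<open>cube m\<close> and the cutoff part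
      of x dominates the window to be estimated.\<close>
    define k where "k = max k0 m"
    have k: "0 < k" "k0 \<le> k" "m \<le> k" using k0 by (auto simp: k_def)
    let ?\<phi> = "rmul (\<lambda>i. bump k (i - 0))"
    have mem: "?\<phi> x \<in> lp" "?\<phi> (L x) \<in> lp" "L (?\<phi> x) \<in> lp" using x Lo by auto
    have "\<parallel>cut m x\<parallel> \<le> \<parallel>?\<phi> x\<parallel>"
    proof (rule lp_solid(2)[OF mem(1)])
      fix i :: "int ^ 'n"
      have "bump k i = 1" if "i \<in> cube m" using that k cube_mono[of m k] by (intro bump_eq_1) auto
      then show "norm (cut m x i) \<le> norm (?\<phi> x i)" by (cases "i \<in> cube m") (auto simp: rmul_apply)
    qed
    also have "\<dots> \<le> c * \<parallel>L (?\<phi> x)\<parallel>" by (rule fin[OF mem(1) bump_support_cut[OF k(1)]])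
    also have "\<dots> \<le> c * (\<parallel>L x\<parallel> + e * \<parallel>x\<parallel>)"
    proof (rule mult_left_mono[OF _ c])
      show "\<parallel>L (?\<phi> x)\<parallel> \<le> \<parallel>L x\<parallel> + e * \<parallel>x\<parallel>"
        using nrm_triangle_sub[OF mem(3,2)] k0(2)[OF k(2) x, of 0] rmul_bump_le[OF ops_mem[OF Lo x], of k 0]
        by linarith
    qed
    finally show "\<parallel>cut m x\<parallel> \<le> c * \<parallel>L x\<parallel> + e * (c * \<parallel>x\<parallel>)" by (simp add: algebra_simps)
  qed
  show ?thesis
    by (rule lp_Fatou(2)[OF _ cutb]) (use c nrm_nonneg[OF ops_mem[OF Lo x]] x lp_finite_gt in auto)
qed

text \<open>The sequence \<open>X n\<close> solves L x = y asymptotically on each window. The lower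
  bound for L, localised by cutoff functions, upgrades this to coordinatewise convergence of
  \<open>X n\<close> itself. The norm of C enters only through boundedness of \<open>X n\<close>, so
  any c bounding it serves.\<close>

lemma limit_op_surjective:
  fixes y :: "('n::finite, 'x::complex_banach) seq"
  assumes B: "B \<in> Pops" "small_commutators B" and C: "C \<in> Pops" "opn C \<le> c"
    and K: "(C \<circ> B) - id_op p \<in> compacts" and K': "(B \<circ> C) - id_op p \<in> compacts"
    and lim: "is_limit_op p B h L" and y: "y \<in> lp"
  shows "\<exists>x\<in>lp. L x = y"
proof -
  note Bo = Pops_ops[OF B(1)] and Co = Pops_ops[OF C(1)] and Lo = is_limit_opD(1)[OF lim]
  note Ko = compactD(1)[OF K']
  note low = limit_op_lower_bound[OF B C K lim]
  have c: "0 \<le> c" using opn_nonneg[OF Co] C(2) by linarith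
  have yy: "0 \<le> \<parallel>y\<parallel>" using y by (rule nrm_nonneg)
  define X where "X = (\<lambda>n. conj_shift (h n) C y)"
  have X: "X n \<in> lp" for n unfolding X_def using ops_mem[OF conj_shift_ops[OF Co] y] .
  have LX: "L (X n) \<in> lp" for n using Lo X by simp
  have Xb: "\<parallel>X n\<parallel> \<le> c * \<parallel>y\<parallel>" for n
    unfolding X_def conj_shift_nrm[OF Co y]
    using opn_bound'[OF Co shift_lp[OF y] C(2), of "h n"] shift_nrm[OF y, of "h n"] by simp
  \<comment> \<open>The conjugated equation has the error (B C - I), which a far shifted window sees
    only through its tail; replacing the conjugate of B by L costs the closeness on the output
    window. The convergence is local and in general not in norm.\<close>
  have ev: "\<forall>\<^sub>F n in sequentially. \<parallel>cut m (L (X n) - y)\<parallel> \<le> e" if "e > 0" for m e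
  proof -
    \<comment> \<open>The two errors add up to
      \<open>d * ((c + 1) * \<parallel>y\<parallel>)\<close>; the summand 1 in the denominator
      covers y = 0.\<close>
    define d where "d = e / ((c + 1) * \<parallel>y\<parallel> + 1)"
    have den: "0 < (c + 1) * \<parallel>y\<parallel> + 1" using c yy by (intro add_nonneg_pos mult_nonneg_nonneg) auto
    then have d: "d > 0" "d * ((c + 1) * \<parallel>y\<parallel>) \<le> e" using that
      by (auto simp: d_def field_simps)
    obtain l where l: "\<And>x. x \<in> lp \<Longrightarrow> \<parallel>tail l (((B \<circ> C) - id_op p) x)\<parallel> \<le> d * \<parallel>x\<parallel>"
      using compactD(2)[OF K' d(1)] by blast
    have "\<forall>\<^sub>F n in sequentially. Suc (m + l) \<le> linf (h n) \<and>
      (\<forall>x\<in>lp. \<parallel>cut m (conj_shift (h n) B x - L x)\<parallel> \<le> d * \<parallel>x\<parallel> \<and> \<parallel>conj_shift (h n) B (cut m x) - L (cut m x)\<parallel> \<le> d * \<parallel>x\<parallel>)"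
      by (intro eventually_conj is_limit_opD(2)[OF lim] P_strong_limit_window[OF is_limit_opD(3)[OF lim] d(1)])
    then show ?thesis
    proof eventually_elim
      fix n
      let ?B = "conj_shift (h n) B"
      assume n: "Suc (m + l) \<le> linf (h n) \<and>
        (\<forall>x\<in>lp. \<parallel>cut m (?B x - L x)\<parallel> \<le> d * \<parallel>x\<parallel> \<and> \<parallel>?B (cut m x) - L (cut m x)\<parallel> \<le> d * \<parallel>x\<parallel>)"
      let ?K = "(B \<circ> C) - id_op p"
      have BX: "?B (X n) \<in> lp" using ops_mem[OF conj_shift_ops[OF Bo] X] .
      have "conj_shift (h n) ?K y = ?B (X n) - y"
        unfolding X_def using y Bo Co
        by (simp only: conj_shift_diff[OF ops_comp(1)[OF Bo Co] id_op_mem] conj_shift_comp conj_shift_id)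
      then have 1: "cut m (?B (X n) - y) = cut m (shift_op p (- h n) (?K (shift_op p (h n) y)))"
        by simp
      have "\<parallel>cut m (shift_op p (- h n) (?K (shift_op p (h n) y)))\<parallel> \<le> \<parallel>tail l (?K (shift_op p (h n) y))\<parallel>"
        by (rule cut_shift_le[OF ops_mem[OF Ko shift_lp[OF y]]]) (use n in auto)
      also have "\<dots> \<le> d * \<parallel>shift_op p (h n) y\<parallel>" by (rule l[OF shift_lp[OF y]])
      finally have 2: "\<parallel>cut m (?B (X n) - y)\<parallel> \<le> d * \<parallel>y\<parallel>" unfolding 1 shift_nrm[OF y] .
      have "\<parallel>cut m (?B (X n) - L (X n))\<parallel> \<le> d * \<parallel>X n\<parallel>" using n X by blast
      also have "\<dots> \<le> d * (c * \<parallel>y\<parallel>)" using d Xb by (intro mult_left_mono) auto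
      finally have 3: "\<parallel>cut m (?B (X n) - L (X n))\<parallel> \<le> d * (c * \<parallel>y\<parallel>)" .
      have eq: "cut m (L (X n) - y) = cut m (?B (X n) - y) - cut m (?B (X n) - L (X n))"
        unfolding rmul_diff by simp
      have "\<parallel>cut m (L (X n) - y)\<parallel> = \<parallel>cut m (?B (X n) - y) - cut m (?B (X n) - L (X n))\<parallel>"
        by (rule arg_cong[OF eq])
      also have "\<dots> \<le> \<parallel>cut m (?B (X n) - y)\<parallel> + \<parallel>cut m (?B (X n) - L (X n))\<parallel>"
        by (rule lp_diff_mem(2)) auto
      also have "\<dots> \<le> d * \<parallel>y\<parallel> + d * (c * \<parallel>y\<parallel>)" using 2 3 by (rule add_mono)
      also have "\<dots> = d * ((c + 1) * \<parallel>y\<parallel>)" by (simp add: algebra_simps)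
      finally show "\<parallel>cut m (L (X n) - y)\<parallel> \<le> e" using d(2) by linarith
    qed
  qed
  have sc: "small_commutators L" by (rule small_commutators_limit_op[OF Bo B(2) lim])
  \<comment> \<open>Local form of the lower bound: the part of u under the bump is controlled by L u
    under the same bump, up to a commutator.\<close>
  have bump_low: "\<parallel>rmul (\<lambda>i. bump k (i - 0)) u\<parallel> \<le> c * (e * \<parallel>u\<parallel> + \<parallel>rmul (\<lambda>i. bump k (i - 0)) (L u)\<parallel>)"
    if "\<parallel>commutator L (\<lambda>i. bump k (i - 0)) u\<parallel> \<le> e * \<parallel>u\<parallel>" "u \<in> lp" for k e u
  proof -
    have "\<parallel>rmul (\<lambda>i. bump k (i - 0)) u\<parallel> \<le> c * \<parallel>L (rmul (\<lambda>i. bump k (i - 0)) u)\<parallel>"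
      using that(2) by (intro low rmul_bump)
    also have "\<dots> \<le> c * (e * \<parallel>u\<parallel> + \<parallel>rmul (\<lambda>i. bump k (i - 0)) (L u)\<parallel>)"
    proof (rule mult_left_mono[OF _ c])
      have "L (rmul (\<lambda>i. bump k (i - 0)) u) \<in> lp" "rmul (\<lambda>i. bump k (i - 0)) (L u) \<in> lp"
        using that(2) Lo by auto
      from nrm_triangle_sub[OF this] show "\<parallel>L (rmul (\<lambda>i. bump k (i - 0)) u)\<parallel> \<le> e * \<parallel>u\<parallel> + \<parallel>rmul (\<lambda>i. bump k (i - 0)) (L u)\<parallel>"
        using that(1) by linarith
    qed
    finally show ?thesis .
  qed
  have bump_le_cut: "\<parallel>rmul (\<lambda>i. bump k (i - 0)) u\<parallel> \<le> \<parallel>cut (2 * k) u\<parallel>" if "0 < k" "u \<in> lp" for k u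
    using rmul_bump_le[of "cut (2 * k) u" k 0] bump_cut[OF that(1), of 0 u] by simp
  have cau: "Cauchy (\<lambda>n. X n i)" for i
  proof (rule CauchyI)
    fix r :: real assume r: "r > 0"
    \<comment> \<open>Chosen so that the final estimate c (e 2c \<parallel>y\<parallel> + 2e) equals
      e (M - 1), which is less than r = e M.\<close>
    define M where "M = c * (2 * c * \<parallel>y\<parallel> + 2) + 1"
    have M: "M > 0" unfolding M_def using c yy by (intro add_nonneg_pos mult_nonneg_nonneg add_nonneg_nonneg) auto
    define e where "e = r / M"
    have e: "e > 0" "e * M = r" using M r by (auto simp: e_def)
    obtain k0 where k0: "k0 > 0" "\<And>k s x. k0 \<le> k \<Longrightarrow> x \<in> lp \<Longrightarrow> \<parallel>commutator L (\<lambda>i. bump k (i - s)) x\<parallel> \<le> e * \<parallel>x\<parallel>"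
      using sc[unfolded small_commutators_def, rule_format, OF e(1)] by blast
    define k where "k = max k0 (linf i)"
    have k: "0 < k" "k0 \<le> k" "i \<in> cube k" using k0 by (auto simp: k_def mem_cube_iff)
    obtain n0 where n0: "\<And>n. n0 \<le> n \<Longrightarrow> \<parallel>cut (2 * k) (L (X n) - y)\<parallel> \<le> e"
      using ev[OF e(1), of "2 * k"] by (auto simp: eventually_sequentially)
    have "norm (X n i - X l i) < r" if "n0 \<le> n" "n0 \<le> l" for n l
    proof -
      let ?u = "X n - X l" and ?\<phi> = "rmul (\<lambda>i. bump k (i - 0))"
      have u: "?u \<in> lp" "\<parallel>?u\<parallel> \<le> 2 * c * \<parallel>y\<parallel>"
        using lp_diff_mem[OF X[of n] X[of l]] Xb[of n] Xb[of l] by auto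
      have Lu: "L ?u \<in> lp" using Lo u by simp
      have "norm (X n i - X l i) = norm (?\<phi> ?u i)" using k by (simp add: rmul_apply bump_eq_1 fun_apply)
      also have "\<dots> \<le> \<parallel>?\<phi> ?u\<parallel>" using u by (intro norm_coord_le rmul_bump)
      also have "\<dots> \<le> c * (e * \<parallel>?u\<parallel> + \<parallel>?\<phi> (L ?u)\<parallel>)" using k0(2)[OF k(2) u(1)] u(1) by (rule bump_low)
      also have "\<dots> \<le> c * (e * (2 * c * \<parallel>y\<parallel>) + 2 * e)"
      proof (intro mult_left_mono[OF _ c] add_mono)
        show "e * \<parallel>?u\<parallel> \<le> e * (2 * c * \<parallel>y\<parallel>)" using u e by (intro mult_left_mono) auto
        have eq: "cut (2 * k) (L ?u) = cut (2 * k) (L (X n) - y) - cut (2 * k) (L (X l) - y)"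
          unfolding ops_diff[OF Lo X X] rmul_diff by simp
        have "\<parallel>?\<phi> (L ?u)\<parallel> \<le> \<parallel>cut (2 * k) (L ?u)\<parallel>" using k Lu by (intro bump_le_cut)
        also have "\<dots> = \<parallel>cut (2 * k) (L (X n) - y) - cut (2 * k) (L (X l) - y)\<parallel>" by (rule arg_cong[OF eq])
        also have "\<dots> \<le> \<parallel>cut (2 * k) (L (X n) - y)\<parallel> + \<parallel>cut (2 * k) (L (X l) - y)\<parallel>"
          by (rule lp_diff_mem(2)) auto
        finally show "\<parallel>?\<phi> (L ?u)\<parallel> \<le> 2 * e" using n0[OF that(1)] n0[OF that(2)] by linarith
      qed
      also have "\<dots> = e * (M - 1)" by (simp add: M_def algebra_simps)
      also have "\<dots> < r" using e by (simp add: algebra_simps)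
      finally show ?thesis .
    qed
    then show "\<exists>M. \<forall>m\<ge>M. \<forall>n\<ge>M. norm (X m i - X n i) < r" by blast
  qed
  then have "\<exists>x. (\<lambda>n. X n i) \<longlonglongrightarrow> x" for i by (simp add: Cauchy_convergent_iff convergent_def)
  then obtain x where x: "\<And>i. (\<lambda>n. X n i) \<longlonglongrightarrow> x i" by metis
  have cl: "(\<lambda>n. \<parallel>cut m (x - X n)\<parallel>) \<longlonglongrightarrow> 0" for m
    using x by (intro nrm_tendsto_0_cube) (auto intro!: tendsto_eq_intros simp: fun_apply)
  have cutx: "\<parallel>cut m x\<parallel> \<le> c * \<parallel>y\<parallel>" for m
  proof (rule field_le_epsilon)
    fix e :: real assume "e > 0"
    then obtain n where n: "\<parallel>cut m (x - X n)\<parallel> < e"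
      using eventually_happens[OF order_tendstoD(2)[OF cl, of e m]] by auto
    have "\<parallel>cut m x\<parallel> \<le> \<parallel>cut m (X n)\<parallel> + \<parallel>cut m (x - X n)\<parallel>"
      unfolding rmul_diff by (rule nrm_triangle_sub) auto
    then show "\<parallel>cut m x\<parallel> \<le> c * \<parallel>y\<parallel> + e" using n lp_ind(2)[OF X, of "cube m" n] Xb[of n] by linarith
  qed
  \<comment> \<open>A coordinatewise limit of null sequences need not vanish at infinity. The cube
    is chosen such that y is at most e outside of it; applying the lower bound to \<open>X n\<close>
    on an annulus around that cube bounds the coordinates beyond twice its radius.\<close>
  have decay: "\<forall>r>0. finite {i. norm (x i) > r}" if p0: "p = 0"
  proof (intro allI impI)
    fix r :: real assume r: "r > 0"
    define M where "M = c * (2 * c * \<parallel>y\<parallel> + 2) + 1"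
    have M: "M > 0" unfolding M_def using c yy by (intro add_nonneg_pos mult_nonneg_nonneg add_nonneg_nonneg) auto
    define e where "e = r / M"
    have e: "e > 0" "e * M = r" using M r by (auto simp: e_def)
    obtain k0 where k0: "k0 > 0" "\<And>k s x. k0 \<le> k \<Longrightarrow> x \<in> lp \<Longrightarrow> \<parallel>commutator L (\<lambda>i. bump k (i - s)) x\<parallel> \<le> e * \<parallel>x\<parallel>"
      using sc[unfolded small_commutators_def, rule_format, OF e(1)] by blast
    obtain R where R: "{i. norm (y i) > e} \<subseteq> cube R"
      using finite_subset_cube[OF lp_finite_gt[OF y p0 e(1)]] by blast
    define k where "k = max k0 R"
    have k: "0 < k" "k0 \<le> k" "R \<le> k" using k0 by (auto simp: k_def)
    have taily: "\<parallel>tail k y\<parallel> \<le> e"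
    proof -
      have "norm (tail k y i) \<le> e" for i
        using R cube_mono[OF k(3)] e(1) by (cases "i \<in> cube k") (auto simp: rmul_apply not_less[symmetric])
      then show ?thesis unfolding lp_norm_def using p0 by (auto intro!: cSUP_least)
    qed
    have "norm (x i) \<le> r" if i: "i \<notin> cube (2 * k)" for i
    proof (rule tendsto_upperbound)
      show "(\<lambda>n. norm (X n i)) \<longlonglongrightarrow> norm (x i)" by (intro tendsto_norm x)
      \<comment> \<open>The outer radius depends on the coordinate i: the outer bump is 1 at i, the
        inner one is 0 there, so their difference \<open>?G\<close> keeps the coordinate i of
        \<open>X n\<close> and removes the region \<open>cube k\<close>. Only k must be independent
        of i.\<close>
      define l where "l = max k (linf i)"
      have l: "0 < l" "k \<le> l" "k0 \<le> l" "i \<in> cube l" using k by (auto simp: l_def mem_cube_iff)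
      let ?\<phi> = "\<lambda>k. rmul (\<lambda>i. bump k (i - 0))"
      let ?G = "\<lambda>u. ?\<phi> l u - ?\<phi> k u"
      have Gn: "norm (?G u j) \<le> norm (cut (2 * l) (tail k u) j)" for u :: "('n, 'x) seq" and j
      proof -
        have "j \<notin> cube (2 * k)" if "j \<notin> cube (2 * l)" using that l by (auto simp: mem_cube_iff)
        moreover have "j \<in> cube l" if "j \<in> cube k" using that l by (auto simp: mem_cube_iff)
        ultimately have "\<bar>bump l j - bump k j\<bar> \<le> indicat_real (cube (2 * l)) j * indicat_real (- cube k) j"
          using bump_eq_0[OF l(1), of j] bump_eq_0[OF k(1), of j] bump_eq_1[OF l(1), of j] bump_eq_1[OF k(1), of j]
            bump_bounds[of l j] bump_bounds[of k j]
          by (auto simp: indicator_def abs_le_iff)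
        from mult_right_mono[OF this, of "norm (u j)"] show ?thesis
          by (simp add: rmul_apply fun_apply scaleR_diff_left[symmetric] abs_mult mult.assoc)
      qed
      have Gle: "\<parallel>?G u\<parallel> \<le> \<parallel>cut (2 * l) (tail k u)\<parallel>" for u :: "('n, 'x) seq"
        by (rule lp_solid(2)[OF lp_cut Gn])
      have "\<forall>\<^sub>F n in sequentially. \<parallel>cut (2 * l) (L (X n) - y)\<parallel> \<le> e" by (rule ev[OF e(1)])
      then show "\<forall>\<^sub>F n in sequentially. norm (X n i) \<le> r"
      proof eventually_elim
        fix n assume n: "\<parallel>cut (2 * l) (L (X n) - y)\<parallel> \<le> e"
        have mem: "?\<phi> l (X n) \<in> lp" "?\<phi> k (X n) \<in> lp" "?\<phi> l (L (X n)) \<in> lp" "?\<phi> k (L (X n)) \<in> lp"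
          "L (?\<phi> l (X n)) \<in> lp" "L (?\<phi> k (X n)) \<in> lp"
          using X Lo LX by auto
        have "norm (X n i) = norm (?G (X n) i)"
          using i l k by (simp add: rmul_apply fun_apply bump_eq_1 bump_eq_0)
        also have "\<dots> \<le> \<parallel>?G (X n)\<parallel>" using mem by (intro norm_coord_le lp_diff_mem)
        also have "\<dots> \<le> c * \<parallel>L (?G (X n))\<parallel>" using mem by (intro low lp_diff_mem)
        also have "\<dots> \<le> c * (2 * (e * (c * \<parallel>y\<parallel>)) + 2 * e)"
        proof (rule mult_left_mono[OF _ c])
          \<comment> \<open>Moving L past the difference of two bumps produces two commutators and
            the annular part of L (X n), which is close to the small annular part of y.\<close>
          have eq: "L (?G (X n)) = (commutator L (\<lambda>i. bump l (i - 0)) (X n) - commutator L (\<lambda>i. bump k (i - 0)) (X n))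
              + ?G (L (X n))"
            using mem by (simp add: ops_diff[OF Lo])
          have "\<parallel>L (?G (X n))\<parallel> = \<parallel>(commutator L (\<lambda>i. bump l (i - 0)) (X n) - commutator L (\<lambda>i. bump k (i - 0)) (X n))
              + ?G (L (X n))\<parallel>" by (rule arg_cong[OF eq])
          also have "\<dots> \<le> \<parallel>commutator L (\<lambda>i. bump l (i - 0)) (X n) - commutator L (\<lambda>i. bump k (i - 0)) (X n)\<parallel> + \<parallel>?G (L (X n))\<parallel>"
            using mem by (intro lp_add_mem(2) lp_diff_mem(1))
          finally have 1: "\<parallel>L (?G (X n))\<parallel> \<le> \<parallel>commutator L (\<lambda>i. bump l (i - 0)) (X n) - commutator L (\<lambda>i. bump k (i - 0)) (X n)\<parallel> + \<parallel>?G (L (X n))\<parallel>" .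
          have 2: "\<parallel>commutator L (\<lambda>i. bump l (i - 0)) (X n) - commutator L (\<lambda>i. bump k (i - 0)) (X n)\<parallel>
              \<le> \<parallel>commutator L (\<lambda>i. bump l (i - 0)) (X n)\<parallel> + \<parallel>commutator L (\<lambda>i. bump k (i - 0)) (X n)\<parallel>"
            using mem by (intro lp_diff_mem)
          have 3: "e * \<parallel>X n\<parallel> \<le> e * (c * \<parallel>y\<parallel>)" using e Xb by (intro mult_left_mono) auto
          have 4: "\<parallel>?G (L (X n))\<parallel> \<le> 2 * e"
          proof -
            have eq: "cut (2 * l) (tail k (L (X n))) = tail k (cut (2 * l) (L (X n) - y)) + cut (2 * l) (tail k y)"
              by (auto simp: rmul_def fun_eq_iff fun_apply algebra_simps)
            have "\<parallel>?G (L (X n))\<parallel> \<le> \<parallel>cut (2 * l) (tail k (L (X n)))\<parallel>" by (rule Gle)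
            also have "\<dots> = \<parallel>tail k (cut (2 * l) (L (X n) - y)) + cut (2 * l) (tail k y)\<parallel>" by (rule arg_cong[OF eq])
            also have "\<dots> \<le> \<parallel>tail k (cut (2 * l) (L (X n) - y))\<parallel> + \<parallel>cut (2 * l) (tail k y)\<parallel>"
              by (rule lp_add_mem(2)) auto
            finally show ?thesis
              using lp_ind(2)[OF lp_cut, of "- cube k" "2 * l" "L (X n) - y"] n
                lp_ind(2)[OF lp_ind(1)[OF y], of "cube (2 * l)" "- cube k"] taily by linarith
          qed
          show "\<parallel>L (?G (X n))\<parallel> \<le> 2 * (e * (c * \<parallel>y\<parallel>)) + 2 * e"
            using 1 2 3 4 k0(2)[OF l(3) X[of n], of 0] k0(2)[OF k(2) X[of n], of 0] by linarith
        qed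
        also have "\<dots> = e * (M - 1)" by (simp add: M_def algebra_simps)
        also have "\<dots> \<le> r" using e by (simp add: algebra_simps)
        finally show "norm (X n i) \<le> r" .
      qed
    qed simp
    then have "{i. norm (x i) > r} \<subseteq> cube (2 * k)" by force
    then show "finite {i. norm (x i) > r}" using finite_cube finite_subset by blast
  qed
  have xlp: "x \<in> lp" "\<parallel>x\<parallel> \<le> c * \<parallel>y\<parallel>"
    using lp_Fatou[OF _ cutx decay] c yy by auto
  have Lx: "L x \<in> lp" using Lo xlp by simp
  \<comment> \<open>\<open>X n\<close> tends to x only on windows, so L (x - X n) is split: the
    window part is small by boundedness of L, the tail part by \<open>limit_op_cut_tail\<close>. The
    three summands of M are the three error factors.\<close>
  have zero: "\<parallel>cut m (L x - y)\<parallel> \<le> 0" for m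
  proof (rule le_of_le_add_small[where M = "1 + opn L + 2 * c * \<parallel>y\<parallel>"])
    fix e :: real assume e: "e > 0"
    obtain l where l: "\<And>x. x \<in> lp \<Longrightarrow> \<parallel>cut m (L (tail l x))\<parallel> \<le> e * \<parallel>x\<parallel>"
      using limit_op_cut_tail[OF B(1) lim e] by blast
    have "\<forall>\<^sub>F n in sequentially. \<parallel>cut m (L (X n) - y)\<parallel> \<le> e \<and> \<parallel>cut l (x - X n)\<parallel> < e"
      by (intro eventually_conj ev[OF e] order_tendstoD(2)[OF cl e])
    from eventually_happens[OF this] obtain n where n: "\<parallel>cut m (L (X n) - y)\<parallel> \<le> e" "\<parallel>cut l (x - X n)\<parallel> < e"
      by auto
    have d: "x - X n \<in> lp" "\<parallel>x - X n\<parallel> \<le> 2 * c * \<parallel>y\<parallel>"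
      using lp_diff_mem[OF xlp(1) X[of n]] xlp(2) Xb[of n] by auto
    have Ls: "L x - L (X n) = L (cut l (x - X n)) + L (tail l (x - X n))"
    proof -
      have "L (cut l (x - X n)) + L (tail l (x - X n)) = L (cut l (x - X n) + tail l (x - X n))"
        by (rule ops_add[OF Lo, symmetric]) (use d in auto)
      then show ?thesis unfolding cut_plus_tail using ops_diff[OF Lo xlp(1) X] by simp
    qed
    have eq: "cut m (L x - y) = cut m (L (X n) - y) + (cut m (L (cut l (x - X n))) + cut m (L (tail l (x - X n))))"
      unfolding rmul_add[symmetric] Ls[symmetric] by simp
    have "\<parallel>cut m (L x - y)\<parallel> = \<parallel>cut m (L (X n) - y) + (cut m (L (cut l (x - X n))) + cut m (L (tail l (x - X n))))\<parallel>"
      by (rule arg_cong[OF eq])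
    also have "\<dots> \<le> \<parallel>cut m (L (X n) - y)\<parallel> + \<parallel>cut m (L (cut l (x - X n))) + cut m (L (tail l (x - X n)))\<parallel>"
      by (rule lp_add_mem(2)) auto
    finally have 1: "\<parallel>cut m (L x - y)\<parallel> \<le> \<parallel>cut m (L (X n) - y)\<parallel> + \<parallel>cut m (L (cut l (x - X n))) + cut m (L (tail l (x - X n)))\<parallel>" .
    have 2: "\<parallel>cut m (L (cut l (x - X n))) + cut m (L (tail l (x - X n)))\<parallel>
        \<le> \<parallel>cut m (L (cut l (x - X n)))\<parallel> + \<parallel>cut m (L (tail l (x - X n)))\<parallel>"
      by (rule lp_add_mem(2)) auto
    have "\<parallel>cut m (L (cut l (x - X n)))\<parallel> \<le> \<parallel>L (cut l (x - X n))\<parallel>" using Lo by (intro lp_ind) auto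
    also have "\<dots> \<le> opn L * \<parallel>cut l (x - X n)\<parallel>" by (rule opn_bound[OF Lo lp_cut])
    also have "\<dots> \<le> opn L * e" using n opn_nonneg[OF Lo] by (intro mult_left_mono) auto
    finally have 3: "\<parallel>cut m (L (cut l (x - X n)))\<parallel> \<le> opn L * e" .
    have "\<parallel>cut m (L (tail l (x - X n)))\<parallel> \<le> e * \<parallel>x - X n\<parallel>" by (rule l[OF d(1)])
    also have "\<dots> \<le> e * (2 * c * \<parallel>y\<parallel>)" using d e by (intro mult_left_mono) auto
    finally have 4: "\<parallel>cut m (L (tail l (x - X n)))\<parallel> \<le> e * (2 * c * \<parallel>y\<parallel>)" .
    show "\<parallel>cut m (L x - y)\<parallel> \<le> 0 + e * (1 + opn L + 2 * c * \<parallel>y\<parallel>)"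
      using 1 2 3 4 n(1) by (simp add: algebra_simps)
  qed
  have "L x = y"
  proof
    fix i :: "int ^ 'n"
    have "cut (linf i) (L x - y) = 0" by (rule nrm_eq_0D[OF lp_cut zero])
    then have "cut (linf i) (L x - y) i = 0" by (simp add: fun_apply)
    then show "L x i = y i" by (simp add: rmul_apply mem_cube_iff fun_apply)
  qed
  then show ?thesis using xlp by blast
qed

end


section \<open>Inversion modulo the ideal from the inverses of limit operators\<close>

definition tile :: "nat \<Rightarrow> int ^ 'n::finite \<Rightarrow> int ^ 'n" where
  "tile k i = (\<chi> j. i $ j div int k)"

text \<open>For k > 0 the tile \<alpha> consists of the points whose offset from this corner has
  entries in [0, k), so the bump centred at the corner is 1 on the whole tile.\<close>

definition corner :: "nat \<Rightarrow> int ^ 'n::finite \<Rightarrow> int ^ 'n" where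
  "corner k \<alpha> = (\<chi> j. int k * \<alpha> $ j)"

lemma corner_add: "corner k (\<alpha> + \<beta>) = corner k \<alpha> + corner k \<beta>"
  by (simp add: corner_def vec_eq_iff algebra_simps)

lemma linf_corner: "linf (corner k \<alpha>) = k * linf \<alpha>"
proof (rule antisym)
  show "linf (corner k \<alpha>) \<le> k * linf \<alpha>"
    unfolding linf_le_iff corner_def
    using abs_le_linf[of \<alpha>] by (auto simp: abs_mult intro: mult_left_mono)
  show "k * linf \<alpha> \<le> linf (corner k \<alpha>)"
  proof (cases "k = 0")
    case False
    have "int k * \<bar>\<alpha> $ j\<bar> \<le> int (linf (corner k \<alpha>))" for j
      using abs_le_linf[of "corner k \<alpha>" j] by (simp add: corner_def abs_mult)
    then have "\<bar>\<alpha> $ j\<bar> \<le> int (linf (corner k \<alpha>)) div int k" for j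
      using False by (metis of_nat_0_less_iff gr0I nonzero_mult_div_cancel_left of_nat_0_eq_iff zdiv_mono1)
    then have "linf \<alpha> \<le> linf (corner k \<alpha>) div k"
      unfolding linf_le_iff by (simp add: zdiv_int)
    then show ?thesis by (metis mult.commute mult_le_mono2 order_trans div_times_less_eq_dividend)
  qed simp
qed

lemma corner_tile: "0 < k \<Longrightarrow> i - corner k (tile k i) \<in> cube k"
  unfolding cube_def
proof (intro CollectI allI)
  fix j assume "0 < k"
  have "i $ j - int k * (i $ j div int k) = i $ j mod int k" by (simp add: minus_mult_div_eq_mod)
  moreover have "0 \<le> i $ j mod int k" "i $ j mod int k < int k" using \<open>0 < k\<close> by auto
  ultimately show "(i - corner k (tile k i)) $ j \<in> {- int k..int k}" by (auto simp: corner_def tile_def)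
qed

lemma div_le_div_add:
  fixes a b c k :: int
  assumes "0 < k" "a \<le> b + c * k" shows "a div k \<le> b div k + c"
  using zdiv_mono1[OF assms(2,1)] assms(1) by simp

lemma tile_near:
  assumes "0 < k" "linf (i - j) \<le> k" shows "linf (tile k i - tile k j) \<le> 1"
  unfolding linf_le_iff
proof
  fix m
  have "\<bar>i $ m - j $ m\<bar> \<le> int k" using assms(2) by (auto simp: linf_le_iff)
  then have "i $ m div int k \<le> j $ m div int k + 1" "j $ m div int k \<le> i $ m div int k + 1"
    using assms(1) by (auto intro!: div_le_div_add simp del: div_mult_self1)
  then have "\<bar>i $ m div int k - j $ m div int k\<bar> \<le> 1" by linarith
  then show "\<bar>(tile k i - tile k j) $ m\<bar> \<le> int 1" by (simp add: tile_def)
qed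

text \<open>The bump about a corner has radius 2k and hence meets only tiles at index distance at
  most 2; this is the radius 2 required in \<open>block_sum_compose\<close>.\<close>

lemma bump_tile:
  assumes "0 < k" "bump k (i - corner k \<alpha>) \<noteq> 0" shows "linf (\<alpha> - tile k i) \<le> 2"
  unfolding linf_le_iff
proof
  fix m
  have "linf (i - corner k \<alpha>) \<le> 2 * k" using bump_eq_0[of k "i - corner k \<alpha>"] assms by (auto simp: mem_cube_iff)
  then have "\<bar>i $ m - int k * \<alpha> $ m\<bar> \<le> 2 * int k" by (auto simp: linf_le_iff corner_def)
  then have "i $ m \<le> 0 + (\<alpha> $ m + 2) * int k" "0 \<le> i $ m + (2 - \<alpha> $ m) * int k"
    by (simp_all add: algebra_simps)
  then have "(i $ m) div int k \<le> 0 div int k + (\<alpha> $ m + 2)" "0 div int k \<le> (i $ m) div int k + (2 - \<alpha> $ m)"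
    using assms(1) by (intro div_le_div_add; simp)+
  then show "\<bar>(\<alpha> - tile k i) $ m\<bar> \<le> int 2" by (simp add: tile_def abs_le_iff)
qed

abbreviation on_tile :: "nat \<Rightarrow> int ^ 'n::finite \<Rightarrow> (int ^ 'n \<Rightarrow> 'x::real_vector) \<Rightarrow> int ^ 'n \<Rightarrow> 'x" where
  "on_tile k \<alpha> \<equiv> rmul (indicat_real {i. tile k i = \<alpha>})"

lemma finite_tile: "0 < k \<Longrightarrow> finite {i. tile k i = \<alpha>}"
proof -
  assume k: "0 < k"
  have "{i. tile k i = \<alpha>} \<subseteq> (\<lambda>i. i + corner k \<alpha>) ` cube k"
  proof
    fix i assume "i \<in> {i. tile k i = \<alpha>}"
    then show "i \<in> (\<lambda>i. i + corner k \<alpha>) ` cube k"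
      using corner_tile[OF k, of i] by (intro image_eqI[of _ _ "i - corner k \<alpha>"]) auto
  qed
  then show ?thesis by (rule finite_subset) simp
qed

text \<open>
  The block sum \<open>\<Sum>\<^sub>\<alpha> S\<^sub>\<alpha> \<chi>\<^sub>\<alpha>\<close> over the tiles, where only the tiles \<open>\<alpha>\<close> at distance at most 3 contribute
  to a coordinate. The radius 3 leaves room for composing local operators of radius 2 with an
  operator of propagation at most \<open>k\<close>.
\<close>

definition block_sum :: "nat \<Rightarrow> (int ^ 'n::finite \<Rightarrow> ('n, 'x::complex_banach) oper) \<Rightarrow> ('n, 'x) oper" where
  "block_sum k S x = (\<lambda>i. \<Sum>\<beta>\<in>cube 3. S (tile k i + \<beta>) (on_tile k (tile k i + \<beta>) x) i)"

section \<open>Block sums of local operators over a tiling\<close>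

context lp_exponent
begin

text \<open>Each coordinate lies in exactly one tile, so the inner size over the tiles is
  \<open>norm (x i)\<close> and interchanging the sizes gives the claim.\<close>

lemma tile_decomposition:
  fixes x :: "('n::finite, 'x::complex_banach) seq"
  assumes x: "x \<in> lp"
  shows "lp_summable p (\<lambda>\<alpha>. \<parallel>on_tile k \<alpha> x\<parallel>)" "lp_size p (\<lambda>\<alpha>. \<parallel>on_tile k \<alpha> x\<parallel>) \<le> \<parallel>x\<parallel>"
proof -
  let ?f = "\<lambda>\<alpha> i. norm (on_tile k \<alpha> x i)"
  have s: "lp_summable p (\<lambda>\<alpha>. ?f \<alpha> i)" "lp_size p (\<lambda>\<alpha>. ?f \<alpha> i) = norm (x i)" for i
    using lp_single[of "\<lambda>\<alpha>. ?f \<alpha> i" "tile k i"] by (auto simp: rmul_apply)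
  have s2: "lp_summable p (\<lambda>i. lp_size p (\<lambda>\<alpha>. ?f \<alpha> i))" unfolding s by (rule lp_summableD[OF x])
  show "lp_summable p (\<lambda>\<alpha>. \<parallel>on_tile k \<alpha> x\<parallel>)" "lp_size p (\<lambda>\<alpha>. \<parallel>on_tile k \<alpha> x\<parallel>) \<le> \<parallel>x\<parallel>"
    using lp_Fubini_le(2,3)[of ?f, OF norm_ge_zero s(1) s2] unfolding s by (auto simp: lp_norm_eq)
qed

text \<open>For one fixed offset \<beta> the pieces belonging to different tiles have disjoint
  supports, so their norms combine to at most \<open>d * \<parallel>x\<parallel>\<close> without
  overlap. The factor \<open>card (cube 3)\<close> only counts the offsets.\<close>

lemma block_sum_bound:
  fixes x :: "('n::finite, 'x::complex_banach) seq"
  assumes k: "0 < k" and x: "x \<in> lp" and d: "0 \<le> d"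
    and S: "\<And>\<alpha> u. u \<in> lp \<Longrightarrow> S \<alpha> u \<in> lp" "\<And>\<alpha> u. u \<in> lp \<Longrightarrow> \<parallel>S \<alpha> u\<parallel> \<le> d * \<parallel>u\<parallel>"
  shows "block_sum k S x \<in> lp"
    and "\<parallel>block_sum k S x\<parallel> \<le> real (card (cube 3 :: (int ^ 'n) set)) * d * \<parallel>x\<parallel>"
proof -
  define z where "z = (\<lambda>\<alpha>. S \<alpha> (on_tile k \<alpha> x))"
  \<comment> \<open>On the tile \<gamma> this is the output of the block \<gamma> + \<beta>; its
    pieces over different \<gamma> do not overlap.\<close>
  define w where "w = (\<lambda>\<beta> i. z (tile k i + \<beta>) i)"
  have z: "z \<alpha> \<in> lp" "\<parallel>z \<alpha>\<parallel> \<le> d * \<parallel>on_tile k \<alpha> x\<parallel>" for \<alpha> using S x by (auto simp: z_def)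
  have w: "w \<beta> \<in> lp \<and> \<parallel>w \<beta>\<parallel> \<le> d * \<parallel>x\<parallel>" for \<beta>
  proof -
    let ?f = "\<lambda>i \<gamma>. norm (on_tile k \<gamma> (z (\<gamma> + \<beta>)) i)"
    let ?g = "\<lambda>\<gamma>. d * \<parallel>on_tile k (\<gamma> + \<beta>) x\<parallel>"
    have b: "bij (\<lambda>\<gamma>. \<gamma> + \<beta>)" by (rule bij_betw_byWitness[of _ "\<lambda>i. i - \<beta>"]) auto
    note td = tile_decomposition[OF x, of k]
    have nn: "0 \<le> \<parallel>on_tile k \<gamma> x\<parallel>" for \<gamma> using x by (intro nrm_nonneg) simp
    note re = lp_reindex[OF nn td(1) b]
    have g: "lp_summable p ?g" "lp_size p ?g \<le> d * \<parallel>x\<parallel>"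
      using lp_mult[OF nn re(1) d] mult_left_mono[OF td(2) d] re(2) by auto
    have s1: "lp_summable p (\<lambda>i. ?f i \<gamma>)" for \<gamma> using lp_summableD[OF lp_ind(1)[OF z(1)]] .
    have fle: "lp_size p (\<lambda>i. ?f i \<gamma>) \<le> ?g \<gamma>" for \<gamma>
      using lp_ind(2)[OF z(1)[of "\<gamma> + \<beta>"], of "{i. tile k i = \<gamma>}"] z(2)[of "\<gamma> + \<beta>"] by (simp add: lp_norm_eq)
    have f0: "0 \<le> lp_size p (\<lambda>i. ?f i \<gamma>)" for \<gamma> by (rule lp_size_nonneg[OF norm_ge_zero s1])
    have s2: "lp_summable p (\<lambda>\<gamma>. lp_size p (\<lambda>i. ?f i \<gamma>))" by (rule lp_summable_mono[OF f0 fle g(1)])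
    have sg: "lp_size p (?f i) = norm (w \<beta> i)" for i
      using lp_single(2)[of "?f i" "tile k i"] by (auto simp: rmul_apply w_def)
    have F: "lp_summable p (\<lambda>i. norm (w \<beta> i))" "lp_size p (\<lambda>i. norm (w \<beta> i)) \<le> lp_size p (\<lambda>\<gamma>. lp_size p (\<lambda>i. ?f i \<gamma>))"
      using lp_Fubini_le(2,3)[of ?f, OF norm_ge_zero s1 s2] unfolding sg by auto
    have bd: "\<parallel>w \<beta>\<parallel> \<le> d * \<parallel>x\<parallel>"
      using F(2) lp_size_mono[OF f0 fle g(1)] g(2) by (simp add: lp_norm_eq)
    have "finite {i. norm (w \<beta> i) > e}" if "p = 0" "e > 0" for e
    proof -
      \<comment> \<open>For p = 0: all but finitely many blocks of x are at most r, and r is chosen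
        with \<open>d * r < e\<close>, the summand 1 allowing d = 0. Large outputs thus come from
        finitely many finite tiles.\<close>
      define r where "r = e / (d + 1)"
      have r: "r > 0" "d * r < e" using that d by (auto simp: r_def field_simps)
      have small: "\<parallel>on_tile k \<alpha> x\<parallel> \<le> r" if "\<alpha> \<notin> tile k ` {j. norm (x j) > r}" for \<alpha>
      proof -
        have "norm (on_tile k \<alpha> x j) \<le> r" for j
        proof (cases "tile k j = \<alpha>")
          case True
          then have "\<not> norm (x j) > r" using that by blast
          then show ?thesis using True by (simp add: rmul_apply)
        next
          case False
          then show ?thesis using r(1) by (simp add: rmul_apply)
        qed
        then show ?thesis unfolding lp_norm_def using \<open>p = 0\<close> by (auto intro: cSUP_least)
      qed
      have "{i. norm (w \<beta> i) > e} \<subseteq> (\<Union>\<alpha>\<in>tile k ` {j. norm (x j) > r}. {i. tile k i = \<alpha> - \<beta>})"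
      proof
        fix i assume i: "i \<in> {i. norm (w \<beta> i) > e}"
        have "tile k i + \<beta> \<in> tile k ` {j. norm (x j) > r}"
        proof (rule ccontr)
          assume "tile k i + \<beta> \<notin> tile k ` {j. norm (x j) > r}"
          then have "d * \<parallel>on_tile k (tile k i + \<beta>) x\<parallel> \<le> d * r" using small d by (intro mult_left_mono) auto
          then have "norm (w \<beta> i) \<le> d * r"
            unfolding w_def using norm_coord_le[OF z(1), of "tile k i + \<beta>" i] z(2)[of "tile k i + \<beta>"] by linarith
          then show False using i r by simp
        qed
        then show "i \<in> (\<Union>\<alpha>\<in>tile k ` {j. norm (x j) > r}. {i. tile k i = \<alpha> - \<beta>})"
          by (intro UN_I[of "tile k i + \<beta>"]) auto
      qed
      moreover have "finite (\<Union>\<alpha>\<in>tile k ` {j. norm (x j) > r}. {i. tile k i = \<alpha> - \<beta>})"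
        using lp_finite_gt[OF x that(1) r(1)] finite_tile[OF k] by auto
      ultimately show ?thesis by (rule finite_subset)
    qed
    then have "w \<beta> \<in> lp" using F(1) lp_iff by blast
    then show ?thesis using bd by simp
  qed
  have eq: "block_sum k S x = (\<Sum>\<beta>\<in>cube 3. w \<beta>)"
  proof
    fix i
    have "(\<Sum>\<beta>\<in>T. w \<beta>) i = (\<Sum>\<beta>\<in>T. w \<beta> i)" if "finite T" for T
      using that
    proof (induction T rule: finite_induct)
      case (insert b T)
      then show ?case unfolding sum.insert[OF insert.hyps] by (simp add: fun_apply)
    qed (simp add: fun_apply)
    then show "block_sum k S x i = (\<Sum>\<beta>\<in>cube 3. w \<beta>) i" by (simp add: block_sum_def w_def z_def)
  qed
  have "(\<Sum>\<beta>\<in>cube 3. w \<beta>) \<in> lp" using w by (intro lp_sum_mem) auto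
  then show "block_sum k S x \<in> lp" by (simp only: eq)
  have "\<parallel>\<Sum>\<beta>\<in>cube 3. w \<beta>\<parallel> \<le> (\<Sum>\<beta>\<in>cube 3. \<parallel>w \<beta>\<parallel>)" using w by (intro lp_sum_mem(2)) auto
  also have "\<dots> \<le> (\<Sum>\<beta>\<in>(cube 3 :: (int ^ 'n) set). d * \<parallel>x\<parallel>)" using w by (intro sum_mono) auto
  finally have "\<parallel>\<Sum>\<beta>\<in>cube 3. w \<beta>\<parallel> \<le> real (card (cube 3 :: (int ^ 'n) set)) * d * \<parallel>x\<parallel>" by (simp add: mult.assoc)
  then show "\<parallel>block_sum k S x\<parallel> \<le> real (card (cube 3 :: (int ^ 'n) set)) * d * \<parallel>x\<parallel>" by (simp only: eq)
qed

text \<open>The propagation 5k is k within the output tile, 3k between the two corners and k within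
  the input tile.\<close>

lemma block_sum_op:
  fixes S :: "int ^ 'n::finite \<Rightarrow> ('n, 'x::complex_banach) oper"
  assumes k: "0 < k" and d: "0 \<le> d" and S: "\<And>\<alpha>. S \<alpha> \<in> ops" "\<And>\<alpha> u. u \<in> lp \<Longrightarrow> \<parallel>S \<alpha> u\<parallel> \<le> d * \<parallel>u\<parallel>"
  shows "lp_restrict p (block_sum k S) \<in> Pops"
proof (rule Pops_propagation[where w = "5 * k"])
  let ?T = "lp_restrict p (block_sum k S)"
  have T: "?T x = block_sum k S x" if "x \<in> lp" for x using that by (simp add: lp_restrict_def)
  note bd = block_sum_bound[OF k _ d ops_mem[OF S(1)] S(2)]
  show "?T \<in> ops"
  proof (rule opsI[where C = "real (card (cube 3 :: (int ^ 'n) set)) * d"])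
    show "?T x = 0" if "x \<notin> lp" for x using that by (simp add: lp_restrict_def)
    show "?T x \<in> lp" if "x \<in> lp" for x unfolding T[OF that] by (rule bd(1)[OF that])
    show "\<parallel>?T x\<parallel> \<le> real (card (cube 3 :: (int ^ 'n) set)) * d * \<parallel>x\<parallel>" if "x \<in> lp" for x
      unfolding T[OF that] by (rule bd(2)[OF that])
    show "?T (x + y) = ?T x + ?T y" if "x \<in> lp" "y \<in> lp" for x y
    proof
      fix i
      have "S \<alpha> (on_tile k \<alpha> (x + y)) i = S \<alpha> (on_tile k \<alpha> x) i + S \<alpha> (on_tile k \<alpha> y) i" for \<alpha>
        using that by (simp add: rmul_add ops_add[OF S(1)] fun_apply)
      then show "?T (x + y) i = (?T x + ?T y) i"
        using that by (simp add: T fun_apply block_sum_def sum.distrib)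
    qed
    show "?T (seq_scaleC c x) = seq_scaleC c (?T x)" if "x \<in> lp" for c x
    proof
      fix i
      have "on_tile k \<alpha> (seq_scaleC c x) = seq_scaleC c (on_tile k \<alpha> x)" for \<alpha>
        by (auto simp: rmul_def seq_scaleC_def scaleC_scaleR)
      then have "S \<alpha> (on_tile k \<alpha> (seq_scaleC c x)) i = scaleC c (S \<alpha> (on_tile k \<alpha> x) i)" for \<alpha>
        using ops_scaleC[OF S(1) lp_ind(1)[OF that], of \<alpha> c] by (simp add: seq_scaleC_def)
      then show "?T (seq_scaleC c x) i = seq_scaleC c (?T x) i"
        using that lp_scaleC(1)[OF that, of c] by (simp add: T block_sum_def seq_scaleC_def scaleC_sum_right)
    qed
  qed
  show "propagation_le (5 * k) ?T"
    unfolding propagation_le_def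
  proof (intro ballI allI impI)
    fix x :: "('n, 'x) seq" and i assume x: "x \<in> lp" and z: "\<forall>j. linf (i - j) \<le> 5 * k \<longrightarrow> x j = 0"
    have "on_tile k (tile k i + \<beta>) x = 0" if "\<beta> \<in> cube 3" for \<beta>
    proof
      fix j
      have "linf (i - j) \<le> 5 * k" if j: "tile k j = tile k i + \<beta>"
      proof -
        have e: "i - j = (i - corner k (tile k i)) - (j - corner k (tile k j)) - corner k \<beta>"
          unfolding j corner_add by simp
        have "linf (i - j) \<le> linf (i - corner k (tile k i)) + linf (j - corner k (tile k j)) + linf (corner k \<beta>)"
          using linf_diff[of "(i - corner k (tile k i)) - (j - corner k (tile k j))" "corner k \<beta>"]
            linf_diff[of "i - corner k (tile k i)" "j - corner k (tile k j)"]
          unfolding e[symmetric] by linarith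
        moreover have "linf (corner k \<beta>) \<le> k * 3"
          unfolding linf_corner using \<open>\<beta> \<in> cube 3\<close> by (simp add: mem_cube_iff)
        ultimately show ?thesis using corner_tile[OF k, of i] corner_tile[OF k, of j] by (simp add: mem_cube_iff)
      qed
      then show "on_tile k (tile k i + \<beta>) x j = 0 j" using z by (auto simp: rmul_apply indicator_def fun_apply)
    qed
    then have "S (tile k i + \<beta>) (on_tile k (tile k i + \<beta>) x) i = 0" if "\<beta> \<in> cube 3" for \<beta>
      using that S(1) by (simp add: zero_fun_apply)
    then show "?T x i = 0" using x by (simp add: T block_sum_def)
  qed
qed

text \<open>To compute B of the block sum at i, only points j within w \<le> k are relevant, and
  their tile index differs from that of i by at most 1. Blocks visible at j are within 2 of the tile
  of j, hence within 3 of the tile of i, so near i the block sum agrees with the finite sum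
  \<open>?u\<close>.\<close>

lemma block_sum_compose:
  fixes S :: "int ^ 'n::finite \<Rightarrow> ('n, 'x::complex_banach) oper"
  assumes k: "0 < k" and d: "0 \<le> d" and S: "\<And>\<alpha>. S \<alpha> \<in> ops" "\<And>\<alpha> u. u \<in> lp \<Longrightarrow> \<parallel>S \<alpha> u\<parallel> \<le> d * \<parallel>u\<parallel>"
    and loc: "\<And>\<alpha> u i. u \<in> lp \<Longrightarrow> \<not> linf (\<alpha> - tile k i) \<le> 2 \<Longrightarrow> S \<alpha> u i = 0"
    and B: "B \<in> ops" "propagation_le w B" "w \<le> k" and x: "x \<in> lp"
  shows "B (block_sum k S x) = block_sum k (\<lambda>\<alpha>. B \<circ> S \<alpha>) x"
proof
  fix i
  define z where "z = (\<lambda>\<alpha>. S \<alpha> (on_tile k \<alpha> x))"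
  have z: "z \<alpha> \<in> lp" for \<alpha> using S(1) x by (simp add: z_def)
  let ?u = "\<Sum>\<beta>\<in>cube 3. z (tile k i + \<beta>)"
  have sum_apply: "(\<Sum>\<beta>\<in>T. v \<beta>) j = (\<Sum>\<beta>\<in>T. v \<beta> j)" if "finite T"
    for T :: "(int ^ 'n) set" and v :: "int ^ 'n \<Rightarrow> ('n, 'x) seq" and j
    using that
  proof (induction T rule: finite_induct)
    case (insert b T)
    then show ?case unfolding sum.insert[OF insert.hyps] by (simp add: fun_apply)
  qed (simp add: fun_apply)
  have u: "?u \<in> lp" using z by (intro lp_sum_mem) auto
  have bs: "block_sum k S x \<in> lp" by (rule block_sum_bound(1)[OF k x d ops_mem[OF S(1)] S(2)])
  have "(block_sum k S x - ?u) j = 0" if j: "linf (i - j) \<le> w" for j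
  proof -
    have zj: "z \<alpha> j = 0" if "\<not> linf (\<alpha> - tile k j) \<le> 2" for \<alpha>
      unfolding z_def using x that by (intro loc) auto
    have near: "linf (tile k i - tile k j) \<le> 1" using j B(3) k by (intro tile_near) auto
    let ?N = "\<lambda>i. (\<lambda>\<beta>. tile k i + \<beta>) ` cube 3"
    have reidx: "(\<Sum>\<beta>\<in>cube 3. z (tile k l + \<beta>) j) = (\<Sum>\<alpha>\<in>?N l. z \<alpha> j)" for l
      by (subst sum.reindex) auto
    \<comment> \<open>Summing over radius 3 about a neighbouring tile gives at j the same as summing
      over radius 2 about the tile of j: all other terms vanish there.\<close>
    have sub: "(\<Sum>\<alpha>\<in>?N l. z \<alpha> j) = (\<Sum>\<alpha>\<in>(\<lambda>\<beta>. tile k j + \<beta>) ` cube 2. z \<alpha> j)" if l: "linf (tile k l - tile k j) \<le> 1" for l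
    proof (rule sum.mono_neutral_right)
      show "(\<lambda>\<beta>. tile k j + \<beta>) ` cube 2 \<subseteq> ?N l"
      proof safe
        fix \<beta> :: "int ^ 'n" assume "\<beta> \<in> cube 2"
        then have "linf (\<beta> - (tile k l - tile k j)) \<le> 3"
          using l linf_diff[of \<beta> "tile k l - tile k j"] by (simp add: mem_cube_iff)
        then show "tile k j + \<beta> \<in> ?N l"
          by (intro image_eqI[of _ _ "\<beta> - (tile k l - tile k j)"]) (auto simp: mem_cube_iff)
      qed
      show "\<forall>\<alpha>\<in>?N l - (\<lambda>\<beta>. tile k j + \<beta>) ` cube 2. z \<alpha> j = 0"
      proof safe
        fix \<beta> :: "int ^ 'n" assume "tile k l + \<beta> \<notin> (\<lambda>\<beta>. tile k j + \<beta>) ` cube 2"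
        then have "tile k l + \<beta> - tile k j \<notin> cube 2"
          by (metis add.commute diff_add_cancel image_eqI)
        then show "z (tile k l + \<beta>) j = 0" by (intro zj) (simp add: mem_cube_iff)
      qed
    qed simp
    have "block_sum k S x j = (\<Sum>\<beta>\<in>cube 3. z (tile k j + \<beta>) j)" by (simp add: block_sum_def z_def)
    also have "\<dots> = (\<Sum>\<beta>\<in>cube 3. z (tile k i + \<beta>) j)"
      unfolding reidx by (simp add: sub[OF near] sub[of j])
    also have "\<dots> = ?u j" by (simp add: sum_apply)
    finally show ?thesis by (simp add: fun_apply)
  qed
  then have "B (block_sum k S x - ?u) i = 0"
    using B(2) lp_diff_mem(1)[OF bs u] unfolding propagation_le_def by blast
  then have "B (block_sum k S x) i = B ?u i" using ops_diff[OF B(1) bs u] by (simp add: fun_apply)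
  also have "\<dots> = (\<Sum>\<beta>\<in>cube 3. B (z (tile k i + \<beta>)) i)"
  proof -
    have "B ?u = (\<Sum>\<beta>\<in>cube 3. B (z (tile k i + \<beta>)))" using z by (intro ops_sum[OF B(1)]) auto
    then show ?thesis by (simp only: sum_apply[OF finite_cube])
  qed
  finally show "B (block_sum k S x) i = block_sum k (\<lambda>\<alpha>. B \<circ> S \<alpha>) x i" by (simp add: block_sum_def z_def)
qed

text \<open>Otherwise there is a sequence tending to infinity none of whose windows is close to a
  limit operator, contradicting richness along a subsequence. The limit operator may vary with
  \<open>a\<close>; only the threshold M is uniform.\<close>

lemma rich_window:
  assumes rich: "rich p A" and e: "0 < e"
  shows "\<exists>M. \<forall>a. M < linf a \<longrightarrow> (\<exists>L\<in>op_spectrum p A. \<forall>x\<in>lp.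
    \<parallel>cut m (conj_shift a A x - L x)\<parallel> \<le> e * \<parallel>x\<parallel> \<and> \<parallel>conj_shift a A (cut m x) - L (cut m x)\<parallel> \<le> e * \<parallel>x\<parallel>)"
    (is "\<exists>M. \<forall>a. M < linf a \<longrightarrow> (\<exists>L\<in>op_spectrum p A. ?close a L)")
proof (rule ccontr)
  assume "\<not> ?thesis"
  then have "\<forall>M. \<exists>a. M < linf a \<and> (\<forall>L\<in>op_spectrum p A. \<not> ?close a L)" by blast
  then obtain h where h: "\<And>M. M < linf (h M)" "\<And>M L. L \<in> op_spectrum p A \<Longrightarrow> \<not> ?close (h M) L"
    by metis
  have "tends_to_infinity h"
    unfolding tends_to_infinity_iff
  proof
    fix m
    have "m \<le> linf (h n)" if "m \<le> n" for n using h(1)[of n] that by simp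
    then show "\<forall>\<^sub>F n in sequentially. m \<le> linf (h n)" unfolding eventually_sequentially by blast
  qed
  then obtain r L where L: "is_limit_op p A (h \<circ> r) L" using rich unfolding rich_def by blast
  from eventually_happens[OF P_strong_limit_window[OF is_limit_opD(3)[OF L] e, of m]]
  obtain n where "?close (h (r n)) L" by auto
  moreover have "L \<in> op_spectrum p A" using L by (auto simp: op_spectrum_def)
  ultimately show False using h(2) by blast
qed

text \<open>Every cut piece of y lives in a window about a point s. If s is far out, a limit
  operator close to B on that window transfers its lower bound 1/c; the averaging lemma assembles
  the pieces. Half of e pays for the closeness, half for the commutators.\<close>

lemma lower_bound_at_infinity:
  fixes B :: "('n::finite, 'x::complex_banach) oper"
  assumes B: "B \<in> ops" "small_average_commutators B" "rich p B" and c: "0 < c"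
    and inv: "\<And>L x. L \<in> op_spectrum p B \<Longrightarrow> x \<in> lp \<Longrightarrow> \<parallel>x\<parallel> \<le> c * \<parallel>L x\<parallel>" and e: "0 < e"
  shows "\<exists>m. \<forall>y\<in>lp. cut m y = 0 \<longrightarrow> (1 / c - e) * \<parallel>y\<parallel> \<le> \<parallel>B y\<parallel>"
proof -
  have e2: "e / 2 > 0" using e by simp
  let ?N = "\<lambda>k. lp_size p (bump k :: int ^ 'n \<Rightarrow> real)"
  obtain k where k: "k > 0" "\<And>x. x \<in> lp \<Longrightarrow> lp_summable p (\<lambda>s. \<parallel>commutator B (\<lambda>i. bump k (i - s)) x\<parallel>)"
    "\<And>x. x \<in> lp \<Longrightarrow> lp_size p (\<lambda>s. \<parallel>commutator B (\<lambda>i. bump k (i - s)) x\<parallel>) \<le> e / 2 * ?N k * \<parallel>x\<parallel>"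
    using B(2)[unfolded small_average_commutators_def, rule_format, OF e2] by blast
  obtain M where M: "\<And>a. M < linf a \<Longrightarrow> \<exists>L\<in>op_spectrum p B. \<forall>x\<in>lp.
    \<parallel>cut (2 * k) (conj_shift a B x - L x)\<parallel> \<le> e / 2 * \<parallel>x\<parallel> \<and> \<parallel>conj_shift a B (cut (2 * k) x) - L (cut (2 * k) x)\<parallel> \<le> e / 2 * \<parallel>x\<parallel>"
    using rich_window[OF B(3) e2, of "2 * k"] by blast
  have "(1 / c - e) * \<parallel>y\<parallel> \<le> \<parallel>B y\<parallel>" if y: "y \<in> lp" "cut (2 * k + M) y = 0" for y
  \<comment> \<open>The averaging lemma requires a nonnegative local constant; for a negative one
    the claim is trivial.\<close>
  proof (cases "1 / c - e / 2 \<ge> 0")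
    case False
    then have "(1 / c - e) * \<parallel>y\<parallel> \<le> 0" using nrm_nonneg[OF y(1)] e by (intro mult_nonpos_nonneg) auto
    then show ?thesis using nrm_nonneg[OF ops_mem[OF B(1) y(1)]] by linarith
  next
    case True
    have "(1 / c - e / 2) * \<parallel>rmul (\<lambda>i. bump k (i - s)) y\<parallel> \<le> \<parallel>B (rmul (\<lambda>i. bump k (i - s)) y)\<parallel>" for s
    proof (cases "M < linf s")
      \<comment> \<open>The support of the bump about such an s lies in
        \<open>cube (2 * k + M)\<close>, where y vanishes, so the local inequality reads 0 \<le>
        0.\<close>
      case False
      have "rmul (\<lambda>i. bump k (i - s)) y i = 0" for i
      proof (cases "bump k (i - s) = 0")
        case nz: False
        then have "linf (i - s) \<le> 2 * k" using bump_eq_0[OF k(1), of "i - s"] by (auto simp: mem_cube_iff)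
        then have "i \<in> cube (2 * k + M)" using False linf_add[of "i - s" s] by (simp add: mem_cube_iff)
        then have "y i = 0" using fun_cong[OF y(2), of i] by (simp add: rmul_apply fun_apply)
        then show ?thesis by (simp add: rmul_apply)
      qed (simp add: rmul_apply)
      then have "rmul (\<lambda>i. bump k (i - s)) y = 0" by (auto simp: fun_apply)
      then show ?thesis using B(1) by simp
    next
      case sM: True
      then obtain L where L: "L \<in> op_spectrum p B"
        "\<And>x. x \<in> lp \<Longrightarrow> \<parallel>conj_shift s B (cut (2 * k) x) - L (cut (2 * k) x)\<parallel> \<le> e / 2 * \<parallel>x\<parallel>"
        using M[OF sM] by blast
      have Lo: "L \<in> ops" using L(1) is_limit_opD(1) by (auto simp: op_spectrum_def)
      let ?u = "rmul (\<lambda>i. bump k (i - s)) y"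
      let ?w = "shift_op p (- s) ?u"
      have u: "?u \<in> lp" using y by simp
      have w: "?w \<in> lp" "\<parallel>?w\<parallel> = \<parallel>?u\<parallel>" "shift_op p s ?w = ?u"
        using u by (auto simp: shift_lp shift_nrm shift_cancel)
      have cw: "cut (2 * k) ?w = ?w"
      proof
        fix i show "cut (2 * k) ?w i = ?w i"
          using bump_eq_0[OF k(1), of i] u by (auto simp: rmul_apply shift_apply' indicator_def)
      qed
      have Bw: "conj_shift s B ?w \<in> lp" using ops_mem[OF conj_shift_ops[OF B(1)] w(1)] .
      have "\<parallel>conj_shift s B ?w\<parallel> = \<parallel>B ?u\<parallel>" unfolding conj_shift_nrm[OF B(1) w(1)] w(3) ..
      moreover have "\<parallel>L ?w\<parallel> \<le> \<parallel>conj_shift s B ?w\<parallel> + \<parallel>conj_shift s B ?w - L ?w\<parallel>"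
        using nrm_triangle_sub[OF ops_mem[OF Lo w(1)] Bw] nrm_diff_commute[of "L ?w" "conj_shift s B ?w"] by linarith
      moreover have "\<parallel>conj_shift s B ?w - L ?w\<parallel> \<le> e / 2 * \<parallel>?u\<parallel>" using L(2)[OF w(1)] unfolding cw w(2) .
      moreover have "1 / c * \<parallel>?u\<parallel> \<le> \<parallel>L ?w\<parallel>"
        using inv[OF L(1) w(1)] c unfolding w(2) by (simp add: field_simps)
      ultimately show ?thesis by (simp add: left_diff_distrib)
    qed
    from lower_bound_globalisation[OF B(1) y(1) k(1) True this k(2)[OF y(1)] k(3)[OF y(1)]]
    show ?thesis by simp
  qed
  then show ?thesis by blast
qed

text \<open>Each block restricts sharply to a tile, applies a transported inverse and multiplies by
  a smooth bump. The sharp restrictions give an exact partition with disjoint inputs; the smooth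
  factor nearly commutes with the approximant B', whose finite propagation lets it pass inside the
  block sum. Limit operators approximate B itself, so B and B' are exchanged where needed at cost
  e.\<close>

lemma right_regulariser:
  fixes B :: "('n::finite, 'x::complex_banach) oper"
  assumes B: "B \<in> Pops" "finite_propagation_limit B" "rich p B" and c: "0 < c"
    and inv: "\<And>L. L \<in> op_spectrum p B \<Longrightarrow> \<exists>D\<in>ops. L \<circ> D = id_op p \<and> opn D \<le> c"
  shows "\<exists>C\<in>Pops. (B \<circ> C) - id_op p \<in> compacts"
proof -
  note Bo = Pops_ops[OF B(1)]
  define N where "N = real (card (cube 3 :: (int ^ 'n) set))"
  have N: "N \<ge> 1"
  proof -
    have "(0 :: int ^ 'n) \<in> cube 3" by (simp add: mem_cube_iff)
    then have "0 < card (cube 3 :: (int ^ 'n) set)" by (auto simp: card_gt_0_iff)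
    then show ?thesis by (simp add: N_def Suc_le_eq)
  qed
  \<comment> \<open>Makes \<open>e * (N * c) = 1 / 8\<close>. Replacing B by B' costs one such unit
    and the blocks cost three, which gives the 1/2 required by the Neumann series.\<close>
  define e where "e = 1 / (8 * N * c)"
  have e: "e > 0" "e * (N * c) = 1 / 8" using N c by (auto simp: e_def field_simps)
  obtain B' w where B': "B' \<in> ops" "propagation_le w B'" "small_commutators B'"
    "\<And>x. x \<in> lp \<Longrightarrow> \<parallel>B x - B' x\<parallel> \<le> e * \<parallel>x\<parallel>"
    using B(2)[unfolded finite_propagation_limit_def, rule_format, OF e(1)] by blast
  obtain k0 where k0: "k0 > 0" "\<And>k s x. k0 \<le> k \<Longrightarrow> x \<in> lp \<Longrightarrow> \<parallel>commutator B' (\<lambda>i. bump k (i - s)) x\<parallel> \<le> e * \<parallel>x\<parallel>"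
    using B'(3)[unfolded small_commutators_def, rule_format, OF e(1)] by blast
  \<comment> \<open>Large enough for the commutators of B' and at least its propagation w, as
    passing B' through the block sum requires.\<close>
  define k where "k = max k0 w"
  have k: "0 < k" "k0 \<le> k" "w \<le> k" using k0 by (auto simp: k_def)
  obtain M where M: "\<And>a. M < linf a \<Longrightarrow> \<exists>L\<in>op_spectrum p B. \<forall>x\<in>lp.
    \<parallel>cut (2 * k) (conj_shift a B x - L x)\<parallel> \<le> e * \<parallel>x\<parallel> \<and> \<parallel>conj_shift a B (cut (2 * k) x) - L (cut (2 * k) x)\<parallel> \<le> e * \<parallel>x\<parallel>"
    using rich_window[OF B(3) e(1), of "2 * k"] by blast
  have "\<exists>L D. M < linf a \<longrightarrow> L \<in> ops \<and> D \<in> ops \<and> L \<circ> D = id_op p \<and> opn D \<le> c \<and>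
      (\<forall>x\<in>lp. \<parallel>cut (2 * k) (conj_shift a B x - L x)\<parallel> \<le> e * \<parallel>x\<parallel>)" for a
  proof (cases "M < linf a")
    case True
    then obtain L where L: "L \<in> op_spectrum p B" "\<forall>x\<in>lp. \<parallel>cut (2 * k) (conj_shift a B x - L x)\<parallel> \<le> e * \<parallel>x\<parallel>"
      using M by blast
    have "L \<in> ops" using L(1) is_limit_opD(1) by (auto simp: op_spectrum_def)
    then show ?thesis using inv[OF L(1)] L(2) by blast
  qed blast
  then obtain L D where LD: "\<And>a. M < linf a \<Longrightarrow> L a \<in> ops" "\<And>a. M < linf a \<Longrightarrow> D a \<in> ops"
    "\<And>a. M < linf a \<Longrightarrow> L a \<circ> D a = id_op p" "\<And>a. M < linf a \<Longrightarrow> opn (D a) \<le> c"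
    "\<And>a x. M < linf a \<Longrightarrow> x \<in> lp \<Longrightarrow> \<parallel>cut (2 * k) (conj_shift a B x - L a x)\<parallel> \<le> e * \<parallel>x\<parallel>"
    by metis
  let ?\<psi> = "\<lambda>\<alpha> i. bump k (i - corner k \<alpha>)"
  let ?good = "\<lambda>\<alpha>. M < linf (corner k \<alpha>)"
  \<comment> \<open>The inverse of the limit operator assigned to the corner, shifted back to it: an
    approximate right inverse of B near the tile.\<close>
  define E where "E = (\<lambda>\<alpha>. shift_op p (corner k \<alpha>) \<circ> D (corner k \<alpha>) \<circ> shift_op p (- corner k \<alpha>))"
  have Eo: "E \<alpha> \<in> ops" "\<And>u. u \<in> lp \<Longrightarrow> \<parallel>E \<alpha> u\<parallel> \<le> c * \<parallel>u\<parallel>" if "?good \<alpha>" for \<alpha>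
  proof -
    show "E \<alpha> \<in> ops" unfolding E_def using LD(2)[OF that] by (intro ops_comp(1) shift_mem)
    show "\<parallel>E \<alpha> u\<parallel> \<le> c * \<parallel>u\<parallel>" if u: "u \<in> lp" for u
    proof -
      have su: "shift_op p (- corner k \<alpha>) u \<in> lp" using u by (rule shift_lp)
      have "\<parallel>E \<alpha> u\<parallel> = \<parallel>D (corner k \<alpha>) (shift_op p (- corner k \<alpha>) u)\<parallel>"
        unfolding E_def comp_apply by (rule shift_nrm[OF ops_mem[OF LD(2)[OF \<open>?good \<alpha>\<close>] su]])
      also have "\<dots> \<le> c * \<parallel>shift_op p (- corner k \<alpha>) u\<parallel>"
        by (rule opn_bound'[OF LD(2)[OF \<open>?good \<alpha>\<close>] su LD(4)[OF \<open>?good \<alpha>\<close>]])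
      finally show ?thesis unfolding shift_nrm[OF u] .
    qed
  qed
  have \<psi>o: "mop p (?\<psi> \<alpha>) \<in> ops" for \<alpha> by (rule mop_mem(1)[of 1]) (auto simp: abs_of_nonneg bump_bounds)
  have \<psi>a: "mop p (?\<psi> \<alpha>) u = rmul (?\<psi> \<alpha>) u" if "u \<in> lp" for \<alpha> u using that by (rule mop_apply)
  \<comment> \<open>The finitely many tiles with corner in \<open>cube M\<close> get no local
    inverse; their contribution is the projection \<open>P\<close> below.\<close>
  define S where "S = (\<lambda>\<alpha>. if ?good \<alpha> then mop p (?\<psi> \<alpha>) \<circ> E \<alpha> else 0)"
  have So: "S \<alpha> \<in> ops" for \<alpha> unfolding S_def using Eo \<psi>o by (auto intro!: ops_comp(1) ops_zero_mem)
  have Sg: "S \<alpha> u = rmul (?\<psi> \<alpha>) (E \<alpha> u)" if "?good \<alpha>" "u \<in> lp" for \<alpha> u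
    using that Eo(1) by (simp add: S_def \<psi>a)
  have Sb: "S \<alpha> u = 0" if "\<not> ?good \<alpha>" for \<alpha> u using that by (simp add: S_def)
  have Sn: "\<parallel>S \<alpha> u\<parallel> \<le> c * \<parallel>u\<parallel>" if u: "u \<in> lp" for \<alpha> u
  proof (cases "?good \<alpha>")
    case True
    have "\<parallel>rmul (?\<psi> \<alpha>) (E \<alpha> u)\<parallel> \<le> \<parallel>E \<alpha> u\<parallel>" using Eo(1)[OF True] u by (intro rmul_bump_le) simp
    then show ?thesis using Eo(2)[OF True u] unfolding Sg[OF True u] by linarith
  next
    case False
    then show ?thesis using Sb[OF False] c nrm_nonneg[OF u] by simp
  qed
  have Sloc: "S \<alpha> u i = 0" if "u \<in> lp" "\<not> linf (\<alpha> - tile k i) \<le> 2" for \<alpha> u i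
  proof (cases "?good \<alpha>")
    case True
    then show ?thesis using bump_tile[OF k(1), of i \<alpha>] that Sg[OF True that(1)] by (auto simp: rmul_apply)
  next
    case False
    then show ?thesis using Sb[OF False] by (simp add: zero_fun_apply)
  qed
  have c0: "0 \<le> c" using c by simp
  define C0 where "C0 = lp_restrict p (block_sum k S)"
  have C0: "C0 \<in> Pops" unfolding C0_def by (rule block_sum_op[OF k(1) c0 So Sn])
  note C0o = Pops_ops[OF C0]
  have C0a: "C0 x = block_sum k S x" if "x \<in> lp" for x using that by (simp add: C0_def lp_restrict_def)
  have C0n: "\<parallel>C0 x\<parallel> \<le> N * c * \<parallel>x\<parallel>" if "x \<in> lp" for x
    unfolding C0a[OF that] N_def by (rule block_sum_bound(2)[OF k(1) that c0 ops_mem[OF So] Sn])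
  \<comment> \<open>The defect of a block: B' S \<alpha> should be multiplication by the bump, which
    acts as the identity on the tile.\<close>
  define R where "R = (\<lambda>\<alpha>. if ?good \<alpha> then (B' \<circ> S \<alpha>) - mop p (?\<psi> \<alpha>) else 0)"
  have Ro: "R \<alpha> \<in> ops" for \<alpha>
    unfolding R_def using So \<psi>o B' by (auto intro!: ops_minus(1) ops_comp(1) ops_zero_mem)
  have Rn: "\<parallel>R \<alpha> u\<parallel> \<le> 3 * e * c * \<parallel>u\<parallel>" if u: "u \<in> lp" for \<alpha> u
  proof (cases "?good \<alpha>")
    case True
    let ?a = "corner k \<alpha>" and ?v = "E \<alpha> u" and ?m = "rmul (?\<psi> \<alpha>)"
    let ?t = "shift_op p (- ?a) ?v"
    have v: "?v \<in> lp" "\<parallel>?v\<parallel> \<le> c * \<parallel>u\<parallel>" using Eo[OF True] u by auto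
    have t: "?t \<in> lp" "\<parallel>?t\<parallel> = \<parallel>?v\<parallel>" using v by (auto simp: shift_lp shift_nrm)
    note La = LD(1)[OF True] and Da = LD(2)[OF True]
    have su: "shift_op p (- ?a) u \<in> lp" using u by (rule shift_lp)
    have tD: "?t = D ?a (shift_op p (- ?a) u)"
      unfolding E_def comp_apply by (rule shift_cancel(2)[OF ops_mem[OF Da su]])
    have Lt: "L ?a ?t = shift_op p (- ?a) u"
      using fun_cong[OF LD(3)[OF True], of "shift_op p (- ?a) u"] su unfolding tD by (simp add: id_op_apply)
    have Bv: "B ?v \<in> lp" "B' ?v \<in> lp" using v Bo B' by auto
    have cB: "conj_shift ?a B ?t = shift_op p (- ?a) (B ?v)"
      unfolding conj_shift_apply using v by (simp add: shift_cancel)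
    have 1: "\<parallel>commutator B' (?\<psi> \<alpha>) ?v\<parallel> \<le> e * \<parallel>?v\<parallel>" by (rule k0(2)[OF k(2) v(1)])
    have 2: "\<parallel>?m (B' ?v - B ?v)\<parallel> \<le> e * \<parallel>?v\<parallel>"
    proof -
      have "\<parallel>?m (B' ?v - B ?v)\<parallel> \<le> \<parallel>B' ?v - B ?v\<parallel>" using Bv by (intro rmul_bump_le) simp
      also have "\<dots> = \<parallel>B ?v - B' ?v\<parallel>" by (rule nrm_diff_commute)
      also have "\<dots> \<le> e * \<parallel>?v\<parallel>" by (rule B'(4)[OF v(1)])
      finally show ?thesis .
    qed
    \<comment> \<open>Shifted to the origin, \<open>B ?v - u\<close> is the conjugate of B minus L
      applied to \<open>?t\<close>, because L maps \<open>?t\<close> to the shifted u; the bump sees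
      it only on \<open>cube (2 * k)\<close>.\<close>
    have 3: "\<parallel>?m (B ?v - u)\<parallel> \<le> e * \<parallel>?v\<parallel>"
    proof -
      have d: "B ?v - u \<in> lp" using Bv u by simp
      have "\<parallel>?m (B ?v - u)\<parallel> = \<parallel>rmul (bump k) (shift_op p (- ?a) (B ?v - u))\<parallel>"
        by (rule rmul_shift_nrm[OF d, symmetric]) (simp add: abs_of_nonneg bump_bounds)
      also have "shift_op p (- ?a) (B ?v - u) = conj_shift ?a B ?t - L ?a ?t"
        unfolding cB Lt using Bv u by (simp add: ops_diff[OF shift_mem])
      also have "\<parallel>rmul (bump k) (conj_shift ?a B ?t - L ?a ?t)\<parallel> = \<parallel>rmul (bump k) (cut (2 * k) (conj_shift ?a B ?t - L ?a ?t))\<parallel>"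
        using bump_cut[OF k(1), of 0 "conj_shift ?a B ?t - L ?a ?t"] by (simp del: comp_apply)
      also have "\<dots> \<le> \<parallel>cut (2 * k) (conj_shift ?a B ?t - L ?a ?t)\<parallel>"
        using rmul_bump_le[OF lp_cut, of k 0 "2 * k" "conj_shift ?a B ?t - L ?a ?t"] by (simp del: comp_apply)
      also have "\<dots> \<le> e * \<parallel>?t\<parallel>" by (rule LD(5)[OF True t(1)])
      finally show ?thesis unfolding t(2) .
    qed
    have eq: "R \<alpha> u = commutator B' (?\<psi> \<alpha>) ?v + (?m (B' ?v - B ?v) + ?m (B ?v - u))"
      using True u by (simp add: R_def Sg[OF True u] \<psi>a rmul_diff)
    have "\<parallel>R \<alpha> u\<parallel> = \<parallel>commutator B' (?\<psi> \<alpha>) ?v + (?m (B' ?v - B ?v) + ?m (B ?v - u))\<parallel>"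
      by (rule arg_cong[OF eq])
    also have "\<dots> \<le> \<parallel>commutator B' (?\<psi> \<alpha>) ?v\<parallel> + \<parallel>?m (B' ?v - B ?v) + ?m (B ?v - u)\<parallel>"
      by (rule lp_add_mem(2)) (use B' Bv v u in auto)
    finally have 4: "\<parallel>R \<alpha> u\<parallel> \<le> \<parallel>commutator B' (?\<psi> \<alpha>) ?v\<parallel> + \<parallel>?m (B' ?v - B ?v) + ?m (B ?v - u)\<parallel>" .
    have 5: "\<parallel>?m (B' ?v - B ?v) + ?m (B ?v - u)\<parallel> \<le> \<parallel>?m (B' ?v - B ?v)\<parallel> + \<parallel>?m (B ?v - u)\<parallel>"
      by (rule lp_add_mem(2)) (use Bv u in auto)
    have "e * \<parallel>?v\<parallel> \<le> e * (c * \<parallel>u\<parallel>)" using e v by (intro mult_left_mono) auto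
    then show ?thesis using 1 2 3 4 5 by (simp add: mult.assoc)
  next
    case False
    then show ?thesis using e c nrm_nonneg[OF u] by (simp add: R_def)
  qed
  let ?G = "{i. ?good (tile k i)}"
  have B'C0: "B' (C0 x) - rmul (indicat_real ?G) x = block_sum k R x" if x: "x \<in> lp" for x
  proof
    fix i
    \<comment> \<open>At i only the block of the tile containing i, with offset 0, has a nonzero
      input coordinate, and the bump is 1 there; the bumps thus sum to the indicator of the good
      tiles.\<close>
    have z: "(\<Sum>\<beta>\<in>cube 3. (if ?good (tile k i + \<beta>) then rmul (?\<psi> (tile k i + \<beta>)) (on_tile k (tile k i + \<beta>) x) i else 0))
        = rmul (indicat_real ?G) x i"
    proof -
      have "(\<Sum>\<beta>\<in>cube 3. (if ?good (tile k i + \<beta>) then rmul (?\<psi> (tile k i + \<beta>)) (on_tile k (tile k i + \<beta>) x) i else 0))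
          = (\<Sum>\<beta>\<in>{0}. (if ?good (tile k i + \<beta>) then rmul (?\<psi> (tile k i + \<beta>)) (on_tile k (tile k i + \<beta>) x) i else 0))"
        by (rule sum.mono_neutral_right) (auto simp: mem_cube_iff rmul_apply)
      then show ?thesis
        using corner_tile[OF k(1), of i] by (auto simp: rmul_apply bump_eq_1[OF k(1)])
    qed
    have Rz: "R \<alpha> (on_tile k \<alpha> x) i = B' (S \<alpha> (on_tile k \<alpha> x)) i - (if ?good \<alpha> then rmul (?\<psi> \<alpha>) (on_tile k \<alpha> x) i else 0)" for \<alpha>
    proof (cases "?good \<alpha>")
      case True
      then show ?thesis using x by (simp add: R_def \<psi>a minus_apply)
    next
      case False
      then show ?thesis using B'(1) Sb[OF False] by (simp add: R_def zero_fun_apply)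
    qed
    have cmp: "B' (block_sum k S x) = block_sum k (\<lambda>\<alpha>. B' \<circ> S \<alpha>) x"
      by (rule block_sum_compose[where S = S and d = c and w = w]) (fact k c0 So Sn Sloc B' x)+
    have "B' (C0 x) i = (\<Sum>\<beta>\<in>cube 3. B' (S (tile k i + \<beta>) (on_tile k (tile k i + \<beta>) x)) i)"
      using fun_cong[OF cmp, of i] by (simp only: C0a[OF x]) (simp add: block_sum_def)
    then show "(B' (C0 x) - rmul (indicat_real ?G) x) i = block_sum k R x i"
      unfolding minus_apply z[symmetric] by (simp add: block_sum_def Rz sum_subtractf)
  qed
  define P :: "('n, 'x) oper" where "P = mop p (indicat_real (- ?G))"
  have Pc: "P \<in> compacts"
    unfolding P_def
  proof (rule compact_mop[of 1])
    have "- ?G \<subseteq> cube (k + M)"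
    proof
      fix i assume "i \<in> - ?G"
      then have "linf (corner k (tile k i)) \<le> M" by simp
      then show "i \<in> cube (k + M)"
        using corner_tile[OF k(1), of i] linf_add[of "i - corner k (tile k i)" "corner k (tile k i)"]
        by (simp add: mem_cube_iff)
    qed
    then show "finite {i. indicat_real (- ?G) i \<noteq> 0}"
      by (rule finite_subset[rotated, OF finite_subset[OF _ finite_cube]]) (auto simp: indicator_def)
  qed auto
  \<comment> \<open>The decomposition B C0 = I + F - P, where P covers the finitely many bad tiles.
    After multiplication by J it becomes B C0 J = I - P J.\<close>
  define F where "F = ((B \<circ> C0) - id_op p) + P"
  have FP: "F \<in> Pops"
    unfolding F_def by (intro Pops_plus Pops_minus Pops_comp B C0 Pops_id compacts_subset_Pops Pc)
  have Fa: "F x = (B (C0 x) - B' (C0 x)) + block_sum k R x" if x: "x \<in> lp" for x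
  proof -
    have "rmul (indicat_real (- ?G)) x = x - rmul (indicat_real ?G) x"
      by (auto simp: rmul_def fun_apply indicator_def)
    then have "F x = B (C0 x) - rmul (indicat_real ?G) x"
      using x by (simp add: F_def P_def id_op_apply mop_apply)
    then show ?thesis unfolding B'C0[OF x, symmetric] by simp
  qed
  have half: "\<parallel>F x\<parallel> \<le> 1 / 2 * \<parallel>x\<parallel>" if x: "x \<in> lp" for x
  proof -
    have d3: "0 \<le> 3 * e * c" using e c by simp
    note bR = block_sum_bound[where S = R, OF k(1) x d3 ops_mem[OF Ro] Rn]
    have C0x: "C0 x \<in> lp" using C0o x by simp
    have "\<parallel>F x\<parallel> = \<parallel>(B (C0 x) - B' (C0 x)) + block_sum k R x\<parallel>" by (rule arg_cong[OF Fa[OF x]])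
    also have "\<dots> \<le> \<parallel>B (C0 x) - B' (C0 x)\<parallel> + \<parallel>block_sum k R x\<parallel>"
      using C0x Bo B' bR(1) by (intro lp_add_mem(2)) auto
    finally have 1: "\<parallel>F x\<parallel> \<le> \<parallel>B (C0 x) - B' (C0 x)\<parallel> + \<parallel>block_sum k R x\<parallel>" .
    have "\<parallel>B (C0 x) - B' (C0 x)\<parallel> \<le> e * \<parallel>C0 x\<parallel>" by (rule B'(4)[OF C0x])
    also have "\<dots> \<le> e * (N * c * \<parallel>x\<parallel>)" using e C0n[OF x] by (intro mult_left_mono) auto
    also have "\<dots> = e * (N * c) * \<parallel>x\<parallel>" by simp
    finally have 2: "\<parallel>B (C0 x) - B' (C0 x)\<parallel> \<le> 1 / 8 * \<parallel>x\<parallel>" unfolding e(2) .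
    have "N * (3 * e * c) * \<parallel>x\<parallel> = 3 * (e * (N * c)) * \<parallel>x\<parallel>" by simp
    then have 3: "\<parallel>block_sum k R x\<parallel> \<le> 3 * (1 / 8) * \<parallel>x\<parallel>" using bR(2) unfolding e(2) N_def[symmetric] by linarith
    show ?thesis using 1 2 3 by linarith
  qed
  obtain J where J: "J \<in> Pops" "(id_op p + F) \<circ> J = id_op p"
    using Neumann_right_inverse[OF FP half] by blast
  note Jo = Pops_ops[OF J(1)] and Po = compactD(1)[OF Pc]
  have "(B \<circ> (C0 \<circ> J)) - id_op p = - (P \<circ> J)"
  proof (rule ops_eqI)
    show "(B \<circ> (C0 \<circ> J)) - id_op p \<in> ops" using Bo C0o Jo by (intro ops_minus(1) ops_comp(1)) auto
    show "- (P \<circ> J) \<in> ops" using Po Jo by (intro ops_neg ops_comp(1))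
    fix x :: "('n, 'x) seq" assume x: "x \<in> lp"
    have Jx: "J x \<in> lp" using Jo x by simp
    have "J x + F (J x) = x"
      using fun_cong[OF J(2), of x] x Jx by (simp add: id_op_apply)
    then have "B (C0 (J x)) + P (J x) = x" using Jx by (simp add: F_def id_op_apply)
    then have "B (C0 (J x)) - x = - P (J x)" by (metis add_diff_cancel_left' diff_add_cancel minus_diff_eq add.commute)
    then show "((B \<circ> (C0 \<circ> J)) - id_op p) x = (- (P \<circ> J)) x" using x by (simp add: id_op_apply)
  qed
  moreover have "- (P \<circ> J) \<in> compacts" by (intro compact_neg Pops_compact(2) J Pc)
  moreover have "C0 \<circ> J \<in> Pops" by (intro Pops_comp C0 J)
  ultimately show ?thesis by (intro bexI[of _ "C0 \<circ> J"]) auto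
qed

end


section \<open>Two-sidedness and norm of the regulariser\<close>

context lp_exponent
begin

text \<open>Splits u into window and tail, uses the lower bound on the tail and rewrites B on the
  tail as B u minus B on the window. A vector is thus small once its window part and its image under
  B are small.\<close>

lemma cut_off_estimate:
  assumes B: "B \<in> ops" and u: "u \<in> lp" and \<kappa>: "0 < \<kappa>" and low: "\<kappa> * \<parallel>tail m u\<parallel> \<le> \<parallel>B (tail m u)\<parallel>"
  shows "\<parallel>u\<parallel> \<le> \<parallel>cut m u\<parallel> + (\<parallel>B u\<parallel> + opn B * \<parallel>cut m u\<parallel>) / \<kappa>"
proof -
  have "B (tail m u) = B u - B (cut m u)"
    using ops_diff[OF B u lp_cut, of m u] unfolding tail_eq_diff .
  then have "\<parallel>B (tail m u)\<parallel> \<le> \<parallel>B u\<parallel> + \<parallel>B (cut m u)\<parallel>"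
    using lp_diff_mem(2)[OF ops_mem[OF B u] ops_mem[OF B lp_cut]] by simp
  then have "\<kappa> * \<parallel>tail m u\<parallel> \<le> \<parallel>B u\<parallel> + opn B * \<parallel>cut m u\<parallel>"
    using low opn_bound[OF B lp_cut, of m u] by linarith
  then have "\<parallel>tail m u\<parallel> \<le> (\<parallel>B u\<parallel> + opn B * \<parallel>cut m u\<parallel>) / \<kappa>" using \<kappa> by (simp add: field_simps)
  moreover have "\<parallel>u\<parallel> \<le> \<parallel>cut m u\<parallel> + \<parallel>tail m u\<parallel>"
    using lp_add_mem(2)[OF lp_cut lp_ind(1)[OF u], of m u "- cube m"] unfolding cut_plus_tail .
  ultimately show ?thesis by linarith
qed

text \<open>With T = C B - I, the identity B T = (B C - I) B puts B T into the ideal. On inputs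
  supported far out T x has small image under B, and a small window part since T lies in the
  algebra, so T x is small by the lower bound at infinity. Hence T is the norm limit of its products
  with cutoffs.\<close>

lemma left_regulariser:
  fixes B :: "('n::finite, 'x::complex_banach) oper"
  assumes B: "B \<in> Pops" and C: "C \<in> Pops" "(B \<circ> C) - id_op p \<in> compacts"
    and low: "0 < \<kappa>" "\<And>y. y \<in> lp \<Longrightarrow> cut m y = 0 \<Longrightarrow> \<kappa> * \<parallel>y\<parallel> \<le> \<parallel>B y\<parallel>"
  shows "(C \<circ> B) - id_op p \<in> compacts"
proof -
  define T where "T = (C \<circ> B) - id_op p"
  note Bo = Pops_ops[OF B] and Co = Pops_ops[OF C(1)]
  have T: "T \<in> Pops" unfolding T_def by (intro Pops_minus Pops_comp Pops_id B C)
  note To = Pops_ops[OF T]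
  have BT: "B \<circ> T \<in> compacts"
  proof -
    have "B \<circ> T = ((B \<circ> C) - id_op p) \<circ> B"
      by (rule ops_eqI)
        (use Bo Co To in \<open>auto simp: T_def ops_diff id_op_apply intro!: ops_comp(1) ops_minus(1)\<close>)
    then show ?thesis using Pops_compact(2)[OF B C(2)] by simp
  qed
  define b where "b = opn B"
  have b: "0 \<le> b" using opn_nonneg[OF Bo] by (simp add: b_def)
  have tailT: "\<exists>n. \<forall>x\<in>lp. \<parallel>T (tail n x)\<parallel> \<le> e * \<parallel>x\<parallel>" if "e > 0" for e
  proof -
    \<comment> \<open>Solves d + (d + b d)/\<kappa> = e, the total error of
      \<open>cut_off_estimate\<close> when window part and image are both at most d times the norm
      of x.\<close>
    define d where "d = e / (1 + (1 + b) / \<kappa>)"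
    have den: "0 < 1 + (1 + b) / \<kappa>" using low(1) b by (intro add_pos_nonneg) auto
    have d: "d > 0" "d + (d + b * d) / \<kappa> = e"
    proof -
      show "d > 0" using that den by (simp add: d_def)
      have "d * (1 + (1 + b) / \<kappa>) = e" using den by (simp add: d_def)
      then show "d + (d + b * d) / \<kappa> = e" by (simp add: algebra_simps add_divide_distrib)
    qed
    obtain n1 where n1: "\<And>n x. n1 \<le> n \<Longrightarrow> x \<in> lp \<Longrightarrow> \<parallel>cut m (T (tail n x))\<parallel> \<le> d * \<parallel>x\<parallel>"
      using Pops_cut_tail[OF T d(1), of m] by blast
    obtain n2 where n2: "\<And>n x. n2 \<le> n \<Longrightarrow> x \<in> lp \<Longrightarrow> \<parallel>(B \<circ> T) (tail n x)\<parallel> \<le> d * \<parallel>x\<parallel>"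
      using compactD(2)[OF BT d(1)] by blast
    define n where "n = max n1 n2"
    have "\<parallel>T (tail n x)\<parallel> \<le> e * \<parallel>x\<parallel>" if x: "x \<in> lp" for x
    proof -
      let ?u = "T (tail n x)"
      have u: "?u \<in> lp" using x To by simp
      have 1: "\<parallel>cut m ?u\<parallel> \<le> d * \<parallel>x\<parallel>" using n1[OF _ x, of n] by (simp add: n_def)
      have 2: "\<parallel>B ?u\<parallel> \<le> d * \<parallel>x\<parallel>" using n2[OF _ x, of n] by (simp add: n_def)
      have "cut m (tail m ?u) = 0" by (auto simp: rmul_def indicator_def fun_apply)
      then have "\<parallel>?u\<parallel> \<le> \<parallel>cut m ?u\<parallel> + (\<parallel>B ?u\<parallel> + b * \<parallel>cut m ?u\<parallel>) / \<kappa>"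
        unfolding b_def using u by (intro cut_off_estimate[OF Bo u low(1)] low(2)) auto
      also have "\<dots> \<le> d * \<parallel>x\<parallel> + (d * \<parallel>x\<parallel> + b * (d * \<parallel>x\<parallel>)) / \<kappa>"
        using low(1) b 1 2 by (intro add_mono divide_right_mono mult_left_mono) auto
      also have "\<dots> = (d + (d + b * d) / \<kappa>) * \<parallel>x\<parallel>" by (simp add: distrib_right add_divide_distrib)
      finally show ?thesis unfolding d(2) .
    qed
    then show ?thesis by blast
  qed
  have "T \<in> compacts"
  proof (rule compact_limit[OF To])
    fix e :: real assume "e > 0"
    then obtain n where n: "\<And>x. x \<in> lp \<Longrightarrow> \<parallel>T (tail n x)\<parallel> \<le> e * \<parallel>x\<parallel>" using tailT by blast
    have "T \<circ> mop p (indicat_real (cube n)) \<in> compacts" by (rule Pops_compact(1)[OF T compact_cut])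
    moreover have "\<parallel>T x - (T \<circ> mop p (indicat_real (cube n))) x\<parallel> \<le> e * \<parallel>x\<parallel>" if x: "x \<in> lp" for x
    proof -
      have "T (tail n x) = T x - (T \<circ> mop p (indicat_real (cube n))) x"
        using ops_diff[OF To x lp_cut, of n x] x unfolding tail_eq_diff by (simp add: mop_apply)
      from arg_cong[OF this, of "lp_norm p"] n[OF x] show ?thesis by simp
    qed
    ultimately show "\<exists>K\<in>compacts. \<forall>x\<in>lp. \<parallel>T x - K x\<parallel> \<le> e * \<parallel>x\<parallel>" by blast
  qed
  then show ?thesis by (simp add: T_def)
qed

text \<open>Subtracting C composed with a cutoff leaves C on tails, and there B C is nearly the
  identity. The lower bound at infinity then gives norm nearly 1/\<kappa>, however large the norm of
  C is.\<close>

lemma regulariser_norm: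
  fixes B :: "('n::finite, 'x::complex_banach) oper"
  assumes B: "B \<in> Pops" and C: "C \<in> Pops" "(B \<circ> C) - id_op p \<in> compacts"
    and low: "0 < \<kappa>" "\<And>y. y \<in> lp \<Longrightarrow> cut m y = 0 \<Longrightarrow> \<kappa> * \<parallel>y\<parallel> \<le> \<parallel>B y\<parallel>"
    and e: "0 < e"
  shows "\<exists>K\<in>compacts. opn (K + C) \<le> 1 / \<kappa> + e"
proof -
  note Bo = Pops_ops[OF B] and Co = Pops_ops[OF C(1)]
  define b where "b = opn B"
  have b: "0 \<le> b" using opn_nonneg[OF Bo] by (simp add: b_def)
  \<comment> \<open>As in \<open>left_regulariser\<close>, but the image under B is now about x
    instead of 0, which contributes the main term 1/\<kappa>.\<close>
  define d where "d = e / (1 + (1 + b) / \<kappa>)"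
  have den: "0 < 1 + (1 + b) / \<kappa>" using low(1) b by (intro add_pos_nonneg) auto
  have d: "d > 0" "d + (1 + d + b * d) / \<kappa> = 1 / \<kappa> + e"
  proof -
    show "d > 0" using e den by (simp add: d_def)
    have "d * (1 + (1 + b) / \<kappa>) = e" using den by (simp add: d_def)
    then show "d + (1 + d + b * d) / \<kappa> = 1 / \<kappa> + e" by (simp add: algebra_simps add_divide_distrib)
  qed
  obtain n1 where n1: "\<And>n x. n1 \<le> n \<Longrightarrow> x \<in> lp \<Longrightarrow> \<parallel>cut m (C (tail n x))\<parallel> \<le> d * \<parallel>x\<parallel>"
    using Pops_cut_tail[OF C(1) d(1), of m] by blast
  obtain n2 where n2: "\<And>n x. n2 \<le> n \<Longrightarrow> x \<in> lp \<Longrightarrow> \<parallel>((B \<circ> C) - id_op p) (tail n x)\<parallel> \<le> d * \<parallel>x\<parallel>"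
    using compactD(2)[OF C(2) d(1)] by blast
  define n where "n = max n1 n2"
  let ?P = "mop p (indicat_real (cube n))"
  have K: "- (C \<circ> ?P) \<in> compacts" by (intro compact_neg Pops_compact(1) C compact_cut)
  have "opn (- (C \<circ> ?P) + C) \<le> 1 / \<kappa> + e"
  proof (rule opn_le)
    show "0 \<le> 1 / \<kappa> + e" using low(1) e by simp
    fix x :: "('n, 'x) seq" assume x: "x \<in> lp"
    let ?u = "C (tail n x)"
    have u: "?u \<in> lp" using x Co by simp
    have eq: "(- (C \<circ> ?P) + C) x = ?u"
      using ops_diff[OF Co x lp_cut, of n x] x unfolding tail_eq_diff by (simp add: mop_apply)
    have 1: "\<parallel>cut m ?u\<parallel> \<le> d * \<parallel>x\<parallel>" using n1[OF _ x, of n] by (simp add: n_def)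
    have "\<parallel>B ?u - tail n x\<parallel> \<le> d * \<parallel>x\<parallel>" using n2[OF _ x, of n] x by (simp add: n_def id_op_apply)
    then have 2: "\<parallel>B ?u\<parallel> \<le> \<parallel>x\<parallel> + d * \<parallel>x\<parallel>"
      using nrm_triangle_sub[OF ops_mem[OF Bo u] lp_ind(1)[OF x], of "- cube n"] lp_ind(2)[OF x, of "- cube n"]
      by linarith
    have "cut m (tail m ?u) = 0" by (auto simp: rmul_def indicator_def fun_apply)
    then have "\<parallel>?u\<parallel> \<le> \<parallel>cut m ?u\<parallel> + (\<parallel>B ?u\<parallel> + b * \<parallel>cut m ?u\<parallel>) / \<kappa>"
      unfolding b_def using u by (intro cut_off_estimate[OF Bo u low(1)] low(2)) auto
    also have "\<dots> \<le> d * \<parallel>x\<parallel> + ((\<parallel>x\<parallel> + d * \<parallel>x\<parallel>) + b * (d * \<parallel>x\<parallel>)) / \<kappa>"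
      using low(1) b 1 2 by (intro add_mono divide_right_mono mult_left_mono) auto
    also have "\<dots> = (d + (1 + d + b * d) / \<kappa>) * \<parallel>x\<parallel>" by (simp add: distrib_right add_divide_distrib)
    finally show "\<parallel>(- (C \<circ> ?P) + C) x\<parallel> \<le> (1 / \<kappa> + e) * \<parallel>x\<parallel>" unfolding d(2) eq .
  qed
  then show ?thesis using K by blast
qed

end

section \<open>The quotient algebra\<close>

context lp_exponent
begin

lemma opn_coset_nonneg: "C \<in> ops \<Longrightarrow> K \<in> compacts \<Longrightarrow> 0 \<le> opn (K + C)"
  by (rule opn_nonneg, rule ops_plus(1)) (simp_all add: compactD(1))

lemma coset_eq: "compacts +>\<^bsub>P_op_ring p\<^esub> B = (\<lambda>K. K + B) ` compacts"
  by (auto simp: a_r_coset_def' P_op_ring_def op_ring_def)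

text \<open>The infimum over the coset need not be attained, hence the quantifier over
  \<open>e\<close>.\<close>

lemma coset_norm_le_iff:
  assumes "C \<in> ops"
  shows "coset_norm p (compacts +>\<^bsub>P_op_ring p\<^esub> C) \<le> c \<longleftrightarrow> (\<forall>e>0. \<exists>K\<in>compacts. opn (K + C) \<le> c + e)"
proof -
  have ne: "compacts \<noteq> {}" using compact_zero by blast
  have bd: "bdd_below ((\<lambda>K. opn (K + C)) ` compacts)"
    using opn_coset_nonneg[OF assms] by (intro bdd_belowI[of _ 0]) auto
  have eq: "coset_norm p (compacts +>\<^bsub>P_op_ring p\<^esub> C) = (INF K\<in>compacts. opn (K + C))"
    by (simp add: coset_norm_def coset_eq image_image)
  show ?thesis
    unfolding eq
  proof safe
    fix e :: real assume "(INF K\<in>compacts. opn (K + C)) \<le> c" "e > 0"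
    then have "(INF K\<in>compacts. opn (K + C)) < c + e" by linarith
    then show "\<exists>K\<in>compacts. opn (K + C) \<le> c + e"
      using cINF_less_iff[OF ne bd] less_imp_le by blast
  next
    assume h: "\<forall>e>0. \<exists>K\<in>compacts. opn (K + C) \<le> c + e"
    show "(INF K\<in>compacts. opn (K + C)) \<le> c"
    proof (rule field_le_epsilon)
      fix e :: real assume "e > 0"
      then obtain K where "K \<in> compacts" "opn (K + C) \<le> c + e" using h by blast
      then show "(INF K\<in>compacts. opn (K + C)) \<le> c + e" using cINF_lower[OF bd] order_trans by blast
    qed
  qed
qed

lemma ring_P_op_ring: "ring (P_op_ring p :: ('n::finite, 'x::complex_banach) oper ring)"
proof (rule ringI)
  show "abelian_group (P_op_ring p :: ('n, 'x) oper ring)"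
  proof (rule abelian_groupI)
    fix x :: "('n, 'x) oper" assume "x \<in> carrier (P_op_ring p)"
    then show "\<exists>y\<in>carrier (P_op_ring p). y \<oplus>\<^bsub>P_op_ring p\<^esub> x = \<zero>\<^bsub>P_op_ring p\<^esub>"
      by (intro bexI[of _ "- x"]) (auto simp: P_op_ring_def op_ring_def Pops_neg)
  qed (auto simp: P_op_ring_def op_ring_def Pops_plus compacts_subset_Pops compact_zero add.assoc add.commute)
  show "monoid (P_op_ring p :: ('n, 'x) oper ring)"
    by (rule monoidI) (auto simp: P_op_ring_def op_ring_def Pops_comp Pops_id id_op_comp Pops_ops comp_assoc)
next
  fix x y z :: "('n, 'x) oper"
  assume "x \<in> carrier (P_op_ring p)" "y \<in> carrier (P_op_ring p)" "z \<in> carrier (P_op_ring p)"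
  then have o: "x \<in> ops" "y \<in> ops" "z \<in> ops" by (auto simp: P_op_ring_def op_ring_def Pops_ops)
  have "(x + y) \<circ> z = (x \<circ> z) + (y \<circ> z)" by (rule ext) simp
  then show "(x \<oplus>\<^bsub>P_op_ring p\<^esub> y) \<otimes>\<^bsub>P_op_ring p\<^esub> z
      = x \<otimes>\<^bsub>P_op_ring p\<^esub> z \<oplus>\<^bsub>P_op_ring p\<^esub> y \<otimes>\<^bsub>P_op_ring p\<^esub> z"
    by (simp add: P_op_ring_def op_ring_def)
  have "z \<circ> (x + y) = (z \<circ> x) + (z \<circ> y)"
    by (rule ops_eqI) (use o in \<open>auto intro!: ops_comp(1) ops_plus(1) simp: ops_add\<close>)
  then show "z \<otimes>\<^bsub>P_op_ring p\<^esub> (x \<oplus>\<^bsub>P_op_ring p\<^esub> y)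
      = z \<otimes>\<^bsub>P_op_ring p\<^esub> x \<oplus>\<^bsub>P_op_ring p\<^esub> z \<otimes>\<^bsub>P_op_ring p\<^esub> y"
    by (simp add: P_op_ring_def op_ring_def)
qed

lemma ideal_compacts: "ideal compacts (P_op_ring p :: ('n::finite, 'x::complex_banach) oper ring)"
proof (rule idealI[OF ring_P_op_ring])
  interpret ring "P_op_ring p :: ('n, 'x) oper ring" by (rule ring_P_op_ring)
  show "subgroup compacts (add_monoid (P_op_ring p :: ('n, 'x) oper ring))"
  proof (rule add.subgroupI)
    show "compacts \<subseteq> carrier (P_op_ring p :: ('n, 'x) oper ring)"
      by (auto simp: P_op_ring_def op_ring_def compacts_subset_Pops)
    show "compacts \<noteq> ({} :: ('n, 'x) oper set)" using compact_zero by blast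
    fix a b :: "('n, 'x) oper" assume ab: "a \<in> compacts" "b \<in> compacts"
    then show "a \<oplus>\<^bsub>P_op_ring p\<^esub> b \<in> compacts" by (simp add: P_op_ring_def op_ring_def compact_plus)
    have "\<ominus>\<^bsub>P_op_ring p\<^esub> a = - a"
      using ab by (intro minus_equality) (auto simp: P_op_ring_def op_ring_def compacts_subset_Pops Pops_neg)
    then show "\<ominus>\<^bsub>P_op_ring p\<^esub> a \<in> compacts" using ab by (simp add: compact_neg)
  qed
qed (auto simp: P_op_ring_def op_ring_def Pops_compact)

text \<open>Noninvertible elements have inverse norm \<infinity>, so a finite bound encodes
  invertibility together with the norm estimate. Translating the quotient into representatives
  leaves a statement about operators only.\<close>

lemma essential_inverse_norm_le_iff:
  fixes B :: "('n::finite, 'x::complex_banach) oper"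
  assumes B: "B \<in> Pops"
  shows "inverse_norm (P_op_ring p Quot compacts) (coset_norm p) (compacts +>\<^bsub>P_op_ring p\<^esub> B) \<le> ereal c
    \<longleftrightarrow> (\<exists>C\<in>Pops. (B \<circ> C) - id_op p \<in> compacts \<and> (C \<circ> B) - id_op p \<in> compacts \<and>
         (\<forall>e>0. \<exists>K\<in>compacts. opn (K + C) \<le> c + e))" (is "?l \<longleftrightarrow> ?r")
proof -
  let ?R = "P_op_ring p :: ('n, 'x) oper ring"
  let ?Q = "?R Quot compacts"
  interpret ideal compacts ?R by (rule ideal_compacts)
  interpret Q: ring ?Q by (rule quotient_is_ring)
  let ?q = "\<lambda>T. compacts +>\<^bsub>?R\<^esub> T"
  have car: "T \<in> carrier ?R \<longleftrightarrow> T \<in> Pops" for T by (simp add: P_op_ring_def op_ring_def)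
  have qc: "?q T \<in> carrier ?Q" if "T \<in> Pops" for T
    using that car by (auto simp: FactRing_def A_RCOSETS_def')
  have qm: "?q S \<otimes>\<^bsub>?Q\<^esub> ?q T = ?q (S \<circ> T)" if "S \<in> Pops" "T \<in> Pops" for S T
    using rcoset_mult_add[of S T] that car by (simp add: FactRing_def P_op_ring_def op_ring_def)
  have q1: "\<one>\<^bsub>?Q\<^esub> = ?q (id_op p)" by (simp add: FactRing_def P_op_ring_def op_ring_def)
  have qeq: "?q S = ?q T \<longleftrightarrow> S - T \<in> compacts" if "S \<in> Pops" "T \<in> Pops" for S T
  proof
    assume eq: "?q S = ?q T"
    have "S \<in> ?q S" unfolding coset_eq using compact_zero by (intro image_eqI[of _ _ 0]) auto
    then have "S \<in> ?q T" by (simp only: eq)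
    then obtain K where "S = K + T" "K \<in> compacts" unfolding coset_eq by (rule imageE)
    then show "S - T \<in> compacts" by simp
  next
    assume d: "S - T \<in> compacts"
    have "(\<lambda>K. K + S) ` compacts \<subseteq> (\<lambda>K. K + T) ` compacts"
    proof safe
      fix K :: "('n, 'x) oper" assume K: "K \<in> compacts"
      have "K + S = (K + (S - T)) + T" by simp
      then show "K + S \<in> (\<lambda>K. K + T) ` compacts" using compact_plus[OF K d] by (rule image_eqI)
    qed
    moreover have "(\<lambda>K. K + T) ` compacts \<subseteq> (\<lambda>K. K + S) ` compacts"
    proof safe
      fix K :: "('n, 'x) oper" assume K: "K \<in> compacts"
      have "K + T = (K - (S - T)) + S" by simp
      then show "K + T \<in> (\<lambda>K. K + S) ` compacts" using compact_diff[OF K d] by (rule image_eqI)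
    qed
    ultimately show "?q S = ?q T" unfolding coset_eq by (rule subset_antisym)
  qed
  show ?thesis
  proof
    assume l: ?l
    then have U: "?q B \<in> Units ?Q" by (auto simp: inverse_norm_def split: if_splits)
    then have "inv\<^bsub>?Q\<^esub> (?q B) \<in> carrier ?Q" by simp
    then obtain C where C: "C \<in> Pops" "inv\<^bsub>?Q\<^esub> (?q B) = ?q C"
      using car by (auto simp: FactRing_def A_RCOSETS_def')
    have "?q (B \<circ> C) = ?q (id_op p)" "?q (C \<circ> B) = ?q (id_op p)"
      using Q.Units_r_inv[OF U] Q.Units_l_inv[OF U] unfolding C(2) q1 qm[OF B C(1)] qm[OF C(1) B] by auto
    then have "(B \<circ> C) - id_op p \<in> compacts" "(C \<circ> B) - id_op p \<in> compacts"
      using qeq Pops_comp[OF B C(1)] Pops_comp[OF C(1) B] Pops_id by auto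
    moreover have "coset_norm p (?q C) \<le> c" using l U C(2) by (simp add: inverse_norm_def)
    ultimately show ?r using C(1) coset_norm_le_iff[OF Pops_ops[OF C(1)]] by blast
  next
    assume ?r
    then obtain C where C: "C \<in> Pops" "(B \<circ> C) - id_op p \<in> compacts" "(C \<circ> B) - id_op p \<in> compacts"
      "\<forall>e>0. \<exists>K\<in>compacts. opn (K + C) \<le> c + e" by blast
    have 1: "?q B \<otimes>\<^bsub>?Q\<^esub> ?q C = \<one>\<^bsub>?Q\<^esub>" "?q C \<otimes>\<^bsub>?Q\<^esub> ?q B = \<one>\<^bsub>?Q\<^esub>"
      unfolding q1 qm[OF B C(1)] qm[OF C(1) B]
      using qeq Pops_comp[OF B C(1)] Pops_comp[OF C(1) B] Pops_id C by auto
    then have U: "?q B \<in> Units ?Q" using qc[OF B] qc[OF C(1)] by (auto simp: Units_def)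
    have "inv\<^bsub>?Q\<^esub> (?q B) = ?q C" using Q.inv_char[OF qc[OF B] qc[OF C(1)] 1] .
    then show ?l using U coset_norm_le_iff[OF Pops_ops[OF C(1)]] C(4) by (simp add: inverse_norm_def)
  qed
qed

lemma inverse_norm_le_iff:
  fixes L :: "('n::finite, 'x::complex_banach) oper"
  assumes L: "L \<in> ops"
  shows "inverse_norm (op_ring p) opn L \<le> ereal c
    \<longleftrightarrow> (\<exists>D\<in>ops. L \<circ> D = id_op p \<and> D \<circ> L = id_op p \<and> opn D \<le> c)" (is "?l \<longleftrightarrow> ?r")
proof -
  let ?R = "op_ring p :: ('n, 'x) oper ring"
  interpret monoid ?R by (rule monoidI) (auto simp: op_ring_def ops_comp id_op_comp comp_assoc)
  have R: "carrier ?R = ops" "mult ?R = (\<circ>)" "one ?R = id_op p" by (simp_all add: op_ring_def)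
  show ?thesis
  proof
    assume l: ?l
    then have U: "L \<in> Units ?R" by (auto simp: inverse_norm_def split: if_splits)
    then have "opn (inv\<^bsub>?R\<^esub> L) \<le> c" using l by (simp add: inverse_norm_def)
    then show ?r
      using Units_r_inv[OF U] Units_l_inv[OF U] Units_inv_closed[OF U] unfolding R by blast
  next
    assume ?r
    then obtain D where D: "D \<in> ops" "L \<circ> D = id_op p" "D \<circ> L = id_op p" "opn D \<le> c" by blast
    then have U: "L \<in> Units ?R" using L unfolding Units_def R by blast
    have "inv\<^bsub>?R\<^esub> L = D" using inv_char[of L D] L D unfolding R by blast
    then show ?l using U D(4) by (simp add: inverse_norm_def)
  qed
qed

text \<open>Both directions keep the same c: one loses an arbitrary e in the choice of a coset
  representative and removes it in the lower bound for L, the other loses e in the lower bound at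
  infinity and is allowed to by the infimum in the coset norm.\<close>

theorem essential_inverse_norm_iff_limit_ops:
  fixes B :: "('n::finite, 'x::complex_banach) oper"
  assumes rich: "rich p B" and sc: "small_commutators B" and ac: "small_average_commutators B"
    and fp: "finite_propagation_limit B" and c: "0 < c"
  shows "inverse_norm (P_op_ring p Quot compacts) (coset_norm p) (compacts +>\<^bsub>P_op_ring p\<^esub> B) \<le> ereal c
    \<longleftrightarrow> (\<forall>L\<in>op_spectrum p B. inverse_norm (op_ring p) opn L \<le> ereal c)"
proof -
  have B: "B \<in> Pops" using rich by (simp add: rich_def)
  note Bo = Pops_ops[OF B]
  have spec: "L \<in> ops" if "L \<in> op_spectrum p B" for L
    using that is_limit_opD(1) by (auto simp: op_spectrum_def)
  show ?thesis
    unfolding essential_inverse_norm_le_iff[OF B]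
  proof (intro iffI ballI)
    fix L assume ex: "\<exists>C\<in>Pops. (B \<circ> C) - id_op p \<in> compacts \<and> (C \<circ> B) - id_op p \<in> compacts \<and>
         (\<forall>e>0. \<exists>K\<in>compacts. opn (K + C) \<le> c + e)" and L: "L \<in> op_spectrum p B"
    obtain h where h: "is_limit_op p B h L" using L by (auto simp: op_spectrum_def)
    obtain C where C: "C \<in> Pops" "(B \<circ> C) - id_op p \<in> compacts" "(C \<circ> B) - id_op p \<in> compacts"
      "\<And>e. e > 0 \<Longrightarrow> \<exists>K\<in>compacts. opn (K + C) \<le> c + e" using ex by blast
    \<comment> \<open>Adding an element of the ideal preserves inverses modulo the ideal, so nearly
      optimal coset representatives are again regularisers.\<close>
    have reg: "\<exists>C'\<in>Pops. opn C' \<le> c + e \<and> (B \<circ> C') - id_op p \<in> compacts \<and> (C' \<circ> B) - id_op p \<in> compacts"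
      if "e > 0" for e
    proof -
      obtain K where K: "K \<in> compacts" "opn (K + C) \<le> c + e" using C(4)[OF \<open>e > 0\<close>] by blast
      note Ko = compactD(1)[OF K(1)] and Co = Pops_ops[OF C(1)]
      have "(B \<circ> (K + C)) - id_op p = (B \<circ> K) + ((B \<circ> C) - id_op p)"
        by (rule ops_eqI)
          (use Bo Co Ko in \<open>auto intro!: ops_comp(1) ops_plus(1) ops_minus(1) simp: ops_add\<close>)
      moreover have "((K + C) \<circ> B) - id_op p = (K \<circ> B) + ((C \<circ> B) - id_op p)"
        by (rule ext) simp
      moreover have "(B \<circ> K) + ((B \<circ> C) - id_op p) \<in> compacts" "(K \<circ> B) + ((C \<circ> B) - id_op p) \<in> compacts"
        using compact_plus[OF Pops_compact(1)[OF B K(1)] C(2)] compact_plus[OF Pops_compact(2)[OF B K(1)] C(3)] .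
      moreover have "K + C \<in> Pops" by (intro Pops_plus compacts_subset_Pops K C)
      ultimately show ?thesis using K(2) by metis
    qed
    have low: "\<parallel>x\<parallel> \<le> c * \<parallel>L x\<parallel>" if x: "x \<in> lp" for x
    proof (rule le_of_le_add_small[where M = "\<parallel>L x\<parallel>"])
      fix e :: real assume "e > 0"
      then obtain C' where C': "C' \<in> Pops" "opn C' \<le> c + e" "(C' \<circ> B) - id_op p \<in> compacts" using reg by blast
      show "\<parallel>x\<parallel> \<le> c * \<parallel>L x\<parallel> + e * \<parallel>L x\<parallel>"
        using limit_op_lower_bound[OF B sc C'(1,2,3) h x] by (simp add: distrib_right)
    qed
    \<comment> \<open>Surjectivity needs no sharp constant, so C is used with its own norm; the
      bound c on the inverse comes from \<open>low\<close>.\<close>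
    have sur: "\<exists>x\<in>lp. L x = y" if "y \<in> lp" for y
      using limit_op_surjective[OF B sc C(1) order_refl C(3,2) h that] .
    obtain D where "D \<in> ops" "L \<circ> D = id_op p" "D \<circ> L = id_op p" "opn D \<le> c"
      using inverse_of_bijective[OF spec[OF L] less_imp_le[OF c] low sur] by blast
    then show "inverse_norm (op_ring p) opn L \<le> ereal c" unfolding inverse_norm_le_iff[OF spec[OF L]] by blast
  next
    assume all: "\<forall>L\<in>op_spectrum p B. inverse_norm (op_ring p) opn L \<le> ereal c"
    have D: "\<exists>D\<in>ops. L \<circ> D = id_op p \<and> D \<circ> L = id_op p \<and> opn D \<le> c" if "L \<in> op_spectrum p B" for L
      using all that unfolding inverse_norm_le_iff[OF spec[OF that], symmetric] by blast
    have low: "\<parallel>x\<parallel> \<le> c * \<parallel>L x\<parallel>" if L: "L \<in> op_spectrum p B" and x: "x \<in> lp" for L x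
    proof -
      obtain D where D: "D \<in> ops" "D \<circ> L = id_op p" "opn D \<le> c" using D[OF L] by blast
      have "D (L x) = x" using fun_cong[OF D(2), of x] x by (simp add: id_op_apply)
      then show ?thesis using opn_bound'[OF D(1) ops_mem[OF spec[OF L] x] D(3)] by simp
    qed
    have inf: "\<exists>m. \<forall>y\<in>lp. cut m y = 0 \<longrightarrow> (1 / c - e) * \<parallel>y\<parallel> \<le> \<parallel>B y\<parallel>" if "e > 0" for e
      by (rule lower_bound_at_infinity[OF Bo ac rich c _ that]) (rule low)
    have rr: "\<exists>D\<in>ops. L \<circ> D = id_op p \<and> opn D \<le> c" if "L \<in> op_spectrum p B" for L
      using D[OF that] by blast
    obtain C where C: "C \<in> Pops" "(B \<circ> C) - id_op p \<in> compacts"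
      using right_regulariser[OF B fp rich c rr] by blast
    have "(C \<circ> B) - id_op p \<in> compacts"
    proof -
      \<comment> \<open>Any loss below 1/c would do here, since only a positive lower bound at
        infinity is needed to make C two-sided.\<close>
      have "1 / (2 * c) > 0" using c by simp
      from inf[OF this] obtain m where "\<And>y. y \<in> lp \<Longrightarrow> cut m y = 0 \<Longrightarrow> (1 / c - 1 / (2 * c)) * \<parallel>y\<parallel> \<le> \<parallel>B y\<parallel>" by blast
      moreover have "0 < 1 / c - 1 / (2 * c)" using c by (simp add: field_simps)
      ultimately show ?thesis by (intro left_regulariser[OF B C])
    qed
    moreover have "\<exists>K\<in>compacts. opn (K + C) \<le> c + e" if e: "e > 0" for e
    proof -
      \<comment> \<open>Slightly below 1/c, with 1/\<kappa> = c + e/2;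
        \<open>regulariser_norm\<close> adds the other half of e.\<close>
      define \<kappa> where "\<kappa> = 1 / (c + e / 2)"
      have ce: "0 < c + e / 2" using c e by simp
      have \<kappa>: "0 < \<kappa>" "1 / \<kappa> = c + e / 2" using ce by (auto simp: \<kappa>_def)
      have "\<kappa> < 1 / c" unfolding \<kappa>_def using c e by (simp add: field_simps)
      then obtain m where m: "\<And>y. y \<in> lp \<Longrightarrow> cut m y = 0 \<Longrightarrow> (1 / c - (1 / c - \<kappa>)) * \<parallel>y\<parallel> \<le> \<parallel>B y\<parallel>"
        using inf[of "1 / c - \<kappa>"] by auto
      have e2: "0 < e / 2" using e by simp
      show ?thesis using regulariser_norm[OF B C \<kappa>(1) _ e2, of m] m unfolding \<kappa>(2) by (simp add: add.commute)
    qed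
    ultimately show "\<exists>C\<in>Pops. (B \<circ> C) - id_op p \<in> compacts \<and> (C \<circ> B) - id_op p \<in> compacts \<and>
         (\<forall>e>0. \<exists>K\<in>compacts. opn (K + C) \<le> c + e)" using C by blast
  qed
qed

section \<open>Subtracting scalars, and the pseudospectral identity\<close>

abbreviation scalar :: "complex \<Rightarrow> ('n::finite, 'x::complex_banach) oper" where
  "scalar z \<equiv> op_scaleC z (id_op p)"

lemma scalar_ops: "scalar z \<in> ops"
  by (intro ops_op_scaleC id_op_mem)

lemma conj_shift_minus_scalar:
  assumes "A \<in> ops" shows "conj_shift k (A - scalar z) = conj_shift k A - scalar z"
proof (rule ops_eqI)
  show "conj_shift k (A - scalar z) \<in> ops" using assms by (intro conj_shift_ops ops_minus(1) scalar_ops)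
  show "conj_shift k A - scalar z \<in> ops" using assms by (intro conj_shift_ops ops_minus(1) scalar_ops)
  fix x :: "('a, 'b) seq" assume x: "x \<in> lp"
  have "conj_shift k (scalar z) x = scalar z x"
    using x by (simp add: op_scaleC_apply id_op_apply shift_lp ops_scaleC[OF shift_mem] shift_cancel)
  then show "conj_shift k (A - scalar z) x = (conj_shift k A - scalar z) x"
    using conj_shift_diff[OF assms scalar_ops x, of k z] by (simp only: oper_apply)
qed

lemma limit_op_minus_scalar:
  assumes A: "A \<in> ops" and lim: "is_limit_op p A h L"
  shows "is_limit_op p (A - scalar z) h (L - scalar z)"
proof -
  have eq: "(conj_shift (h n) A - scalar z) - (L - scalar z) = conj_shift (h n) A - L" for n by simp
  have P: "P_strong_limit p (\<lambda>n. conj_shift (h n) A - scalar z) (L - scalar z)"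
    unfolding P_strong_limit_def eq
    using is_limit_opD(3)[OF lim] is_limit_opD(1)[OF lim] conj_shift_ops[OF A] unfolding P_strong_limit_def
    by (blast intro: ops_minus(1) scalar_ops)
  then show ?thesis
    using lim unfolding is_limit_op_def conj_shift_minus_scalar[OF A] by simp
qed

lemma minus_scalar_cancel: "(A - scalar z) - scalar (- z) = A"
proof
  fix x
  have "seq_scaleC (- z) y = - seq_scaleC z y" for y :: "('a, 'b) seq"
  proof
    fix i show "seq_scaleC (- z) y i = (- seq_scaleC z y) i"
      using scaleC_scaleC[of "-1" z "y i"] by (simp add: seq_scaleC_def fun_apply scaleC_minus_one)
  qed
  then show "((A - scalar z) - scalar (- z)) x = A x" by (simp add: op_scaleC_apply)
qed

text \<open>Conjugation by shifts fixes scalars, so limit operators move along with A. The reverse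
  inclusion is the same fact applied to A - z I with the scalar -z.\<close>

lemma op_spectrum_minus_scalar:
  assumes A: "A \<in> ops"
  shows "op_spectrum p (A - scalar z) = (\<lambda>L. L - scalar z) ` op_spectrum p A"
proof safe
  fix L assume "L \<in> op_spectrum p (A - scalar z)"
  then obtain h where "is_limit_op p (A - scalar z) h L" by (auto simp: op_spectrum_def)
  from limit_op_minus_scalar[OF ops_minus(1)[OF A scalar_ops] this, of "- z"]
  have "L - scalar (- z) \<in> op_spectrum p A" unfolding minus_scalar_cancel by (auto simp: op_spectrum_def)
  moreover have "L = (L - scalar (- z)) - scalar z" using minus_scalar_cancel[of L "- z"] by simp
  ultimately show "L \<in> (\<lambda>L. L - scalar z) ` op_spectrum p A" by blast
qed (use limit_op_minus_scalar[OF A] in \<open>auto simp: op_spectrum_def\<close>)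

lemma rich_minus_scalar:
  assumes "rich p A" shows "rich p (A - scalar z)"
proof -
  have A: "A \<in> Pops" using assms by (simp add: rich_def)
  have "A - scalar z \<in> Pops" by (intro Pops_minus Pops_op_scaleC Pops_id A)
  then show ?thesis using assms limit_op_minus_scalar[OF Pops_ops[OF A]] unfolding rich_def by metis
qed

end

theorem theorem4p3:
  fixes p :: ereal
    and A :: "('n::finite, 'x::complex_banach) oper"
    and \<epsilon> :: real
  assumes "p = 0 \<or> 1 \<le> p"
    and "\<exists>v :: 'x. v \<noteq> 0"
    and "A \<in> rich_band_dominated_ops p"
    and "\<epsilon> > 0"
  shows "ess_pseudospectrum p \<epsilon> A = (\<Union>B\<in>op_spectrum p A. pseudospectrum p \<epsilon> B)"
proof -
  interpret lp_exponent p by unfold_locales (rule assms(1))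
  have A: "A \<in> band_dominated_ops p" "rich p A" using assms(3) by (auto simp: rich_band_dominated_ops_def)
  note st = band_dominated_structure[OF A(1)]
  have "inverse_norm (P_op_ring p Quot compacts) (coset_norm p) (compacts +>\<^bsub>P_op_ring p\<^esub> (A - scalar z)) \<le> ereal (1 / \<epsilon>)
    \<longleftrightarrow> (\<forall>L\<in>op_spectrum p A. inverse_norm (op_ring p) opn (L - scalar z) \<le> ereal (1 / \<epsilon>))" for z
  proof -
    have "0 < 1 / \<epsilon>" using assms(4) by simp
    from essential_inverse_norm_iff_limit_ops[OF rich_minus_scalar[OF A(2), of z]
        structure_minus_scalar(1)[OF st(1,2), of z] structure_minus_scalar(2)[OF st(1,3), of z]
        structure_minus_scalar(3)[OF st(1,4), of z] this]
    show ?thesis unfolding op_spectrum_minus_scalar[OF st(1)] by simp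
  qed
  then show ?thesis
    unfolding ess_pseudospectrum_def pseudospectrum_def by (auto simp: not_le[symmetric])
qed

end
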